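(* Fix $\delta>0$ and $E>0$. Suppose that, for some $R_0>0$ independent of $h$, $V=V(\cdot\,;h)$ is supported in $[-R_0,R_0]$. Set $h_0=2^{-1}\delta^{-1}(1+R_0)^{-\delta}$. There exists $C>0$, depending only on $R_0$, $E$, and $\delta$, so that for all $\varepsilon\in(0,1]$, all $h\in(0,h_0]$, and both choices of sign $\pm$, $$\big\|(|x|+1)^{-\frac{1+\delta}{2}}\mathbf 1_{>R_0}(P-E\pm i\varepsilon)^{-1}\mathbf 1_{>R_0}(|x|+1)^{-\frac{1+\delta}{2}}\big\|_{L^2(\mathbb R)\to L^2(\mathbb R)}\le\frac{C}{h},$$ where $\mathbf 1_{>R_0}$ denotes the characteristic function of $\{x\in\mathbb R:|x|>R_0\}$.
   Context: For each $h>0$, $V=V(x;h)$ is a real, finite signed Borel measure on $\mathbb R$, which may depend on $h$. Each $u\in H^1(\mathbb R)$ has a unique bounded continuous representative $u_c$; the product of $u$ and $V$ is the complex Borel measure $u_cV$, and one defines, in the sense of distributions on $\mathbb R$, $$Pu=P(h)u=-h^2\partial_x^2u+u_cV .$$ The domain of $P$ is $\mathcal D=\{u\in H^1(\mathbb R): u'\in L^\infty(\mathbb R),\ Pu\in L^2(\mathbb R)\}$; with this domain $P$ is self-adjoint on $L^2(\mathbb R)$. The weights and characteristic functions act as multiplication operators. *)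

theory Defs
  imports "HOL-Analysis.Analysis"
begin

section \<open>Finite signed Borel measures on the real line\<close>

definition finite_signed_borel_measure :: "(real set \<Rightarrow> real) \<Rightarrow> bool" where
  "finite_signed_borel_measure \<mu> \<longleftrightarrow>
     (\<forall>A :: nat \<Rightarrow> real set. range A \<subseteq> sets borel \<longrightarrow> disjoint_family A \<longrightarrow>
        (\<lambda>i. \<mu> (A i)) sums \<mu> (\<Union>i. A i))"

definition signed_supported_in :: "(real set \<Rightarrow> real) \<Rightarrow> real set \<Rightarrow> bool" where
  "signed_supported_in \<mu> K \<longleftrightarrow> (\<forall>A\<in>sets borel. A \<inter> K = {} \<longrightarrow> \<mu> A = 0)"

text \<open>The parts of the Jordan decomposition \<open>\<mu> = \<mu>\<^sub>+ - \<mu>\<^sub>-\<close>. Here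
  \<open>\<mu>\<^sub>+ A\<close> is the supremum of \<open>\<mu> B\<close> over Borel subsets \<open>B\<close> of \<open>A\<close>; \<^const>\<open>ennreal\<close> sends
  negative values to 0, which is harmless since \<open>B = {}\<close> contributes 0.\<close>

definition pos_variation :: "(real set \<Rightarrow> real) \<Rightarrow> real measure" where
  "pos_variation \<mu> = measure_of UNIV (sets borel)
     (\<lambda>A. SUP B\<in>{B \<in> sets borel. B \<subseteq> A}. ennreal (\<mu> B))"

definition neg_variation :: "(real set \<Rightarrow> real) \<Rightarrow> real measure" where
  "neg_variation \<mu> = pos_variation (\<lambda>A. - \<mu> A)"

definition signed_integral :: "(real set \<Rightarrow> real) \<Rightarrow> (real \<Rightarrow> complex) \<Rightarrow> complex" where
  "signed_integral \<mu> f =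
     (LINT x|pos_variation \<mu>. f x) - (LINT x|neg_variation \<mu>. f x)"

section \<open>Function spaces and weak derivatives\<close>

text \<open>Elements of \<open>L\<^sup>2\<close> are represented by functions; equality in \<open>L\<^sup>2\<close> is equality almost
  everywhere.\<close>

definition L2 :: "(real \<Rightarrow> complex) set" where
  "L2 = {f \<in> borel_measurable lborel. integrable lborel (\<lambda>x. (cmod (f x))\<^sup>2)}"

definition L2_norm :: "(real \<Rightarrow> complex) \<Rightarrow> real" where
  "L2_norm f = sqrt (LINT x|lborel. (cmod (f x))\<^sup>2)"

definition Linf :: "(real \<Rightarrow> complex) set" where
  "Linf = {f \<in> borel_measurable lborel. \<exists>K. AE x in lborel. cmod (f x) \<le> K}"

definition L1_loc :: "(real \<Rightarrow> complex) set" where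
  "L1_loc = {f \<in> borel_measurable lborel. \<forall>a b. set_integrable lborel {a..b} f}"

definition vderiv :: "(real \<Rightarrow> complex) \<Rightarrow> real \<Rightarrow> complex" where
  "vderiv \<phi> x = vector_derivative \<phi> (at x)"

definition test_functions :: "(real \<Rightarrow> complex) set" where
  "test_functions = {\<phi>. (\<forall>n x. (vderiv ^^ n) \<phi> differentiable (at x)) \<and>
                        (\<exists>r. \<forall>x. r < \<bar>x\<bar> \<longrightarrow> \<phi> x = 0)}"

definition weak_derivative :: "(real \<Rightarrow> complex) \<Rightarrow> (real \<Rightarrow> complex) \<Rightarrow> bool" where
  "weak_derivative u v \<longleftrightarrow> u \<in> L1_loc \<and> v \<in> L1_loc \<and>
     (\<forall>\<phi>\<in>test_functions. (LINT x|lborel. u x * vderiv \<phi> x) = - (LINT x|lborel. v x * \<phi> x))"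

definition H1 :: "(real \<Rightarrow> complex) set" where
  "H1 = {u \<in> L2. \<exists>v\<in>L2. weak_derivative u v}"

definition cont_rep :: "(real \<Rightarrow> complex) \<Rightarrow> real \<Rightarrow> complex" where
  "cont_rep u = (THE c. continuous_on UNIV c \<and> bounded (range c) \<and> (AE x in lborel. u x = c x))"

section \<open>The operator \<open>P\<close>\<close>

text \<open>Distributions are functionals on test functions; the pairing is bilinear
  (no complex conjugation).\<close>

definition dist_of :: "(real \<Rightarrow> complex) \<Rightarrow> (real \<Rightarrow> complex) \<Rightarrow> complex" where
  "dist_of f \<phi> = (LINT x|lborel. f x * \<phi> x)"

definition P_dist :: "(real set \<Rightarrow> real) \<Rightarrow> real \<Rightarrow> (real \<Rightarrow> complex) \<Rightarrow> (real \<Rightarrow> complex) \<Rightarrow> complex" where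
  "P_dist V h u \<phi> = - complex_of_real (h\<^sup>2) * dist_of u (vderiv (vderiv \<phi>))
                    + signed_integral V (\<lambda>x. cont_rep u x * \<phi> x)"

definition P_domain :: "(real set \<Rightarrow> real) \<Rightarrow> real \<Rightarrow> (real \<Rightarrow> complex) set" where
  "P_domain V h = {u \<in> H1. (\<exists>v\<in>Linf. weak_derivative u v) \<and>
                           (\<exists>f\<in>L2. \<forall>\<phi>\<in>test_functions. P_dist V h u \<phi> = dist_of f \<phi>)}"

definition solves_shifted ::
    "(real set \<Rightarrow> real) \<Rightarrow> real \<Rightarrow> complex \<Rightarrow> (real \<Rightarrow> complex) \<Rightarrow> (real \<Rightarrow> complex) \<Rightarrow> bool" where
  "solves_shifted V h z u g \<longleftrightarrow> u \<in> P_domain V h \<and>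
     (\<forall>\<phi>\<in>test_functions. P_dist V h u \<phi> - z * dist_of u \<phi> = dist_of g \<phi>)"

text \<open>\<open>P - z\<close> maps its domain bijectively onto \<open>L\<^sup>2\<close>, modulo equality almost everywhere.\<close>

definition P_shift_bijective :: "(real set \<Rightarrow> real) \<Rightarrow> real \<Rightarrow> complex \<Rightarrow> bool" where
  "P_shift_bijective V h z \<longleftrightarrow>
     (\<forall>g\<in>L2. \<exists>u. solves_shifted V h z u g \<and>
        (\<forall>w. solves_shifted V h z w g \<longrightarrow> (AE x in lborel. w x = u x)))"

text \<open>\<open>(P - z)\<^sup>-\<^sup>1 g\<close>, determined almost everywhere when \<^const>\<open>P_shift_bijective\<close> holds; otherwise
  the value of the choice operator carries no information.\<close>

definition resolvent :: "(real set \<Rightarrow> real) \<Rightarrow> real \<Rightarrow> complex \<Rightarrow> (real \<Rightarrow> complex) \<Rightarrow> real \<Rightarrow> complex" where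
  "resolvent V h z g = (SOME u. solves_shifted V h z u g)"

section \<open>Multiplication operators and the operator norm\<close>

definition mult_op :: "(real \<Rightarrow> real) \<Rightarrow> (real \<Rightarrow> complex) \<Rightarrow> real \<Rightarrow> complex" where
  "mult_op m f x = complex_of_real (m x) * f x"

definition weight :: "real \<Rightarrow> real \<Rightarrow> real" where
  "weight \<delta> x = (\<bar>x\<bar> + 1) powr (- ((1 + \<delta>) / 2))"

definition exterior_ind :: "real \<Rightarrow> real \<Rightarrow> real" where
  "exterior_ind R = indicator {x. R < \<bar>x\<bar>}"

text \<open>The value is \<open>\<infinity>\<close> when \<open>T\<close> does not map the unit ball of \<open>L\<^sup>2\<close> into \<open>L\<^sup>2\<close>.\<close>

definition L2_opnorm :: "((real \<Rightarrow> complex) \<Rightarrow> real \<Rightarrow> complex) \<Rightarrow> ennreal" where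
  "L2_opnorm T = (SUP f\<in>{f \<in> L2. L2_norm f \<le> 1}. if T f \<in> L2 then ennreal (L2_norm (T f)) else \<infinity>)"

end

(* The resolvent is bounded in the exterior independently of the potential because the multiplier
   W(x) = (1 + R)^-d - (1 + |x|)^-d vanishes at the edge of the support of V and increases outwards.
   Integrating the derivative of W (h^2 |u'|^2 + E |u|^2) over each half line gives no boundary term
   and produces the weighted norm of u; the term with eps is absorbed by
   eps ||u||^2 = |Im <g, u>| together with the identity obtained from the multiplier W^2 u.
   A weak solution is turned into a pair (U, v) with U' = v and h^2 v a primitive of
   u V - g - z u by du Bois-Reymond's lemma, so that everything reduces to integration by parts.
   Existence: with mu^2 = -z / h^2, a solution is a fixed point u = G g - G (u V) of the free Green's
   operator, whose kernel exp (-mu |x - y|) is exp (mu (x - y)) plus a Volterra kernel vanishing on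
   the diagonal. *)

theory Submission
  imports Defs
begin

section \<open>Jordan decomposition\<close>

text \<open>\<open>V\<close> may have atoms, so U' jumps, and the energy h^2 |U'|^2 cannot be
  followed through the support with a bound uniform in \<open>V\<close>. Both multipliers therefore
  live on one half line and vanish at its end; the price is that |U'|^2 is controlled only with the
  weight W^2, which is all that the error of size eps asks for. The exponent in W is dictated by W'
  = d (1 + |x|)^(-1-d), which is d times the square of the weight in the theorem. The bound on
  \<open>h\<close> makes h W' at most 1/2, so that the term from differentiating W^2 is absorbed.
  Only Im <g, u> has to see the whole line: the form identity is wanted for a \<open>U\<close> that
  is no test function, and it is obtained by integrating by parts separately on the left, on the
  support and on the right. The boundary terms cancel and the potential contributes a real number.
  The imaginary part also gives injectivity, and injectivity makes the one scalar equation of the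
  existence proof solvable. Invertibility of P - z is thus proved, not taken from
  self-adjointness.\<close>

context
  fixes \<mu> :: "real set \<Rightarrow> real"
  assumes fin: "finite_signed_borel_measure \<mu>"
begin

lemma signed_measure_sums:
  "range A \<subseteq> sets borel \<Longrightarrow> disjoint_family A \<Longrightarrow> (\<lambda>i. \<mu> (A i)) sums \<mu> (\<Union>i. A i)"
  for A :: "nat \<Rightarrow> real set"
  using fin unfolding finite_signed_borel_measure_def by blast

lemma signed_measure_empty: "\<mu> {} = 0"
proof -
  have "(\<lambda>i::nat. \<mu> {}) sums \<mu> (\<Union>i::nat. {})"
    by (rule signed_measure_sums) (auto simp: disjoint_family_on_def)
  then have "summable (\<lambda>i::nat. \<mu> {})" by (rule sums_summable)
  then show ?thesis using summable_const_iff by blast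
qed

lemma signed_measure_Un:
  assumes "A \<in> sets borel" "B \<in> sets borel" "A \<inter> B = {}"
  shows "\<mu> (A \<union> B) = \<mu> A + \<mu> B"
proof -
  have "(\<lambda>i. \<mu> (binaryset A B i)) sums \<mu> (\<Union>i. binaryset A B i)"
    using assms by (intro signed_measure_sums)
      (auto simp: range_binaryset_eq disjoint_family_on_def binaryset_def)
  then have "(\<lambda>i. \<mu> (binaryset A B i)) sums \<mu> (A \<union> B)"
    by (simp add: UN_binaryset_eq)
  moreover have "(\<lambda>i. \<mu> (binaryset A B i)) sums (\<mu> A + \<mu> B)"
    by (rule binaryset_sums) (rule signed_measure_empty)
  ultimately show ?thesis using sums_unique2 by blast
qed

text \<open>\<open>measure_of\<close> replaces a set function that is not countably additive by the
  zero measure, so \<open>pos_variation\<close> carries information only once this supremum is known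
  to be a measure on the Borel sets. Naming it lets that be proved first.\<close>

definition pos_part :: "real set \<Rightarrow> ennreal" where
  "pos_part A = (SUP B\<in>{B \<in> sets borel. B \<subseteq> A}. ennreal (\<mu> B))"

lemma pos_part_upper: "B \<in> sets borel \<Longrightarrow> B \<subseteq> A \<Longrightarrow> ennreal (\<mu> B) \<le> pos_part A"
  unfolding pos_part_def by (rule SUP_upper) auto

lemma pos_part_mono: "A \<subseteq> B \<Longrightarrow> pos_part A \<le> pos_part B"
  unfolding pos_part_def by (rule SUP_subset_mono) auto

lemma pos_part_empty: "pos_part {} = 0"
  unfolding pos_part_def by (rule SUP_eq_const) (auto simp: signed_measure_empty)

lemma pos_part_superadditive:
  assumes "A \<inter> B = {}"
  shows "pos_part A + pos_part B \<le> pos_part (A \<union> B)"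
proof -
  have ne: "{C \<in> sets borel. C \<subseteq> A} \<noteq> {}" "{D \<in> sets borel. D \<subseteq> B} \<noteq> {}" by auto
  have *: "ennreal (\<mu> C) + ennreal (\<mu> D) \<le> pos_part (A \<union> B)"
    if "C \<in> sets borel" "C \<subseteq> A" "D \<in> sets borel" "D \<subseteq> B" for C D
  proof -
    have CD: "ennreal (\<mu> C + \<mu> D) \<le> pos_part (A \<union> B)"
      using that assms signed_measure_Un[of C D] pos_part_upper[of "C \<union> D" "A \<union> B"] by fastforce
    \<comment> \<open>\<open>ennreal\<close> truncates at 0: a negative summand contributes nothing,
      and then the other set alone, also a subset of \<open>A \<union> B\<close>, gives the
      bound.\<close>
    consider "\<mu> C \<ge> 0 \<and> \<mu> D \<ge> 0" | "\<mu> C < 0" | "\<mu> D < 0" by linarith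
    then show ?thesis
    proof cases
      case 1 then show ?thesis using CD by (simp add: ennreal_plus)
    next
      case 2 then show ?thesis using that pos_part_upper[of D "A \<union> B"] by (simp add: ennreal_neg le_supI2)
    next
      case 3 then show ?thesis using that pos_part_upper[of C "A \<union> B"] by (simp add: ennreal_neg le_supI1)
    qed
  qed
  have "pos_part A + pos_part B = (SUP C\<in>{C \<in> sets borel. C \<subseteq> A}. ennreal (\<mu> C) + pos_part B)"
    unfolding pos_part_def[of A] using ne by (simp add: ennreal_SUP_add_left)
  also have "\<dots> \<le> pos_part (A \<union> B)"
  proof (rule SUP_least, clarsimp)
    fix C assume C: "C \<in> sets borel" "C \<subseteq> A"
    have "ennreal (\<mu> C) + pos_part B = (SUP D\<in>{D \<in> sets borel. D \<subseteq> B}. ennreal (\<mu> C) + ennreal (\<mu> D))"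
      unfolding pos_part_def using ne by (simp add: ennreal_SUP_add_right)
    also have "\<dots> \<le> pos_part (A \<union> B)"
      by (rule SUP_least) (use C * in auto)
    finally show "ennreal (\<mu> C) + pos_part B \<le> pos_part (A \<union> B)" .
  qed
  finally show ?thesis .
qed

text \<open>Superadditivity on finite unions gives one inequality. For the other, a Borel subset of
  the union is cut along the \<open>A i\<close>, and countable additivity of \<open>\<mu>\<close> is
  passed to the limit.\<close>

lemma pos_part_suminf:
  fixes A :: "nat \<Rightarrow> real set"
  assumes A: "range A \<subseteq> sets borel" and disj: "disjoint_family A"
  shows "(\<Sum>i. pos_part (A i)) = pos_part (\<Union>i. A i)"
proof (rule antisym)
  have "(\<Sum>i<n. pos_part (A i)) \<le> pos_part (\<Union>i<n. A i)" for n
  proof (induction n)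
    case (Suc n)
    have "(\<Union>i<n. A i) \<inter> A n = {}"
    proof -
      have "A i \<inter> A n = {}" if "i < n" for i
        using disj that by (simp add: disjoint_family_on_def)
      then show ?thesis by auto
    qed
    then have "pos_part (\<Union>i<n. A i) + pos_part (A n) \<le> pos_part ((\<Union>i<n. A i) \<union> A n)"
      by (rule pos_part_superadditive)
    also have "(\<Union>i<n. A i) \<union> A n = (\<Union>i<Suc n. A i)" by (auto simp: lessThan_Suc)
    finally have "pos_part (\<Union>i<n. A i) + pos_part (A n) \<le> pos_part (\<Union>i<Suc n. A i)" .
    with add_right_mono[OF Suc, of "pos_part (A n)"] show ?case
      unfolding sum.lessThan_Suc by (rule order_trans)
  qed (simp add: pos_part_empty)
  moreover have "pos_part (\<Union>i<n. A i) \<le> pos_part (\<Union>i. A i)" for n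
    by (rule pos_part_mono) auto
  ultimately have "(\<Sum>i<n. pos_part (A i)) \<le> pos_part (\<Union>i. A i)" for n
    by (meson order_trans)
  then show "(\<Sum>i. pos_part (A i)) \<le> pos_part (\<Union>i. A i)"
    by (intro suminf_le_const) auto
next
  show "pos_part (\<Union>i. A i) \<le> (\<Sum>i. pos_part (A i))"
    unfolding pos_part_def[of "\<Union>i. A i"]
  proof (rule SUP_least, clarsimp)
    fix B :: "real set" assume B: "B \<in> sets borel" "B \<subseteq> (\<Union>i. A i)"
    have "(\<lambda>i. \<mu> (B \<inter> A i)) sums \<mu> (\<Union>i. B \<inter> A i)"
      using A disj B by (intro signed_measure_sums) (auto simp: disjoint_family_on_def)
    moreover have "(\<Union>i. B \<inter> A i) = B" using B by auto
    ultimately have "(\<lambda>n. \<Sum>i<n. \<mu> (B \<inter> A i)) \<longlonglongrightarrow> \<mu> B" by (simp add: sums_def)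
    then have lim: "(\<lambda>n. ennreal (\<Sum>i<n. \<mu> (B \<inter> A i))) \<longlonglongrightarrow> ennreal (\<mu> B)"
      by (rule tendsto_ennrealI)
    have "ennreal (\<Sum>i<n. \<mu> (B \<inter> A i)) \<le> (\<Sum>i. pos_part (A i))" for n
    proof -
      \<comment> \<open>\<open>ennreal\<close> is additive only on nonnegative reals, so the terms
        are first replaced by their positive parts.\<close>
      have "ennreal (\<Sum>i<n. \<mu> (B \<inter> A i)) \<le> ennreal (\<Sum>i<n. max 0 (\<mu> (B \<inter> A i)))"
        by (intro ennreal_leI sum_mono) auto
      also have "\<dots> = (\<Sum>i<n. ennreal (\<mu> (B \<inter> A i)))"
      proof -
        have "ennreal (max 0 (\<mu> (B \<inter> A i))) = ennreal (\<mu> (B \<inter> A i))" for i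
          by (cases "\<mu> (B \<inter> A i) \<ge> 0") (auto simp: max_def ennreal_neg)
        then show ?thesis by (subst sum_ennreal[symmetric]) auto
      qed
      also have "\<dots> \<le> (\<Sum>i<n. pos_part (A i))"
        using A B by (intro sum_mono pos_part_upper) auto
      also have "\<dots> \<le> (\<Sum>i. pos_part (A i))" by (rule sum_le_suminf) auto
      finally show ?thesis .
    qed
    then show "ennreal (\<mu> B) \<le> (\<Sum>i. pos_part (A i))"
      by (intro LIMSEQ_le_const2[OF lim]) auto
  qed
qed

lemma sets_pos_variation: "sets (pos_variation \<mu>) = sets borel"
  and space_pos_variation: "space (pos_variation \<mu>) = UNIV"
  unfolding pos_variation_def using sets.sigma_sets_eq[of "borel :: real measure"] by auto

lemma emeasure_pos_variation:
  assumes "A \<in> sets borel"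
  shows "emeasure (pos_variation \<mu>) A = pos_part A"
proof -
  have eq: "pos_variation \<mu> = measure_of UNIV (sets borel) pos_part"
    unfolding pos_variation_def pos_part_def ..
  have "sigma_algebra (UNIV :: real set) (sets borel)"
    using sets.sigma_algebra_axioms[of "borel :: real measure"] by simp
  then show ?thesis
    unfolding eq
    by (rule emeasure_measure_of_sigma)
      (use assms in \<open>auto simp: positive_def countably_additive_def pos_part_empty pos_part_suminf\<close>)
qed

text \<open>Real values alone force finite variation. A set of infinite positive part splits into
  two pieces, both of measure at least 1 in absolute value, one of which again has infinite positive
  part; iterating produces disjoint differences whose measures are summable yet do not tend to
  0.\<close>

lemma pos_part_finite: "pos_part UNIV < \<infinity>"
proof (rule ccontr)
  assume "\<not> pos_part UNIV < \<infinity>"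
  then have top: "pos_part UNIV = \<infinity>" by (simp add: not_less top_unique)
  define Q where "Q E \<longleftrightarrow> E \<in> sets borel \<and> pos_part E = \<infinity>" for E
  have step: "\<exists>E'. Q E' \<and> E' \<subseteq> E \<and> \<bar>\<mu> (E - E')\<bar> \<ge> 1" if QE: "Q E" for E
  proof -
    \<comment> \<open>This threshold makes \<open>\<mu> A\<close> exceed 1 and also keeps the
      absolute value of \<open>\<mu> E - \<mu> A\<close> at least 1, so either piece may be the one
      removed.\<close>
    have "ennreal (1 + \<bar>\<mu> E\<bar>) < pos_part E" using QE by (simp add: Q_def)
    then obtain A where A: "A \<in> sets borel" "A \<subseteq> E" "ennreal (1 + \<bar>\<mu> E\<bar>) < ennreal (\<mu> A)"
      unfolding pos_part_def less_SUP_iff by auto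
    then have gt: "1 + \<bar>\<mu> E\<bar> < \<mu> A"
      using ennreal_less_iff[of "1 + \<bar>\<mu> E\<bar>" "\<mu> A"] by simp
    have E: "E \<in> sets borel" using QE by (simp add: Q_def)
    have "\<mu> (A \<union> (E - A)) = \<mu> A + \<mu> (E - A)"
      using A E by (intro signed_measure_Un) auto
    moreover have "A \<union> (E - A) = E" using A by auto
    ultimately have EA: "\<bar>\<mu> (E - A)\<bar> \<ge> 1" using gt by simp
    have "pos_part E = pos_part A + pos_part (E - A)"
    proof -
      have "emeasure (pos_variation \<mu>) E
          = emeasure (pos_variation \<mu>) A + emeasure (pos_variation \<mu>) (E - A)"
        using A E \<open>A \<union> (E - A) = E\<close>
        by (subst plus_emeasure) (auto simp: sets_pos_variation)
      then show ?thesis using A E by (simp add: emeasure_pos_variation)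
    qed
    then consider "pos_part A = \<infinity>" | "pos_part (E - A) = \<infinity>"
      using QE by (auto simp: Q_def ennreal_add_eq_top)
    then show ?thesis
    proof cases
      case 1 then show ?thesis using A EA by (intro exI[of _ A]) (auto simp: Q_def)
    next
      case 2
      have "E - (E - A) = A" using A by auto
      then show ?thesis using A E 2 gt by (intro exI[of _ "E - A"]) (auto simp: Q_def)
    qed
  qed
  have "\<exists>E. \<forall>n. Q (E n) \<and> (E (Suc n) \<subseteq> E n \<and> \<bar>\<mu> (E n - E (Suc n))\<bar> \<ge> 1)"
    by (rule dependent_nat_choice) (use step top in \<open>auto simp: Q_def\<close>)
  then obtain E where E: "\<And>n. Q (E n)" "\<And>n. E (Suc n) \<subseteq> E n" "\<And>n. \<bar>\<mu> (E n - E (Suc n))\<bar> \<ge> 1"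
    by blast
  have dec: "m \<le> n \<Longrightarrow> E n \<subseteq> E m" for m n
    by (rule lift_Suc_antimono_le[of E]) (use E in auto)
  have "disjoint_family (\<lambda>n. E n - E (Suc n))"
    unfolding disjoint_family_on_def
  proof (clarsimp)
    fix m n :: nat assume "m \<noteq> n"
    then consider "Suc m \<le> n" | "Suc n \<le> m" by linarith
    then show "(E m - E (Suc m)) \<inter> (E n - E (Suc n)) = {}"
      by cases (use dec in blast)+
  qed
  then have "(\<lambda>n. \<mu> (E n - E (Suc n))) sums \<mu> (\<Union>n. E n - E (Suc n))"
    using E by (intro signed_measure_sums) (auto simp: Q_def)
  then have "(\<lambda>n. \<mu> (E n - E (Suc n))) \<longlonglongrightarrow> 0"
    by (rule summable_LIMSEQ_zero[OF sums_summable])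
  from LIMSEQ_D[OF this, of 1] obtain n where "norm (\<mu> (E n - E (Suc n)) - 0) < 1"
    by auto
  with E(3)[of n] show False by simp
qed

lemma finite_measure_pos_variation: "finite_measure (pos_variation \<mu>)"
  using pos_part_finite
  by (intro finite_measureI) (simp add: emeasure_pos_variation space_pos_variation less_top)

lemma pos_variation_null:
  assumes "signed_supported_in \<mu> K" "A \<in> sets borel" "A \<inter> K = {}"
  shows "emeasure (pos_variation \<mu>) A = 0"
proof -
  have "ennreal (\<mu> B) = 0" if "B \<in> sets borel" "B \<subseteq> A" for B
  proof -
    have "\<mu> B = 0" using assms that unfolding signed_supported_in_def by blast
    then show ?thesis by simp
  qed
  then have "pos_part A = 0"
    unfolding pos_part_def by (intro SUP_eq_const) auto
  then show ?thesis using assms by (simp add: emeasure_pos_variation)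
qed

end

lemma finite_signed_borel_measure_uminus:
  "finite_signed_borel_measure \<mu> \<Longrightarrow> finite_signed_borel_measure (\<lambda>A. - \<mu> A)"
  unfolding finite_signed_borel_measure_def
  by (intro allI impI sums_minus) simp

text \<open>All that is used of \<^term>\<open>signed_integral\<close> is that it is a
  difference of integrals against two finite measures living on \<open>[-R, R]\<close>.\<close>

locale compact_signed_measure =
  fixes V :: "real set \<Rightarrow> real" and R :: real
  assumes fin_V: "finite_signed_borel_measure V"
    and supp_V: "signed_supported_in V {-R..R}"
    and R_pos: "R > 0"
begin

abbreviation "Vp \<equiv> pos_variation V"
abbreviation "Vn \<equiv> neg_variation V"

lemma fin_V': "finite_signed_borel_measure (\<lambda>A. - V A)"
  by (rule finite_signed_borel_measure_uminus[OF fin_V])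

lemma supp_V': "signed_supported_in (\<lambda>A. - V A) {-R..R}"
  using supp_V by (simp add: signed_supported_in_def)

sublocale p: finite_measure Vp by (rule finite_measure_pos_variation[OF fin_V])
sublocale n: finite_measure Vn
  unfolding neg_variation_def by (rule finite_measure_pos_variation[OF fin_V'])

lemma sets_Vp [simp, measurable_cong]: "sets Vp = sets borel"
  by (rule sets_pos_variation[OF fin_V])
lemma sets_Vn [simp, measurable_cong]: "sets Vn = sets borel"
  unfolding neg_variation_def by (rule sets_pos_variation[OF fin_V'])

lemma space_Vp [simp]: "space Vp = UNIV"
  by (rule space_pos_variation[OF fin_V])
lemma space_Vn [simp]: "space Vn = UNIV"
  unfolding neg_variation_def by (rule space_pos_variation[OF fin_V'])

lemma AE_Vp: "AE x in Vp. \<bar>x\<bar> \<le> R"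
  by (rule AE_I[of _ _ "- {-R..R}"]) (auto intro!: pos_variation_null[OF fin_V supp_V])

lemma AE_Vn: "AE x in Vn. \<bar>x\<bar> \<le> R"
  by (rule AE_I[of _ _ "- {-R..R}"])
    (auto simp: neg_variation_def sets_pos_variation[OF fin_V']
        intro!: pos_variation_null[OF fin_V' supp_V'])

end

section \<open>Test functions\<close>

text \<open>Equivalent to the iterated condition in \<open>test_functions\<close>, but with the
  derivative peeled off next to \<open>f\<close>, which is what the inductions for sums, products
  and affine substitutions need.\<close>

primrec diff_upto :: "nat \<Rightarrow> (real \<Rightarrow> complex) \<Rightarrow> bool" where
  "diff_upto 0 f \<longleftrightarrow> (\<forall>x. f differentiable (at x))"
| "diff_upto (Suc n) f \<longleftrightarrow> (\<forall>x. f differentiable (at x)) \<and> diff_upto n (vderiv f)"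

lemma diff_upto_iff: "diff_upto n f \<longleftrightarrow> (\<forall>m\<le>n. \<forall>x. (vderiv ^^ m) f differentiable (at x))"
proof (induction n arbitrary: f)
  case (Suc n)
  show ?case
    by (auto simp: Suc.IH All_less_Suc2 less_Suc_eq_le[symmetric] funpow_Suc_right simp del: funpow.simps)
qed auto

lemma smooth_iff: "(\<forall>n x. (vderiv ^^ n) f differentiable (at x)) \<longleftrightarrow> (\<forall>n. diff_upto n f)"
  by (auto simp: diff_upto_iff)

lemma test_functions_iff:
  "\<phi> \<in> test_functions \<longleftrightarrow> (\<forall>n. diff_upto n \<phi>) \<and> (\<exists>r. \<forall>x. r < \<bar>x\<bar> \<longrightarrow> \<phi> x = 0)"
  by (simp add: test_functions_def smooth_iff)

lemma diff_upto_differentiable: "diff_upto n f \<Longrightarrow> f differentiable (at x)"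
  by (cases n) auto

lemma vderiv_works: "f differentiable (at x) \<Longrightarrow> (f has_vector_derivative vderiv f x) (at x)"
  by (simp add: vderiv_def vector_derivative_works)

lemma vderiv_eqI: "(\<And>x. (f has_vector_derivative g x) (at x)) \<Longrightarrow> vderiv f = g"
  by (auto simp: vderiv_def fun_eq_iff intro: vector_derivative_at)

lemma diff_upto_antimono: "diff_upto n f \<Longrightarrow> m \<le> n \<Longrightarrow> diff_upto m f"
  by (auto simp: diff_upto_iff)

lemma diff_upto_SucI:
  assumes "\<And>x. (f has_vector_derivative g x) (at x)" "diff_upto n g"
  shows "diff_upto (Suc n) f"
  using assms vderiv_eqI[OF assms(1)] by (auto intro: differentiableI_vector)

lemma diff_upto_add: "diff_upto n f \<Longrightarrow> diff_upto n g \<Longrightarrow> diff_upto n (\<lambda>x. f x + g x)"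
proof (induction n arbitrary: f g)
  case (Suc n)
  have "((\<lambda>x. f x + g x) has_vector_derivative vderiv f x + vderiv g x) (at x)" for x
    using Suc.prems by (auto intro!: derivative_eq_intros vderiv_works)
  moreover have "diff_upto n (\<lambda>x. vderiv f x + vderiv g x)"
    using Suc.prems by (intro Suc.IH) auto
  ultimately show ?case by (rule diff_upto_SucI)
qed auto

lemma diff_upto_mult: "diff_upto n f \<Longrightarrow> diff_upto n g \<Longrightarrow> diff_upto n (\<lambda>x. f x * g x)"
proof (induction n arbitrary: f g)
  case (Suc n)
  have "((\<lambda>x. f x * g x) has_vector_derivative f x * vderiv g x + vderiv f x * g x) (at x)" for x
    using Suc.prems by (auto intro!: has_vector_derivative_mult vderiv_works)
  moreover have "diff_upto n f" "diff_upto n g"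
    using Suc.prems diff_upto_antimono[of "Suc n" _ n] by (auto simp del: diff_upto.simps)
  then have "diff_upto n (\<lambda>x. f x * vderiv g x + vderiv f x * g x)"
    using Suc.prems by (intro diff_upto_add Suc.IH) auto
  ultimately show ?case by (rule diff_upto_SucI)
qed auto

lemma diff_upto_const: "diff_upto n (\<lambda>x. c)"
  by (induction n arbitrary: c) (auto simp: vderiv_eqI[where g = "\<lambda>x. 0"])

lemma diff_upto_affine: "diff_upto n f \<Longrightarrow> diff_upto n (\<lambda>x. f (a * x + b))"
proof (induction n arbitrary: f)
  have *: "((\<lambda>x. f (a * x + b)) has_vector_derivative complex_of_real a * vderiv f (a * x + b)) (at x)"
    if "\<And>x. f differentiable (at x)" for f :: "real \<Rightarrow> complex" and x
  proof -
    have "((\<lambda>x. a * x + b) has_vector_derivative a) (at x)"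
      by (auto intro!: derivative_eq_intros)
    from vector_diff_chain_at[OF this vderiv_works[OF that]]
    show ?thesis by (simp add: o_def scaleR_conv_of_real)
  qed
  {
    case 0 then show ?case using * by (auto intro: differentiableI_vector)
  next
    case (Suc n) then show ?case
      by (intro diff_upto_SucI[OF *] diff_upto_mult diff_upto_const) auto
  }
qed

subsection \<open>A cutoff function\<close>

text \<open>The classical family p(1/x) exp(-1/x), extended by 0. Carrying the polynomial as a
  parameter makes the family closed under differentiation, so smoothness is an induction with
  \<open>p\<close> arbitrary.\<close>

definition flat_exp :: "real poly \<Rightarrow> real \<Rightarrow> complex" where
  "flat_exp p x = (if x > 0 then complex_of_real (poly p (1 / x) * exp (- (1 / x))) else 0)"

lemma poly_exp_tendsto: "((\<lambda>t. poly p t * exp (- t)) \<longlongrightarrow> (0::real)) at_top"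
proof -
  have "((\<lambda>t. \<Sum>i\<le>degree p. coeff p i * (t ^ i / exp t)) \<longlongrightarrow> (\<Sum>i\<le>degree p. coeff p i * 0)) at_top"
    by (intro tendsto_sum tendsto_mult tendsto_const tendsto_power_div_exp_0)
  then show ?thesis
    by (simp add: poly_altdef exp_minus divide_inverse sum_distrib_right mult.assoc)
qed

text \<open>With y = 1/x one has d/dx = -y^2 d/dy, which sends p(y) exp(-y) to y^2 (p - p')(y)
  exp(-y). At the origin the derivative is 0 because exp(-y) beats every polynomial.\<close>

lemma flat_exp_deriv:
  "(flat_exp p has_vector_derivative flat_exp ([:0, 0, 1:] * (p - pderiv p)) x) (at x)"
proof -
  define q where "q = [:0, 0, 1:] * (p - pderiv p)"
  consider "x > 0" | "x < 0" | "x = 0" by linarith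
  then show ?thesis
  proof cases
    case 1
    have "((\<lambda>x. poly p (1 / x) * exp (- (1 / x))) has_real_derivative
       poly q (1 / x) * exp (- (1 / x))) (at x)"
    proof -
      have i: "((\<lambda>x. 1 / x) has_real_derivative - (1 / x\<^sup>2)) (at x)"
        using 1 by (auto intro!: derivative_eq_intros simp: power2_eq_square)
      have "((\<lambda>x. poly p (1 / x)) has_real_derivative poly (pderiv p) (1 / x) * - (1 / x\<^sup>2)) (at x)"
        by (rule DERIV_chain2[OF poly_DERIV i])
      moreover have "((\<lambda>x. exp (- (1 / x))) has_real_derivative exp (- (1 / x)) * - (- (1 / x\<^sup>2))) (at x)"
        by (rule DERIV_chain2[OF DERIV_exp DERIV_minus[OF i]])
      moreover have "poly (pderiv p) y * - (y * y) * exp (- y) + exp (- y) * - (- (y * y)) * poly p y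
          = poly q y * exp (- y)" for y
        unfolding q_def poly_mult poly_diff by (simp add: algebra_simps)
      from this[of "1 / x"] show ?thesis
        by (intro DERIV_mult[OF calculation, THEN DERIV_cong]) (simp add: power2_eq_square)
    qed
    then have "((\<lambda>x. complex_of_real (poly p (1 / x) * exp (- (1 / x)))) has_vector_derivative
       complex_of_real (poly q (1 / x) * exp (- (1 / x)))) (at x)"
      by (intro has_vector_derivative_of_real) (simp add: has_real_derivative_iff_has_vector_derivative)
    then have "(flat_exp p has_vector_derivative complex_of_real (poly q (1 / x) * exp (- (1 / x)))) (at x)"
      by (rule has_vector_derivative_transform_within_open[where S = "{0<..}"])
        (use 1 in \<open>auto simp: flat_exp_def\<close>)
    then show ?thesis unfolding q_def[symmetric] flat_exp_def[of q] using 1 by simp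
  next
    case 2
    have "((\<lambda>x. 0) has_vector_derivative (0::complex)) (at x)" by simp
    then have "(flat_exp p has_vector_derivative 0) (at x)"
      by (rule has_vector_derivative_transform_within_open[where S = "{..<0}"])
        (use 2 in \<open>auto simp: flat_exp_def\<close>)
    then show ?thesis unfolding q_def[symmetric] flat_exp_def[of q] using 2 by simp
  next
    case 3
    have "((\<lambda>y. flat_exp p y /\<^sub>R y) \<longlongrightarrow> 0) (at 0)"
    proof -
      have "((\<lambda>y. flat_exp p y /\<^sub>R y) \<longlongrightarrow> 0) (at_left 0)"
        by (rule tendsto_eventually) (auto simp: eventually_at_left_field flat_exp_def intro: exI[of _ "-1"])
      moreover have "((\<lambda>y. flat_exp p y /\<^sub>R y) \<longlongrightarrow> 0) (at_right 0)"
      proof -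
        \<comment> \<open>Dividing by \<open>y\<close> contributes one more factor 1/y to the
          polynomial, so the difference quotient is again of the same type.\<close>
        have "((\<lambda>y. complex_of_real (poly ([:0, 1:] * p) (inverse y) * exp (- inverse y))) \<longlongrightarrow> of_real 0)
            (at_right 0)"
          by (intro tendsto_of_real filterlim_compose[OF poly_exp_tendsto filterlim_inverse_at_top_right])
        then have "((\<lambda>y. complex_of_real (poly ([:0, 1:] * p) (inverse y) * exp (- inverse y))) \<longlongrightarrow> 0)
            (at_right 0)" by simp
        then show ?thesis
          by (rule Lim_transform_eventually)
            (auto simp: eventually_at_right_field flat_exp_def scaleR_conv_of_real divide_inverse
              intro!: exI[of _ 1])
      qed
      ultimately show ?thesis by (simp add: filterlim_at_split)
    qed
    then have "((\<lambda>y. norm (flat_exp p y /\<^sub>R y)) \<longlongrightarrow> 0) (at 0)"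
      by (rule tendsto_norm_zero)
    then have "((\<lambda>y. norm ((1 / norm (y - 0)) *\<^sub>R (flat_exp p y - (flat_exp p 0 + (y - 0) *\<^sub>R 0)))) \<longlongrightarrow> 0) (at 0)"
      by (simp add: flat_exp_def[of p 0] divide_inverse)
    then have "(flat_exp p has_vector_derivative 0) (at 0)"
      unfolding has_vector_derivative_def has_derivative_at2
      by (simp only: tendsto_norm_zero_iff) (simp add: bounded_linear_zero)
    then show ?thesis unfolding q_def[symmetric] flat_exp_def[of q] using 3 by simp
  qed
qed

lemma diff_upto_flat_exp: "diff_upto n (flat_exp p)"
  by (induction n arbitrary: p) (auto intro!: diff_upto_SucI flat_exp_deriv differentiableI_vector
      simp del: diff_upto.simps(2))

text \<open>Stretching by \<open>n\<close> leaves the support inside [a, b] while both factors tend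
  to 1 on the open interval, so one explicit family takes the place of mollified indicators.\<close>

definition bump :: "real \<Rightarrow> real \<Rightarrow> nat \<Rightarrow> real \<Rightarrow> complex" where
  "bump a b n x = flat_exp 1 (real n * x + (- real n * a)) * flat_exp 1 (- real n * x + real n * b)"

lemma bump_test: "n > 0 \<Longrightarrow> bump a b n \<in> test_functions"
proof -
  assume n: "n > 0"
  have "diff_upto m (bump a b n)" for m
    unfolding bump_def by (intro diff_upto_mult diff_upto_affine diff_upto_flat_exp)
  moreover have "bump a b n x = 0" if "\<bar>a\<bar> + \<bar>b\<bar> < \<bar>x\<bar>" for x
  proof -
    have "x \<le> a \<or> b \<le> x" using that by linarith
    then have "real n * x + (- real n * a) \<le> 0 \<or> - real n * x + real n * b \<le> 0"
      using n by (auto simp: mult_left_mono)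
    then show ?thesis by (auto simp: bump_def flat_exp_def)
  qed
  ultimately show ?thesis unfolding test_functions_iff by blast
qed

lemma norm_flat_exp_1: "cmod (flat_exp 1 x) \<le> 1"
  by (auto simp: flat_exp_def)

lemma norm_bump: "cmod (bump a b n x) \<le> 1"
  unfolding bump_def norm_mult using norm_flat_exp_1 by (intro mult_le_one) auto

lemma bump_outside: "x \<notin> {a<..<b} \<Longrightarrow> bump a b n x = 0"
proof -
  assume "x \<notin> {a<..<b}"
  then have "x \<le> a \<or> b \<le> x" by auto
  then have "real n * x + (- real n * a) \<le> 0 \<or> - real n * x + real n * b \<le> 0"
    by (auto simp: mult_left_mono)
  then show ?thesis by (auto simp: bump_def flat_exp_def)
qed

lemma bump_pos: "a < x \<Longrightarrow> x < b \<Longrightarrow> n > 0 \<Longrightarrow>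
  bump a b n x = complex_of_real (exp (- (1 / (real n * (x - a)))) * exp (- (1 / (real n * (b - x)))))"
proof -
  assume *: "a < x" "x < b" "n > 0"
  have e: "real n * x + (- real n * a) = real n * (x - a)" "- real n * x + real n * b = real n * (b - x)"
    by (auto simp: algebra_simps)
  show ?thesis unfolding bump_def e using * by (auto simp: flat_exp_def)
qed

lemma bump_tendsto: "(\<lambda>n. bump a b (Suc n) x) \<longlonglongrightarrow> indicator {a<..<b} x"
proof (cases "x \<in> {a<..<b}")
  case True
  have t: "(\<lambda>n. 1 / (real (Suc n) * c)) \<longlonglongrightarrow> 0" for c :: real
    using tendsto_mult[OF LIMSEQ_inverse_real_of_nat tendsto_const[of "inverse c"]]
    by (simp add: divide_inverse inverse_mult_distrib)
  have "(\<lambda>n. complex_of_real (exp (- (1 / (real (Suc n) * (x - a)))) * exp (- (1 / (real (Suc n) * (b - x))))))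
      \<longlonglongrightarrow> of_real (exp (- 0) * exp (- 0))"
    by (intro tendsto_of_real tendsto_mult tendsto_exp tendsto_minus t)
  then show ?thesis using True by (simp add: bump_pos)
qed (simp add: bump_outside)

subsection \<open>Elementary properties\<close>

lemma test_deriv: "\<phi> \<in> test_functions \<Longrightarrow> (\<phi> has_vector_derivative vderiv \<phi> x) (at x)"
  by (auto simp: test_functions_iff intro!: vderiv_works diff_upto_differentiable[of 0])

lemma test_support:
  assumes "\<phi> \<in> test_functions"
  obtains r where "r > 0" "\<And>x. r \<le> \<bar>x\<bar> \<Longrightarrow> \<phi> x = 0"
proof -
  obtain r where "\<And>x. r < \<bar>x\<bar> \<Longrightarrow> \<phi> x = 0" using assms by (auto simp: test_functions_iff)
  then show ?thesis using that[of "\<bar>r\<bar> + 1"] by auto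
qed

lemma test_vderiv: "\<phi> \<in> test_functions \<Longrightarrow> vderiv \<phi> \<in> test_functions"
proof -
  assume \<phi>: "\<phi> \<in> test_functions"
  have "diff_upto n (vderiv \<phi>)" for n
    using \<phi> diff_upto.simps(2)[of n \<phi>] by (auto simp: test_functions_iff)
  moreover obtain r where r: "\<And>x. r \<le> \<bar>x\<bar> \<Longrightarrow> \<phi> x = 0" using test_support[OF \<phi>] by blast
  have "vderiv \<phi> x = 0" if "r < \<bar>x\<bar>" for x
  proof -
    have "((\<lambda>x. 0) has_vector_derivative (0::complex)) (at x)" by simp
    then have "(\<phi> has_vector_derivative 0) (at x)"
      by (rule has_vector_derivative_transform_within_open[where S = "{x. r < \<bar>x\<bar>}"])
        (use that r in \<open>auto intro!: open_Collect_less continuous_intros\<close>)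
    then show ?thesis by (simp add: vderiv_def vector_derivative_at)
  qed
  ultimately show ?thesis unfolding test_functions_iff by blast
qed

lemma test_continuous: "\<phi> \<in> test_functions \<Longrightarrow> continuous_on A \<phi>"
  by (meson test_deriv continuous_at_imp_continuous_on has_vector_derivative_continuous)

lemma test_measurable: "\<phi> \<in> test_functions \<Longrightarrow> \<phi> \<in> borel_measurable borel"
  by (intro borel_measurable_continuous_onI test_continuous)

lemma test_bounded:
  assumes "\<phi> \<in> test_functions"
  obtains B where "B > 0" "\<And>x. cmod (\<phi> x) \<le> B"
proof -
  obtain r where r: "\<And>x. r \<le> \<bar>x\<bar> \<Longrightarrow> \<phi> x = 0" using test_support[OF assms] by blast
  have "compact (\<phi> ` {-r..r})"
    by (intro compact_continuous_image test_continuous assms compact_Icc)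
  then obtain B where "B > 0" and B: "\<And>y. y \<in> \<phi> ` {-r..r} \<Longrightarrow> cmod y \<le> B"
    using compact_imp_bounded bounded_pos by metis
  have "cmod (\<phi> x) \<le> B" for x
  proof (cases "r \<le> \<bar>x\<bar>")
    case False
    then have "x \<in> {-r..r}" by auto
    then show ?thesis using B by blast
  qed (use r \<open>B > 0\<close> in auto)
  then show ?thesis using \<open>B > 0\<close> that by blast
qed

lemma test_add: "\<phi> \<in> test_functions \<Longrightarrow> \<psi> \<in> test_functions \<Longrightarrow> (\<lambda>x. \<phi> x + \<psi> x) \<in> test_functions"
proof -
  assume *: "\<phi> \<in> test_functions" "\<psi> \<in> test_functions"
  obtain r where r: "\<And>x. r \<le> \<bar>x\<bar> \<Longrightarrow> \<phi> x = 0" using test_support[OF *(1)] by blast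
  obtain s where s: "\<And>x. s \<le> \<bar>x\<bar> \<Longrightarrow> \<psi> x = 0" using test_support[OF *(2)] by blast
  have "\<forall>x. max r s < \<bar>x\<bar> \<longrightarrow> \<phi> x + \<psi> x = 0" using r s by auto
  then show ?thesis using * unfolding test_functions_iff by (blast intro: diff_upto_add)
qed

lemma test_cmult: "\<phi> \<in> test_functions \<Longrightarrow> (\<lambda>x. c * \<phi> x) \<in> test_functions"
  unfolding test_functions_iff by (auto intro!: diff_upto_mult diff_upto_const)

lemma L1_loc_mult_integrable:
  assumes e: "e \<in> L1_loc" and [measurable]: "\<phi> \<in> borel_measurable borel"
    and B: "\<And>x. cmod (\<phi> x) \<le> B" and r: "\<And>x. r \<le> \<bar>x\<bar> \<Longrightarrow> \<phi> x = 0"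
  shows "integrable lborel (\<lambda>x. e x * \<phi> x)"
proof -
  have [measurable]: "e \<in> borel_measurable borel" using e by (simp add: L1_loc_def)
  have "integrable lborel (\<lambda>x. indicator {-r..r} x *\<^sub>R e x)"
    using e unfolding L1_loc_def set_integrable_def by blast
  then have "integrable lborel (\<lambda>x. B * cmod (indicator {-r..r} x *\<^sub>R e x))"
    by (intro integrable_mult_right integrable_norm)
  then show ?thesis
  proof (rule Bochner_Integration.integrable_bound)
    show "AE x in lborel. norm (e x * \<phi> x) \<le> norm (B * cmod (indicator {-r..r} x *\<^sub>R e x))"
    proof (intro AE_I2)
      fix x
      have "B \<ge> 0" using B[of 0] norm_ge_zero[of "\<phi> 0"] by linarith
      then show "norm (e x * \<phi> x) \<le> norm (B * cmod (indicator {-r..r} x *\<^sub>R e x))"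
        using B[of x] r[of x] by (cases "r \<le> \<bar>x\<bar>")
          (auto simp: norm_mult indicator_def abs_mult mult.commute[of "cmod (e x)"] intro!: mult_right_mono)
    qed
  qed simp
qed

lemma L1_loc_mult_test:
  assumes "e \<in> L1_loc" "\<phi> \<in> test_functions"
  shows "integrable lborel (\<lambda>x. e x * \<phi> x)"
proof -
  obtain B where B: "\<And>x. cmod (\<phi> x) \<le> B" using test_bounded[OF assms(2)] by blast
  obtain r where r: "\<And>x. r \<le> \<bar>x\<bar> \<Longrightarrow> \<phi> x = 0" using test_support[OF assms(2)] by blast
  show ?thesis by (rule L1_loc_mult_integrable[OF assms(1) test_measurable[OF assms(2)] B r])
qed

lemma const_L1_loc: "(\<lambda>x. c) \<in> L1_loc"
  unfolding L1_loc_def by (auto intro!: borel_integrable_atLeastAtMost' continuous_intros)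

lemma continuous_L1_loc: "continuous_on UNIV f \<Longrightarrow> f \<in> L1_loc"
  unfolding L1_loc_def
  by (auto intro!: borel_integrable_atLeastAtMost' borel_measurable_continuous_onI
      intro: continuous_on_subset)

lemma L1_loc_add: "f \<in> L1_loc \<Longrightarrow> g \<in> L1_loc \<Longrightarrow> (\<lambda>x. f x + g x) \<in> L1_loc"
  unfolding L1_loc_def by (auto intro: set_integral_add)

lemma L1_loc_diff: "f \<in> L1_loc \<Longrightarrow> g \<in> L1_loc \<Longrightarrow> (\<lambda>x. f x - g x) \<in> L1_loc"
  unfolding L1_loc_def by (auto intro: set_integral_diff)

lemma L1_loc_cmult: "f \<in> L1_loc \<Longrightarrow> (\<lambda>x. c * f x) \<in> L1_loc"
  unfolding L1_loc_def by auto

lemma test_integrable: "\<phi> \<in> test_functions \<Longrightarrow> integrable lborel \<phi>"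
  using L1_loc_mult_test[OF const_L1_loc[of 1]] by simp

lemma test_FTC_ge:
  assumes "\<phi> \<in> test_functions"
  shows "(LINT x|lborel. indicator {y..} x *\<^sub>R vderiv \<phi> x) = - \<phi> y"
proof -
  obtain r where r: "\<And>x. r \<le> \<bar>x\<bar> \<Longrightarrow> \<phi> x = 0" using test_support[OF assms] by blast
  obtain s where s: "\<And>x. s \<le> \<bar>x\<bar> \<Longrightarrow> vderiv \<phi> x = 0" using test_support[OF test_vderiv[OF assms]] by blast
  define t where "t = \<bar>r\<bar> + \<bar>s\<bar> + \<bar>y\<bar>"
  have "(LINT x|lborel. indicator {y..} x *\<^sub>R vderiv \<phi> x) = (LINT x|lborel. indicator {y..t} x *\<^sub>R vderiv \<phi> x)"
    using s by (intro Bochner_Integration.integral_cong) (auto simp: indicator_def t_def)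
  also have "\<dots> = \<phi> t - \<phi> y"
    by (rule integral_FTC_atLeastAtMost)
      (auto simp: t_def assms intro!: test_continuous test_vderiv has_vector_derivative_at_within test_deriv)
  also have "\<phi> t = 0" using r[of t] by (simp add: t_def)
  finally show ?thesis by simp
qed

text \<open>A primitive that starts left of the support ends with the value of the total integral;
  zero mean is therefore what makes the primitive compactly supported.\<close>

lemma test_antideriv:
  assumes \<eta>: "\<eta> \<in> test_functions" and zero: "(LINT x|lborel. \<eta> x) = 0"
  obtains \<phi> where "\<phi> \<in> test_functions" "vderiv \<phi> = \<eta>"
proof -
  obtain r where r: "r > 0" "\<And>x. r \<le> \<bar>x\<bar> \<Longrightarrow> \<eta> x = 0" using test_support[OF \<eta>] by blast
  define \<phi> where "\<phi> x = (LINT t|lborel. indicator {..x} t *\<^sub>R \<eta> t)" for x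
  have der: "(\<phi> has_vector_derivative \<eta> x) (at x)" for x
  proof -
    \<comment> \<open>The lower limit lies left of the support, so the primitive from
      \<open>a\<close> agrees with \<open>\<phi>\<close>, and \<open>x\<close> is interior to
      [a, b].\<close>
    define a where "a = - r - \<bar>x\<bar> - 1"
    define b where "b = \<bar>x\<bar> + 1"
    have eq: "\<phi> y = integral {a..y} \<eta>" for y
    proof -
      have "\<phi> y = (LINT t:{a..y}|lborel. \<eta> t)"
        unfolding \<phi>_def set_lebesgue_integral_def
        using r by (intro Bochner_Integration.integral_cong) (auto simp: indicator_def a_def)
      also have "\<dots> = integral {a..y} \<eta>"
        by (intro set_borel_integral_eq_integral borel_integrable_atLeastAtMost' test_continuous \<eta>)
      finally show ?thesis .
    qed
    have "((\<lambda>u. integral {a..u} \<eta>) has_vector_derivative \<eta> x) (at x within {a..b})"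
      using r by (intro integral_has_vector_derivative test_continuous \<eta>) (auto simp: a_def b_def)
    then have "(\<phi> has_vector_derivative \<eta> x) (at x within {a..b})"
      by (simp add: eq[abs_def])
    moreover have "at x within {a..b} = at x"
      using r by (intro at_within_interior) (auto simp: a_def b_def)
    ultimately show ?thesis by simp
  qed
  have "diff_upto n \<phi>" for n
    using \<eta> diff_upto_antimono[OF diff_upto_SucI[OF der, of n]] by (auto simp: test_functions_iff)
  moreover have "\<phi> x = 0" if "r < \<bar>x\<bar>" for x
  proof (cases "x > 0")
    case True
    then have "\<phi> x = (LINT x|lborel. \<eta> x)"
      unfolding \<phi>_def using r that by (intro Bochner_Integration.integral_cong) (auto simp: indicator_def)
    then show ?thesis using zero by simp
  next
    case False
    then have "indicator {..x} t *\<^sub>R \<eta> t = 0" for t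
      using r that by (auto simp: indicator_def)
    then have "\<phi> x = (LINT t::real|lborel. 0)" unfolding \<phi>_def by (simp only:)
    then show ?thesis by simp
  qed
  ultimately have "\<phi> \<in> test_functions" unfolding test_functions_iff by blast
  then show ?thesis using that vderiv_eqI[OF der] by blast
qed

subsection \<open>The fundamental lemmas of the calculus of variations\<close>

text \<open>Half lines are an intersection-stable generator of the Borel sets; the class of sets
  with vanishing integral is closed under disjoint unions and, because the total integral is 0,
  under complements.\<close>

lemma AE_zero_of_integral_lessThan:
  fixes f :: "real \<Rightarrow> complex"
  assumes f: "integrable lborel f" and z: "\<And>x. (LINT t:{..<x}|lborel. f t) = 0"
    and total: "(LINT t|lborel. f t) = 0"
  shows "AE x in lborel. f x = 0"
proof (rule sigma_finite_measure.density_zero[OF sigma_finite_lborel f])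
  fix A :: "real set" assume "A \<in> sets lborel"
  then have A: "A \<in> sigma_sets UNIV (range lessThan)"
    by (simp add: borel_Iio)
  have "{..<a} \<inter> {..<b} = {..<min a b}" for a b :: real by auto
  then have "Int_stable (range (lessThan :: real \<Rightarrow> real set))"
    by (auto simp: Int_stable_def)
  moreover have "range (lessThan :: real \<Rightarrow> real set) \<subseteq> Pow UNIV" by simp
  ultimately show "(LINT t:A|lborel. f t) = 0" using A
  proof (induction rule: sigma_sets_induct_disjoint)
    case (compl A)
    then have A: "A \<in> sets lborel" by (simp add: borel_Iio)
    have "(LINT t:A \<union> (UNIV - A)|lborel. f t) = (LINT t:A|lborel. f t) + (LINT t:UNIV - A|lborel. f t)"
      using A f by (intro set_integral_Un) (auto simp: set_integrable_def integrable_mult_indicator)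
    then show ?case using compl total by (simp add: set_integral_space[OF f, simplified])
  next
    case (union A)
    then have A: "A i \<in> sets lborel" for i by (auto simp: borel_Iio)
    have "(LINT t:(\<Union>i. A i)|lborel. f t) = (\<Sum>i. (LINT t:(A i)|lborel. f t))"
      using A f union(1)
      by (intro lebesgue_integral_countable_add)
       (auto simp: set_integrable_def disjoint_family_on_def intro!: integrable_mult_indicator)
    then show ?case using union by simp
  qed (auto simp: z[unfolded set_lebesgue_integral_def] set_lebesgue_integral_def)
qed

text \<open>The bumps converge boundedly to indicators of open intervals, so vanishing against test
  functions passes to vanishing integrals over intervals.\<close>

lemma fundamental_lemma:
  assumes e: "e \<in> L1_loc" and z: "\<And>\<psi>. \<psi> \<in> test_functions \<Longrightarrow> (LINT x|lborel. e x * \<psi> x) = 0"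
  shows "AE x in lborel. e x = 0"
proof -
  have [measurable]: "e \<in> borel_measurable borel" using e by (simp add: L1_loc_def)
  have int: "integrable lborel (\<lambda>x. indicator {a<..<b} x *\<^sub>R e x)" for a b
  proof -
    have "set_integrable lborel {a..b} e" using e by (simp add: L1_loc_def)
    then have "set_integrable lborel {a<..<b} e" by (rule set_integrable_subset) auto
    then show ?thesis unfolding set_integrable_def .
  qed
  have ab: "(LINT x|lborel. indicator {a<..<b} x *\<^sub>R e x) = 0" for a b
  proof -
    have "(\<lambda>n. LINT x|lborel. e x * bump a b (Suc n) x) \<longlonglongrightarrow> (LINT x|lborel. indicator {a<..<b} x *\<^sub>R e x)"
    proof (rule integral_dominated_convergence)
      show "integrable lborel (\<lambda>x. norm (indicator {a<..<b} x *\<^sub>R e x))"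
        by (intro integrable_norm int)
      show "(\<lambda>x. e x * bump a b (Suc n) x) \<in> borel_measurable lborel" for n
        using test_measurable[OF bump_test, of "Suc n" a b] by measurable
      show "AE x in lborel. (\<lambda>n. e x * bump a b (Suc n) x) \<longlonglongrightarrow> indicator {a<..<b} x *\<^sub>R e x"
      proof (rule AE_I2)
        fix x show "(\<lambda>n. e x * bump a b (Suc n) x) \<longlonglongrightarrow> indicator {a<..<b} x *\<^sub>R e x"
          using tendsto_mult[OF tendsto_const[of "e x"] bump_tendsto[of a b x]]
          by (cases "x \<in> {a<..<b}") auto
      qed
      show "AE x in lborel. norm (e x * bump a b (Suc n) x) \<le> norm (indicator {a<..<b} x *\<^sub>R e x)" for n
      proof (rule AE_I2)
        fix x show "norm (e x * bump a b (Suc n) x) \<le> norm (indicator {a<..<b} x *\<^sub>R e x)"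
          using mult_left_mono[OF norm_bump, of "cmod (e x)" a b "Suc n" x] bump_outside[of x a b "Suc n"]
          by (cases "x \<in> {a<..<b}") (auto simp: norm_mult)
      qed
    qed (use int in auto)
    moreover have "(LINT x|lborel. e x * bump a b (Suc n) x) = 0" for n
      by (intro z bump_test) simp
    ultimately show ?thesis by (simp add: LIMSEQ_const_iff)
  qed
  \<comment> \<open>\<open>e\<close> is only locally integrable, hence the cut-off to (-N, N) and a
    countable union of null sets.\<close>
  have "AE x in lborel. indicator {- real N<..<real N} x *\<^sub>R e x = 0" for N :: nat
  proof (rule AE_zero_of_integral_lessThan[OF int])
    fix x
    have "indicator {..<x} t *\<^sub>R (indicator {- real N<..<real N} t *\<^sub>R e t)
        = indicator {- real N<..<min x (real N)} t *\<^sub>R e t" for t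
      by (auto simp: indicator_def)
    then show "(LINT t:{..<x}|lborel. indicator {- real N<..<real N} t *\<^sub>R e t) = 0"
      unfolding set_lebesgue_integral_def by (simp only: ab)
  qed (rule ab)
  then have "AE x in lborel. \<forall>N::nat. indicator {- real N<..<real N} x *\<^sub>R e x = 0"
    by (subst AE_all_countable) auto
  then show ?thesis
  proof eventually_elim
    case (elim x)
    obtain N :: nat where "\<bar>x\<bar> < real N" using reals_Archimedean2 by blast
    then show ?case using elim[rule_format, of N] by (auto simp: indicator_def split: if_splits)
  qed
qed

lemma bump_integral_nonzero: "(LINT x|lborel. bump 0 1 1 x) \<noteq> 0"
proof
  assume z: "(LINT x|lborel. bump 0 1 1 x) = 0"
  define f where "f x = Re (bump 0 1 1 x)" for x
  have int: "integrable lborel (bump 0 1 1)" by (intro test_integrable bump_test) simp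
  have nn: "f x \<ge> 0" for x unfolding f_def by (simp add: bump_def flat_exp_def)
  have "(LINT x|lborel. f x) = 0"
    unfolding f_def using z int by (simp add: integral_Re[symmetric])
  moreover have "integrable lborel f" unfolding f_def using int by simp
  ultimately have "AE x in lborel. f x = 0"
    using nn by (subst (asm) integral_nonneg_eq_0_iff_AE) auto
  then have "AE x in lborel. x \<notin> {0<..<1::real}"
  proof eventually_elim
    case (elim x)
    then show ?case by (auto simp: f_def bump_pos)
  qed
  then have "{0<..<1::real} \<in> null_sets lborel"
    by (subst AE_iff_null_sets) auto
  then show False by (simp add: null_sets_def)
qed

text \<open>After subtracting a multiple of one function \<open>\<rho>\<close> of mass 1, every test
  function has mean zero and is a derivative; hence \<open>e\<close> acts like the constant given by
  its pairing with \<open>\<rho>\<close>.\<close>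

lemma du_bois_reymond:
  assumes e: "e \<in> L1_loc" and z: "\<And>\<phi>. \<phi> \<in> test_functions \<Longrightarrow> (LINT x|lborel. e x * vderiv \<phi> x) = 0"
  obtains c where "AE x in lborel. e x = c"
proof -
  define J where "J = (LINT x|lborel. bump 0 1 1 x)"
  define \<rho> where "\<rho> x = 1 / J * bump 0 1 1 x" for x
  have \<rho>: "\<rho> \<in> test_functions" unfolding \<rho>_def by (intro test_cmult bump_test) simp
  have \<rho>1: "(LINT x|lborel. \<rho> x) = 1"
    using bump_integral_nonzero unfolding \<rho>_def by (simp add: J_def)
  define c where "c = (LINT x|lborel. e x * \<rho> x)"
  have "(LINT x|lborel. (e x - c) * \<psi> x) = 0" if \<psi>: "\<psi> \<in> test_functions" for \<psi>
  proof -
    define I where "I = (LINT x|lborel. \<psi> x)"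
    define \<eta> where "\<eta> x = \<psi> x + (- I) * \<rho> x" for x
    have \<eta>: "\<eta> \<in> test_functions" unfolding \<eta>_def by (intro test_add test_cmult \<psi> \<rho>)
    have "(LINT x|lborel. \<eta> x) = 0"
      unfolding \<eta>_def using test_integrable[OF \<psi>] test_integrable[OF \<rho>]
      by (subst Bochner_Integration.integral_add) (auto simp: \<rho>1 I_def)
    then obtain \<phi> where "\<phi> \<in> test_functions" "vderiv \<phi> = \<eta>" using test_antideriv[OF \<eta>] by blast
    then have "(LINT x|lborel. e x * \<eta> x) = 0" using z by blast
    moreover have "(LINT x|lborel. e x * \<eta> x) = (LINT x|lborel. e x * \<psi> x) - I * c"
    proof -
      have "(LINT x|lborel. e x * \<eta> x) = (LINT x|lborel. e x * \<psi> x - I * (e x * \<rho> x))"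
        unfolding \<eta>_def by (simp add: algebra_simps)
      also have "\<dots> = (LINT x|lborel. e x * \<psi> x) - I * c"
        using L1_loc_mult_test[OF e \<psi>] L1_loc_mult_test[OF e \<rho>]
        by (subst Bochner_Integration.integral_diff) (auto simp: c_def)
      finally show ?thesis .
    qed
    moreover have "(LINT x|lborel. (e x - c) * \<psi> x) = (LINT x|lborel. e x * \<psi> x) - c * I"
      unfolding left_diff_distrib
      using L1_loc_mult_test[OF e \<psi>] test_integrable[OF \<psi>]
      by (subst Bochner_Integration.integral_diff) (auto simp: I_def)
    ultimately show ?thesis by simp
  qed
  then have "AE x in lborel. e x - c = 0"
    by (intro fundamental_lemma L1_loc_diff e const_L1_loc)
  then show ?thesis using that[of c] by simp
qed

section \<open>Primitives\<close>

lemma integrable_product_mult: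
  fixes b k :: "real \<Rightarrow> complex"
  assumes "sigma_finite_measure M" "integrable M k" "integrable lborel b"
  shows "integrable (lborel \<Otimes>\<^sub>M M) (\<lambda>(x, y). b x * k y)"
proof -
  interpret M: sigma_finite_measure M by fact
  interpret P: pair_sigma_finite lborel M by standard
  have [measurable]: "b \<in> borel_measurable lborel" "k \<in> borel_measurable M" using assms by auto
  show ?thesis
  proof (rule P.Fubini_integrable)
    have "integrable lborel (\<lambda>x. norm (b x) * (LINT y|M. norm (k y)))"
      using assms by (intro integrable_mult_left integrable_norm) auto
    then show "integrable lborel (\<lambda>x. LINT y|M. norm (case (x, y) of (x, y) \<Rightarrow> b x * k y))"
      by (simp add: norm_mult)
    show "AE x in lborel. integrable M (\<lambda>y. case (x, y) of (x, y) \<Rightarrow> b x * k y)"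
      using assms by simp
  qed simp
qed

text \<open>The common source of the integrations by parts: with \<open>M\<close> Lebesgue measure
  it gives the product rule for primitives, with \<open>M\<close> a variation of the potential it
  moves a derivative across \<open>V\<close>. The triangle y <= x is closed, so an atom at
  \<open>x\<close> is already counted at \<open>x\<close>.\<close>

lemma Fubini_triangle:
  fixes b k :: "real \<Rightarrow> complex"
  assumes sf: "sigma_finite_measure M" and sets[measurable_cong]: "sets M = sets borel"
    and k: "integrable M k" and b: "integrable lborel b"
  shows Fubini_triangle_integrable:
      "integrable lborel (\<lambda>x. b x * (LINT y|M. indicator {..x} y *\<^sub>R k y))" (is ?A)
    and Fubini_triangle_eq: "(LINT x|lborel. b x * (LINT y|M. indicator {..x} y *\<^sub>R k y))
      = (LINT y|M. k y * (LINT x|lborel. indicator {y..} x *\<^sub>R b x))" (is ?B)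
proof -
  interpret M: sigma_finite_measure M by fact
  interpret P: pair_sigma_finite lborel M by standard
  define F where "F x y = (if y \<le> x then b x * k y else 0)" for x y
  have [measurable]: "b \<in> borel_measurable lborel" "k \<in> borel_measurable M" using k b by auto
  have int: "integrable (lborel \<Otimes>\<^sub>M M) (case_prod F)"
  proof (rule Bochner_Integration.integrable_bound[OF integrable_product_mult[OF sf k b]])
    show "case_prod F \<in> borel_measurable (lborel \<Otimes>\<^sub>M M)" unfolding F_def by measurable
  qed (auto simp: F_def)
  have 1: "(LINT y|M. F x y) = b x * (LINT y|M. indicator {..x} y *\<^sub>R k y)" for x
  proof -
    have "F x = (\<lambda>y. b x * (indicator {..x} y *\<^sub>R k y))" by (simp add: F_def indicator_def fun_eq_iff)
    then show ?thesis by (simp only: integral_mult_right_zero)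
  qed
  have 2: "(LINT x|lborel. F x y) = k y * (LINT x|lborel. indicator {y..} x *\<^sub>R b x)" for y
  proof -
    have "(\<lambda>x. F x y) = (\<lambda>x. k y * (indicator {y..} x *\<^sub>R b x))" by (simp add: F_def indicator_def fun_eq_iff)
    then show ?thesis by (simp only: integral_mult_right_zero)
  qed
  show ?A using P.integrable_fst[OF int] by (simp add: 1)
  show ?B using P.integral_fst[OF int] P.integral_snd[OF int] by (simp add: 1 2)
qed

text \<open>Absolute continuity on \<open>[R, \<infinity>)\<close>, encoded by the integral representation.\<close>

definition prim_on :: "real \<Rightarrow> (real \<Rightarrow> complex) \<Rightarrow> (real \<Rightarrow> complex) \<Rightarrow> bool" where
  "prim_on R U v \<longleftrightarrow> (\<forall>t\<ge>R. set_integrable lborel {R..t} v \<and> U t = U R + (LINT x:{R..t}|lborel. v x))"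

lemma prim_onD:
  assumes "prim_on R U v" "R \<le> t"
  shows "set_integrable lborel {R..t} v" "U t = U R + (LINT x:{R..t}|lborel. v x)"
  using assms unfolding prim_on_def by blast+

lemma prim_onI:
  assumes "\<And>t. R \<le> t \<Longrightarrow> set_integrable lborel {R..t} v"
    "\<And>t. R \<le> t \<Longrightarrow> U t = U R + (LINT x:{R..t}|lborel. v x)"
  shows "prim_on R U v"
  using assms unfolding prim_on_def by blast

lemma prim_on_add:
  assumes "prim_on R A a" "prim_on R B b"
  shows "prim_on R (\<lambda>x. A x + B x) (\<lambda>x. a x + b x)"
proof (rule prim_onI)
  fix t assume t: "R \<le> t"
  note * = prim_onD[OF assms(1) t] prim_onD[OF assms(2) t]
  show "set_integrable lborel {R..t} (\<lambda>x. a x + b x)" using * by simp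
  show "A t + B t = A R + B R + (LINT x:{R..t}|lborel. a x + b x)"
    using set_integral_add(2)[OF *(1,3)] *(2,4) by simp
qed

lemma prim_on_cmult: "prim_on R A a \<Longrightarrow> prim_on R (\<lambda>x. c * A x) (\<lambda>x. c * a x)"
proof (intro prim_onI)
  fix t assume A: "prim_on R A a" and t: "R \<le> t"
  show "set_integrable lborel {R..t} (\<lambda>x. c * a x)" using prim_onD(1)[OF A t] by simp
  show "c * A t = c * A R + (LINT x:{R..t}|lborel. c * a x)"
    by (subst prim_onD(2)[OF A t]) (simp add: distrib_left)
qed

lemma set_integral_cnj:
  "(LINT x:A|M. cnj (f x)) = cnj (LINT x:A|M. f x)"
proof -
  have "(\<lambda>x. indicat_real A x *\<^sub>R cnj (f x)) = (\<lambda>x. cnj (indicat_real A x *\<^sub>R f x))" by auto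
  then show ?thesis unfolding set_lebesgue_integral_def by (simp only: Bochner_Integration.integral_cnj)
qed

lemma set_integrable_cnj: "set_integrable M A (\<lambda>x. cnj (f x)) \<longleftrightarrow> set_integrable M A f"
proof -
  have "(\<lambda>x. indicat_real A x *\<^sub>R cnj (f x)) = (\<lambda>x. cnj (indicat_real A x *\<^sub>R f x))" by auto
  then show ?thesis unfolding set_integrable_def by (simp only: complex_integrable_cnj)
qed

lemma prim_on_cnj: "prim_on R A a \<Longrightarrow> prim_on R (\<lambda>x. cnj (A x)) (\<lambda>x. cnj (a x))"
proof (intro prim_onI)
  fix t assume A: "prim_on R A a" and t: "R \<le> t"
  show "set_integrable lborel {R..t} (\<lambda>x. cnj (a x))"
    using prim_onD(1)[OF A t] by (simp add: set_integrable_cnj)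
  show "cnj (A t) = cnj (A R) + (LINT x:{R..t}|lborel. cnj (a x))"
    by (subst prim_onD(2)[OF A t]) (simp add: set_integral_cnj)
qed

lemma prim_on_C1:
  assumes "\<And>x. x \<ge> R \<Longrightarrow> (W has_vector_derivative w x) (at x)" "continuous_on {R..} w"
  shows "prim_on R W w"
proof (rule prim_onI)
  fix t assume t: "R \<le> t"
  have c: "continuous_on {R..t} w" using assms(2) by (rule continuous_on_subset) auto
  show "set_integrable lborel {R..t} w" by (rule borel_integrable_atLeastAtMost'[OF c])
  show "W t = W R + (LINT x:{R..t}|lborel. w x)"
    using integral_FTC_atLeastAtMost[OF t _ c, of W] assms(1)
    by (auto simp: set_lebesgue_integral_def has_vector_derivative_at_within)
qed

lemma set_integral_prim_le:
  assumes "prim_on R A a" "R \<le> x" "x \<le> t"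
  shows "(LINT y|lborel. indicator {..x} y *\<^sub>R (indicator {R..t} y *\<^sub>R a y)) = A x - A R"
proof -
  have "(\<lambda>y. indicator {..x} y *\<^sub>R (indicator {R..t} y *\<^sub>R a y)) = (\<lambda>y. indicator {R..x} y *\<^sub>R a y)"
    using assms by (auto simp: indicator_def)
  then show ?thesis using prim_onD(2)[OF assms(1,2)] by (simp add: set_lebesgue_integral_def)
qed

lemma set_integral_prim_ge:
  assumes "prim_on R A a" "R \<le> y" "y \<le> t"
  shows "(LINT x|lborel. indicator {y..} x *\<^sub>R (indicator {R..t} x *\<^sub>R a x)) = A t - A y"
proof -
  define f where "f x = indicator {R..t} x *\<^sub>R a x" for x
  have f: "integrable lborel f"
    using prim_onD(1)[OF assms(1), of t] assms unfolding f_def set_integrable_def by auto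
  have "(LINT x|lborel. indicator {y..} x *\<^sub>R f x) = (LINT x|lborel. f x - indicator {..y} x *\<^sub>R f x)"
  proof (rule integral_cong_AE)
    show "AE x in lborel. indicat_real {y..} x *\<^sub>R f x = f x - indicat_real {..y} x *\<^sub>R f x"
      using AE_lborel_singleton[of y] by eventually_elim (auto simp: indicator_def)
  qed (use f in auto)
  also have "\<dots> = (LINT x|lborel. f x) - (LINT x|lborel. indicator {..y} x *\<^sub>R f x)"
    using f by (intro Bochner_Integration.integral_diff integrable_mult_indicator) auto
  also have "(LINT x|lborel. f x) = A t - A R"
    using prim_onD(2)[OF assms(1), of t] assms by (simp add: f_def set_lebesgue_integral_def)
  also have "(LINT x|lborel. indicator {..y} x *\<^sub>R f x) = A y - A R"
    unfolding f_def by (rule set_integral_prim_le[OF assms])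
  finally show ?thesis by (simp add: f_def)
qed

text \<open>Absolutely continuous functions have a derivative only almost everywhere, so the product
  rule is derived from Fubini on a triangle: over [R, t], the integral of a (B - B R) equals that of
  b (A t - A).\<close>

lemma prim_on_mult:
  assumes A: "prim_on R A a" and B: "prim_on R B b"
  shows "prim_on R (\<lambda>x. A x * B x) (\<lambda>x. a x * B x + A x * b x)"
  unfolding prim_on_def
proof (intro allI impI)
  fix t assume t: "R \<le> t"
  define a' where "a' x = indicator {R..t} x *\<^sub>R a x" for x
  define b' where "b' x = indicator {R..t} x *\<^sub>R b x" for x
  have a': "integrable lborel a'" and b': "integrable lborel b'"
    using prim_onD(1)[OF A t] prim_onD(1)[OF B t] by (simp_all add: a'_def[abs_def] b'_def[abs_def] set_integrable_def)
  have le: "(LINT y|lborel. indicator {..x} y *\<^sub>R a' y) = A x - A R"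
    "(LINT y|lborel. indicator {..x} y *\<^sub>R b' y) = B x - B R" if "x \<in> {R..t}" for x
    using set_integral_prim_le[OF A, of x t] set_integral_prim_le[OF B, of x t] that
    by (auto simp: a'_def b'_def)
  have ge: "(LINT x|lborel. indicator {y..} x *\<^sub>R a' x) = A t - A y" if "y \<in> {R..t}" for y
    using set_integral_prim_ge[OF A, of y t] that by (auto simp: a'_def)
  have a0: "a' x = 0" and b0: "b' x = 0" if "x \<notin> {R..t}" for x
    using that by (auto simp: a'_def b'_def)
  have ai: "(\<lambda>x. a' x * (LINT y|lborel. indicator {..x} y *\<^sub>R b' y)) = (\<lambda>x. a' x * (B x - B R))"
    by (rule ext) (metis a0 le(2) mult_zero_left)
  have bi: "(\<lambda>x. b' x * (LINT y|lborel. indicator {..x} y *\<^sub>R a' y)) = (\<lambda>x. b' x * (A x - A R))"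
    by (rule ext) (metis b0 le(1) mult_zero_left)
  have bi': "(\<lambda>x. b' x * (LINT y|lborel. indicator {x..} y *\<^sub>R a' y)) = (\<lambda>x. b' x * (A t - A x))"
    by (rule ext) (metis b0 ge mult_zero_left)
  have int_aB': "integrable lborel (\<lambda>x. a' x * (B x - B R))"
    using Fubini_triangle_integrable[OF sigma_finite_lborel _ b' a'] by (simp add: ai)
  have int_Ab': "integrable lborel (\<lambda>x. b' x * (A x - A R))"
    using Fubini_triangle_integrable[OF sigma_finite_lborel _ a' b'] by (simp add: bi)
  have eq: "(LINT x|lborel. a' x * (B x - B R)) = (LINT x|lborel. b' x * (A t - A x))"
    using Fubini_triangle_eq[OF sigma_finite_lborel _ b' a'] by (simp add: ai bi')
  have int_aB: "integrable lborel (\<lambda>x. a' x * B x)"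
    using Bochner_Integration.integrable_add[OF int_aB' integrable_mult_left[OF a', of "B R"]]
    by (simp add: algebra_simps)
  have int_Ab: "integrable lborel (\<lambda>x. A x * b' x)"
    using Bochner_Integration.integrable_add[OF int_Ab' integrable_mult_left[OF b', of "A R"]]
    by (simp add: algebra_simps)
  have at: "(LINT x|lborel. a' x) = A t - A R" and bt: "(LINT x|lborel. b' x) = B t - B R"
    using prim_onD(2)[OF A t] prim_onD(2)[OF B t] by (auto simp: a'_def b'_def set_lebesgue_integral_def)
  have "(LINT x|lborel. a' x * (B x - B R)) = (LINT x|lborel. a' x * B x) - (A t - A R) * B R"
    using int_aB a' by (simp add: right_diff_distrib at)
  moreover have "(LINT x|lborel. b' x * (A t - A x)) = (B t - B R) * A t - (LINT x|lborel. A x * b' x)"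
    using int_Ab b' by (simp add: right_diff_distrib bt mult.commute[of _ "A _"])
  moreover have "X + Y = (B t - B R) * A t + (A t - A R) * B R"
    if "P = X - (A t - A R) * B R" "Q = (B t - B R) * A t - Y" "P = Q" for X Y P Q
    using that by (simp add: algebra_simps)
  ultimately have sum: "(LINT x|lborel. a' x * B x) + (LINT x|lborel. A x * b' x)
      = (B t - B R) * A t + (A t - A R) * B R"
    using eq by blast
  have split: "(\<lambda>x. indicator {R..t} x *\<^sub>R (a x * B x + A x * b x)) = (\<lambda>x. a' x * B x + A x * b' x)"
    by (auto simp: a'_def b'_def indicator_def)
  show "set_integrable lborel {R..t} (\<lambda>x. a x * B x + A x * b x) \<and>
      A t * B t = A R * B R + (LINT x:{R..t}|lborel. a x * B x + A x * b x)"
    unfolding set_integrable_def set_lebesgue_integral_def split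
      Bochner_Integration.integral_add[OF int_aB int_Ab] sum
    using int_aB int_Ab by (auto simp: algebra_simps)
qed

text \<open>\<open>B\<close> vanishes at infinity: it has a limit and is integrable.\<close>

lemma prim_on_integral:
  assumes B: "prim_on R B b" and iB: "set_integrable lborel {R..} B" and ib: "set_integrable lborel {R..} b"
  shows "(LINT x:{R..}|lborel. b x) = - B R"
proof -
  define L where "L = B R + (LINT x:{R..}|lborel. b x)"
  have "((\<lambda>t. B R + (LINT x:{R..t}|lborel. b x)) \<longlongrightarrow> L) at_top"
    unfolding L_def by (intro tendsto_intros tendsto_set_lebesgue_integral_at_top ib) auto
  then have lim: "(B \<longlongrightarrow> L) at_top"
  proof (rule Lim_transform_eventually)
    show "\<forall>\<^sub>F t in at_top. B R + (LINT x:{R..t}|lborel. b x) = B t"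
      using eventually_ge_at_top[of R] by eventually_elim (rule prim_onD(2)[OF B, symmetric])
  qed
  \<comment> \<open>Otherwise |B| stays above |L|/2 on a half line, which has infinite measure,
    against integrability.\<close>
  have "L = 0"
  proof (rule ccontr)
    assume "L \<noteq> 0"
    then have "\<forall>\<^sub>F t in at_top. dist (B t) L < norm L / 2"
      using lim by (intro tendstoD) auto
    then obtain T where T: "\<And>t. t \<ge> T \<Longrightarrow> dist (B t) L < norm L / 2"
      by (auto simp: eventually_at_top_linorder)
    have big: "norm L / 2 \<le> norm (B t)" if "t \<ge> T" for t
    proof -
      have "norm L \<le> norm (B t) + dist (B t) L"
        by (metis dist_commute dist_norm norm_triangle_sub)
      then show ?thesis using T[OF that] by linarith
    qed
    define T' where "T' = max R T"
    have "integrable lborel (\<lambda>x. indicator {T'..} x *\<^sub>R (norm L / 2))"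
    proof (rule Bochner_Integration.integrable_bound)
      show "integrable lborel (\<lambda>x. indicator {R..} x *\<^sub>R B x)" using iB by (simp add: set_integrable_def)
      show "AE x in lborel. norm (indicat_real {T'..} x *\<^sub>R (norm L / 2)) \<le> norm (indicat_real {R..} x *\<^sub>R B x)"
        using big by (intro AE_I2) (auto simp: indicator_def T'_def)
    qed simp
    then have "integrable lborel (\<lambda>x. (2 / norm L) *\<^sub>R (indicator {T'..} x *\<^sub>R (norm L / 2)))"
      by (rule integrable_scaleR_right)
    then have "integrable lborel (indicat_real {T'..})"
      using \<open>L \<noteq> 0\<close> by simp
    then have "emeasure lborel {T'..} < \<infinity>"
      by (subst (asm) integrable_indicator_iff) auto
    moreover have "emeasure lborel {T'..} = \<infinity>"
    proof (rule ccontr)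
      assume "emeasure lborel {T'..} \<noteq> \<infinity>"
      then obtain m where m: "emeasure lborel {T'..} = ennreal m" "m \<ge> 0"
        by (cases "emeasure lborel {T'..}") auto
      have "emeasure lborel {T'..T' + (m + 1)} \<le> emeasure lborel {T'..}"
        by (rule emeasure_mono) auto
      then show False using m by simp
    qed
    ultimately show False by simp
  qed
  then show ?thesis by (simp add: L_def add_eq_0_iff)
qed

section \<open>Primitives on the whole line and weak derivatives\<close>

definition prim :: "(real \<Rightarrow> complex) \<Rightarrow> real \<Rightarrow> complex" where
  "prim v x = (LBINT y=0..ereal x. v y)"

lemma L1_loc_set_integrable: "v \<in> L1_loc \<Longrightarrow> set_integrable lborel {a..b} v"
  by (simp add: L1_loc_def)

text \<open>The oriented interval integral changes sign for negative end points, so one function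
  serves as primitive from every base point.\<close>

lemma prim_on_prim:
  assumes "v \<in> L1_loc"
  shows "prim_on R (prim v) v"
proof (rule prim_onI)
  fix t assume t: "R \<le> t"
  show "set_integrable lborel {R..t} v" by (rule L1_loc_set_integrable[OF assms])
  have "(LBINT y=0..ereal R. v y) + (LBINT y=ereal R..ereal t. v y) = (LBINT y=0..ereal t. v y)"
  proof (rule interval_integral_sum)
    have eq: "min 0 (min (ereal R) (ereal t)) = ereal (min 0 (min R t))"
      "max 0 (max (ereal R) (ereal t)) = ereal (max 0 (max R t))"
      by (auto simp: min_def max_def zero_ereal_def)
    have "set_integrable lborel {min 0 (min R t)..max 0 (max R t)} v"
      by (rule L1_loc_set_integrable[OF assms])
    then have "set_integrable lborel {min 0 (min R t)<..<max 0 (max R t)} v"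
      by (rule set_integrable_subset) auto
    then show "interval_lebesgue_integrable lborel (min 0 (min (ereal R) (ereal t))) (max 0 (max (ereal R) (ereal t))) v"
      unfolding eq interval_lebesgue_integrable_def by (auto simp: einterval_eq min_def max_def)
  qed
  then show "prim v t = prim v R + (LINT x:{R..t}|lborel. v x)"
    unfolding prim_def using t by (simp add: interval_integral_Icc)
qed

lemma prim_on_continuous:
  assumes "\<And>R. prim_on R U v"
  shows "continuous_on UNIV U"
proof (subst continuous_on_eq_continuous_at, simp, intro ballI)
  fix x :: real
  define a b where "a = x - 1" "b = x + 1"
  have ab: "a < x" "x < b" by (auto simp: a_b_def)
  have int: "set_integrable lborel {a..t} v" if "a \<le> t" for t using prim_onD(1)[OF assms that] .
  have "continuous_on {a..b} (\<lambda>t. integral {a..t} v)"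
    using int[of b] ab by (intro indefinite_integral_continuous_1 set_borel_integral_eq_integral(1)) auto
  then have "continuous_on {a..b} (\<lambda>t. U a + integral {a..t} v)" by (intro continuous_intros)
  moreover have "U a + integral {a..t} v = U t" if "t \<in> {a..b}" for t
    using prim_onD(2)[OF assms, of a t] set_borel_integral_eq_integral(2)[OF int[of t]] that by auto
  ultimately have "continuous_on {a..b} U" by (rule continuous_on_eq)
  then show "isCont U x" using ab by (intro continuous_on_interior[of "{a..b}"]) auto
qed

lemma L1_loc_prim_continuous: "v \<in> L1_loc \<Longrightarrow> continuous_on UNIV (prim v)"
  by (rule prim_on_continuous[OF prim_on_prim])

text \<open>On [-N, N], beyond the support of \<open>\<phi>\<close>, the product of \<open>U\<close>
  and \<open>\<phi>\<close> vanishes at both ends, so the product rule has no boundary term.\<close>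

lemma weak_of_prim_on:
  assumes U: "\<And>R. prim_on R U v" and v: "v \<in> L1_loc" and \<phi>: "\<phi> \<in> test_functions"
  shows "(LINT x|lborel. U x * vderiv \<phi> x) = - (LINT x|lborel. v x * \<phi> x)"
proof -
  obtain r where r: "r > 0" "\<And>x. r \<le> \<bar>x\<bar> \<Longrightarrow> \<phi> x = 0" using test_support[OF \<phi>] by blast
  obtain s where s: "s > 0" "\<And>x. s \<le> \<bar>x\<bar> \<Longrightarrow> vderiv \<phi> x = 0" using test_support[OF test_vderiv[OF \<phi>]] by blast
  define N where "N = max r s"
  have N: "N > 0" "\<And>x. N \<le> \<bar>x\<bar> \<Longrightarrow> \<phi> x = 0" "\<And>x. N \<le> \<bar>x\<bar> \<Longrightarrow> vderiv \<phi> x = 0"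
    using r s by (auto simp: N_def)
  have "prim_on (-N) \<phi> (vderiv \<phi>)"
    by (intro prim_on_C1 test_deriv \<phi> test_continuous test_vderiv)
  from prim_onD(2)[OF prim_on_mult[OF U this], of N]
  have "0 = (LINT x:{-N..N}|lborel. v x * \<phi> x + U x * vderiv \<phi> x)"
    using N(1) N(2)[of N] N(2)[of "-N"] by simp
  also have "\<dots> = (LINT x|lborel. v x * \<phi> x + U x * vderiv \<phi> x)"
    unfolding set_lebesgue_integral_def
    by (intro Bochner_Integration.integral_cong refl) (use N in \<open>auto simp: indicator_def\<close>)
  also have "\<dots> = (LINT x|lborel. v x * \<phi> x) + (LINT x|lborel. U x * vderiv \<phi> x)"
    by (intro Bochner_Integration.integral_add L1_loc_mult_test v \<phi> test_vderiv continuous_L1_loc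
        prim_on_continuous[OF U])
  finally show ?thesis by (simp add: eq_neg_iff_add_eq_0 add.commute)
qed

section \<open>Integration against the potential\<close>

lemma AE_continuous_eq:
  fixes f g :: "real \<Rightarrow> complex"
  assumes "continuous_on UNIV f" "continuous_on UNIV g" "AE x in lborel. f x = g x"
  shows "f = g"
proof (rule ccontr)
  assume "f \<noteq> g"
  then obtain x where "f x \<noteq> g x" by auto
  have "open {x. f x \<noteq> g x}" using assms by (intro open_Collect_neq)
  moreover have "x \<in> {x. f x \<noteq> g x}" using \<open>f x \<noteq> g x\<close> by simp
  ultimately obtain d where d: "d > 0" "cball x d \<subseteq> {x. f x \<noteq> g x}"
    by (meson open_contains_cball)
  have "AE y in lborel. y \<notin> {x - d..x + d}"
    using assms(3)
  proof eventually_elim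
    case (elim y)
    then show ?case using d(2) by (auto simp: cball_eq_atLeastAtMost subset_iff)
  qed
  then have "{x - d..x + d} \<in> null_sets lborel" by (subst AE_iff_null_sets) auto
  then show False using d(1) by (simp add: null_sets_def)
qed

lemma cont_rep_eqI:
  assumes "continuous_on UNIV c" "bounded (range c)" "AE x in lborel. u x = c x"
  shows "cont_rep u = c"
  unfolding cont_rep_def
proof (rule the_equality)
  fix c' assume c': "continuous_on UNIV c' \<and> bounded (range c') \<and> (AE x in lborel. u x = c' x)"
  have "AE x in lborel. c' x = c x" using assms(3) c' by (auto elim!: AE_mp)
  then show "c' = c" using assms(1) c' by (intro AE_continuous_eq) auto
qed (use assms in auto)

context compact_signed_measure
begin

abbreviation S :: "(real \<Rightarrow> complex) \<Rightarrow> complex" where "S \<equiv> signed_integral V"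

lemma S_integrable:
  assumes [measurable]: "f \<in> borel_measurable borel" and B: "\<And>x. \<bar>x\<bar> \<le> R \<Longrightarrow> cmod (f x) \<le> B"
  shows "integrable Vp f" "integrable Vn f"
proof -
  have "AE x in Vp. norm (f x) \<le> B" using AE_Vp by eventually_elim (rule B)
  then show "integrable Vp f" by (intro p.integrable_const_bound) auto
  have "AE x in Vn. norm (f x) \<le> B" using AE_Vn by eventually_elim (rule B)
  then show "integrable Vn f" by (intro n.integrable_const_bound) auto
qed

lemma S_cong:
  assumes "f \<in> borel_measurable borel" "g \<in> borel_measurable borel" "\<And>x. \<bar>x\<bar> \<le> R \<Longrightarrow> f x = g x"
  shows "S f = S g"
proof -
  have "AE x in Vp. f x = g x" using AE_Vp by eventually_elim (rule assms)
  moreover have "AE x in Vn. f x = g x" using AE_Vn by eventually_elim (rule assms)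
  ultimately show ?thesis
    unfolding signed_integral_def using assms(1,2)
    by (intro arg_cong2[where f = "(-)"] integral_cong_AE) auto
qed

lemma S_diff:
  assumes "f \<in> borel_measurable borel" "\<And>x. \<bar>x\<bar> \<le> R \<Longrightarrow> cmod (f x) \<le> B"
    and "g \<in> borel_measurable borel" "\<And>x. \<bar>x\<bar> \<le> R \<Longrightarrow> cmod (g x) \<le> C"
  shows "S (\<lambda>x. f x - g x) = S f - S g"
  unfolding signed_integral_def using S_integrable[OF assms(1,2)] S_integrable[OF assms(3,4)] by simp

lemma S_cmult: "S (\<lambda>x. c * f x) = c * S f"
  unfolding signed_integral_def by (simp add: right_diff_distrib)

lemma S_real: "Im (S (\<lambda>x. complex_of_real (f x))) = 0"
  unfolding signed_integral_def by simp

lemma S_Fubini: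
  assumes [measurable]: "k \<in> borel_measurable borel" and K: "\<And>x. \<bar>x\<bar> \<le> R \<Longrightarrow> cmod (k x) \<le> K"
    and b: "integrable lborel b"
  shows "integrable lborel (\<lambda>x. b x * S (\<lambda>y. indicator {..x} y *\<^sub>R k y))"
    and "(LINT x|lborel. b x * S (\<lambda>y. indicator {..x} y *\<^sub>R k y))
      = S (\<lambda>y. k y * (LINT x|lborel. indicator {y..} x *\<^sub>R b x))"
proof -
  note i = S_integrable[OF assms(1) K]
  note p = Fubini_triangle_integrable[OF p.sigma_finite_measure_axioms sets_Vp i(1) b]
    Fubini_triangle_eq[OF p.sigma_finite_measure_axioms sets_Vp i(1) b]
  note n = Fubini_triangle_integrable[OF n.sigma_finite_measure_axioms sets_Vn i(2) b]
    Fubini_triangle_eq[OF n.sigma_finite_measure_axioms sets_Vn i(2) b]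
  show "integrable lborel (\<lambda>x. b x * S (\<lambda>y. indicator {..x} y *\<^sub>R k y))"
    unfolding signed_integral_def right_diff_distrib
    using p(1) n(1) by (rule Bochner_Integration.integrable_diff)
  have "(LINT x|lborel. b x * S (\<lambda>y. indicator {..x} y *\<^sub>R k y))
      = (LINT x|lborel. b x * (LINT y|Vp. indicator {..x} y *\<^sub>R k y))
        - (LINT x|lborel. b x * (LINT y|Vn. indicator {..x} y *\<^sub>R k y))"
    unfolding signed_integral_def right_diff_distrib
    using p(1) n(1) by (rule Bochner_Integration.integral_diff)
  then show "(LINT x|lborel. b x * S (\<lambda>y. indicator {..x} y *\<^sub>R k y))
      = S (\<lambda>y. k y * (LINT x|lborel. indicator {y..} x *\<^sub>R b x))"
    by (simp only: p(2) n(2) signed_integral_def)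
qed

lemma S_partial_measurable:
  assumes [measurable]: "k \<in> borel_measurable borel"
  shows "(\<lambda>x. S (\<lambda>y. indicator {..x} y *\<^sub>R k y)) \<in> borel_measurable borel"
proof -
  have "(\<lambda>x. LINT y|Vp. (if y \<le> x then k y else 0)) \<in> borel_measurable borel"
    "(\<lambda>x. LINT y|Vn. (if y \<le> x then k y else 0)) \<in> borel_measurable borel"
    by measurable
  then have "(\<lambda>x. S (\<lambda>y. if y \<le> x then k y else 0)) \<in> borel_measurable borel"
    unfolding signed_integral_def by measurable
  moreover have "(\<lambda>y. indicator {..x} y *\<^sub>R k y) = (\<lambda>y. if y \<le> x then k y else 0)" for x
    by (auto simp: indicator_def)
  ultimately show ?thesis by simp
qed

lemma S_partial_L1_loc:
  assumes "k \<in> borel_measurable borel" "\<And>x. cmod (k x) \<le> K"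
  shows "(\<lambda>x. S (\<lambda>y. indicator {..x} y *\<^sub>R k y)) \<in> L1_loc"
  unfolding L1_loc_def
proof (intro CollectI conjI allI)
  note [measurable] = S_partial_measurable[OF assms(1)]
  show "(\<lambda>x. S (\<lambda>y. indicator {..x} y *\<^sub>R k y)) \<in> borel_measurable lborel" by measurable
  fix a b :: real
  have "integrable lborel (\<lambda>x. indicator {a..b} x *\<^sub>R (1::complex))"
    using borel_integrable_atLeastAtMost'[of a b "\<lambda>x. 1::complex"] by (simp add: set_integrable_def)
  from S_Fubini(1)[OF assms this]
  show "set_integrable lborel {a..b} (\<lambda>x. S (\<lambda>y. indicator {..x} y *\<^sub>R k y))"
    by (simp add: set_integrable_def scaleR_conv_of_real)
qed

text \<open>The cumulative integral is a primitive of the measure \<open>k V\<close> in the sense of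
  distributions. It turns the potential term into a locally integrable function paired with a
  derivative, the form in which du Bois-Reymond's lemma applies.\<close>

lemma S_partial_test:
  assumes "k \<in> borel_measurable borel" "\<And>x. cmod (k x) \<le> K" "\<phi> \<in> test_functions"
  shows "S (\<lambda>y. k y * \<phi> y) = - (LINT x|lborel. S (\<lambda>y. indicator {..x} y *\<^sub>R k y) * vderiv \<phi> x)"
proof -
  have "(LINT x|lborel. vderiv \<phi> x * S (\<lambda>y. indicator {..x} y *\<^sub>R k y)) = S (\<lambda>y. k y * - \<phi> y)"
    using S_Fubini(2)[OF assms(1,2) test_integrable[OF test_vderiv[OF assms(3)]]]
    by (simp add: test_FTC_ge[OF assms(3)])
  also have "\<dots> = - S (\<lambda>y. k y * \<phi> y)" using S_cmult[of "-1" "\<lambda>y. k y * \<phi> y"] by simp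
  finally show ?thesis by (simp add: mult.commute)
qed

end

section \<open>Square integrable functions\<close>

lemma L2_measurable: "f \<in> L2 \<Longrightarrow> f \<in> borel_measurable borel"
  by (simp add: L2_def)

lemma L2_integrable: "f \<in> L2 \<Longrightarrow> integrable lborel (\<lambda>x. (cmod (f x))\<^sup>2)"
  by (simp add: L2_def)

lemma L2_mult_bound: "cmod (a * b) \<le> (cmod a)\<^sup>2 + (cmod b)\<^sup>2"
proof -
  have "0 \<le> (cmod a - cmod b)\<^sup>2" by simp
  then have "2 * (cmod a * cmod b) \<le> (cmod a)\<^sup>2 + (cmod b)\<^sup>2"
    by (simp add: power2_diff)
  moreover have "0 \<le> cmod a * cmod b" by simp
  ultimately show ?thesis unfolding norm_mult by linarith
qed

lemma L2_mult_integrable: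
  assumes "f \<in> L2" "g \<in> L2"
  shows "integrable lborel (\<lambda>x. f x * g x)"
proof (rule Bochner_Integration.integrable_bound)
  show "integrable lborel (\<lambda>x. (cmod (f x))\<^sup>2 + (cmod (g x))\<^sup>2)"
    using assms by (intro Bochner_Integration.integrable_add L2_integrable)
  show "AE x in lborel. norm (f x * g x) \<le> norm ((cmod (f x))\<^sup>2 + (cmod (g x))\<^sup>2)"
    using L2_mult_bound by (intro AE_I2) (simp add: order_trans)
  show "(\<lambda>x. f x * g x) \<in> borel_measurable lborel"
    using assms[THEN L2_measurable] by simp
qed

lemma L2_cnj: "f \<in> L2 \<Longrightarrow> (\<lambda>x. cnj (f x)) \<in> L2"
proof -
  assume f: "f \<in> L2"
  have "cnj \<in> borel_measurable borel" by (intro borel_measurable_continuous_onI continuous_intros)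
  then have "(\<lambda>x. cnj (f x)) \<in> borel_measurable borel"
    using L2_measurable[OF f] by (rule measurable_compose_rev)
  then show ?thesis using f by (simp add: L2_def)
qed

lemma L2_bounded_mult:
  assumes "f \<in> L2" and [measurable]: "w \<in> borel_measurable borel" and w: "\<And>x. cmod (w x) \<le> B"
  shows "(\<lambda>x. w x * f x) \<in> L2"
  unfolding L2_def
proof (intro CollectI conjI)
  have [measurable]: "f \<in> borel_measurable borel" using assms by (simp add: L2_def)
  show "(\<lambda>x. w x * f x) \<in> borel_measurable lborel" by simp
  show "integrable lborel (\<lambda>x. (cmod (w x * f x))\<^sup>2)"
  proof (rule Bochner_Integration.integrable_bound)
    show "integrable lborel (\<lambda>x. B\<^sup>2 * (cmod (f x))\<^sup>2)"
      using L2_integrable[OF assms(1)] by simp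
    show "AE x in lborel. norm ((cmod (w x * f x))\<^sup>2) \<le> norm (B\<^sup>2 * (cmod (f x))\<^sup>2)"
      using w by (intro AE_I2) (auto simp: norm_mult power_mult_distrib intro!: mult_right_mono power_mono)
  qed simp
qed

lemma L2_cmult: "f \<in> L2 \<Longrightarrow> (\<lambda>x. c * f x) \<in> L2"
  by (rule L2_bounded_mult[of f "\<lambda>x. c" "cmod c"]) auto

lemma L2_add:
  assumes "f \<in> L2" "g \<in> L2" shows "(\<lambda>x. f x + g x) \<in> L2"
  unfolding L2_def
proof (intro CollectI conjI)
  have [measurable]: "f \<in> borel_measurable borel" "g \<in> borel_measurable borel"
    using assms by (simp_all add: L2_def)
  show "(\<lambda>x. f x + g x) \<in> borel_measurable lborel" by simp
  show "integrable lborel (\<lambda>x. (cmod (f x + g x))\<^sup>2)"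
  proof (rule Bochner_Integration.integrable_bound)
    show "integrable lborel (\<lambda>x. 2 * (cmod (f x))\<^sup>2 + 2 * (cmod (g x))\<^sup>2)"
      using assms[THEN L2_integrable] by simp
    have "(cmod (f x + g x))\<^sup>2 \<le> 2 * (cmod (f x))\<^sup>2 + 2 * (cmod (g x))\<^sup>2" for x
    proof -
      have "(cmod (f x + g x))\<^sup>2 \<le> (cmod (f x) + cmod (g x))\<^sup>2"
        by (intro power_mono norm_triangle_ineq) simp
      also have "\<dots> \<le> 2 * (cmod (f x))\<^sup>2 + 2 * (cmod (g x))\<^sup>2"
        using zero_le_power2[of "cmod (f x) - cmod (g x)"] by (simp add: power2_sum power2_diff)
      finally show ?thesis .
    qed
    then show "AE x in lborel. norm ((cmod (f x + g x))\<^sup>2) \<le> norm (2 * (cmod (f x))\<^sup>2 + 2 * (cmod (g x))\<^sup>2)"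
      by (intro AE_I2) simp
  qed simp
qed

lemma L2_cong_AE:
  assumes "f \<in> L2" "g \<in> borel_measurable borel" "AE x in lborel. f x = g x"
  shows "g \<in> L2"
proof -
  have "integrable lborel (\<lambda>x. (cmod (g x))\<^sup>2)"
    using L2_integrable[OF assms(1)]
  proof (rule integrable_cong_AE_imp)
    show "AE x in lborel. (cmod (f x))\<^sup>2 = (cmod (g x))\<^sup>2" using assms(3) by eventually_elim simp
  qed (use assms in simp)
  then show ?thesis using assms by (simp add: L2_def)
qed

lemma L2_L1_loc: "f \<in> L2 \<Longrightarrow> f \<in> L1_loc"
  unfolding L1_loc_def
proof (intro CollectI conjI allI)
  assume f: "f \<in> L2"
  then show "f \<in> borel_measurable lborel" by (simp add: L2_def)
  fix a b
  have i: "(\<lambda>x. indicator {a..b} x :: complex) \<in> L2"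
  proof -
    have "(\<lambda>x. (cmod (indicator {a..b} x))\<^sup>2) = (\<lambda>x. indicator {a..b} x *\<^sub>R (1::real))"
      by (auto simp: indicator_def)
    then show ?thesis
      using borel_integrable_atLeastAtMost'[of a b "\<lambda>x. 1::real"] by (simp add: L2_def set_integrable_def)
  qed
  have "(\<lambda>x. indicator {a..b} x * f x) = (\<lambda>x. indicat_real {a..b} x *\<^sub>R f x)"
    by (auto simp: indicator_def)
  with L2_mult_integrable[OF i f] show "set_integrable lborel {a..b} f"
    by (simp add: set_integrable_def)
qed

text \<open>Average \<open>\<bar>U(x)\<bar>\<^sup>2 \<le> \<bar>U(y)\<bar>\<^sup>2 + 2\<integral>\<bar>U'U\<bar>\<close> over \<open>y \<in> [x-1,x]\<close>.\<close>

lemma H1_bounded: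
  assumes U: "U \<in> L2" and v: "v \<in> L2" and prim: "\<And>R. prim_on R U v"
  shows "(cmod (U x))\<^sup>2 \<le> (LINT y|lborel. (cmod (U y))\<^sup>2)
    + 2 * (LINT y|lborel. (cmod (U y))\<^sup>2 + (cmod (v y))\<^sup>2)"
proof -
  define D where "D = 2 * (LINT y|lborel. (cmod (U y))\<^sup>2 + (cmod (v y))\<^sup>2)"
  define w where "w y = v y * cnj (U y) + U y * cnj (v y)" for y
  have sum: "integrable lborel (\<lambda>y. (cmod (U y))\<^sup>2 + (cmod (v y))\<^sup>2)"
    using U v by (simp add: L2_integrable)
  have wb: "cmod (w y) \<le> 2 * ((cmod (U y))\<^sup>2 + (cmod (v y))\<^sup>2)" for y
    unfolding w_def using L2_mult_bound[of "v y" "cnj (U y)"] L2_mult_bound[of "U y" "cnj (v y)"]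
    by (intro order_trans[OF norm_triangle_ineq]) simp
  have step: "(cmod (U x))\<^sup>2 \<le> (cmod (U y))\<^sup>2 + D" if "y \<le> x" for y
  proof -
    have p: "prim_on y (\<lambda>x. U x * cnj (U x)) w"
      unfolding w_def by (intro prim_on_mult prim_on_cnj prim)
    have "U x * cnj (U x) = U y * cnj (U y) + (LINT t:{y..x}|lborel. w t)"
      using prim_onD(2)[OF p that] .
    then have "complex_of_real ((cmod (U x))\<^sup>2) = of_real ((cmod (U y))\<^sup>2) + (LINT t:{y..x}|lborel. w t)"
      by (simp add: complex_norm_square[symmetric])
    then have "(cmod (U x))\<^sup>2 = (cmod (U y))\<^sup>2 + Re (LINT t:{y..x}|lborel. w t)"
      by (metis Re_complex_of_real plus_complex.sel(1))
    also have "Re (LINT t:{y..x}|lborel. w t) \<le> cmod (LINT t:{y..x}|lborel. w t)" by (rule complex_Re_le_cmod)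
    also have "\<dots> \<le> (LINT t|lborel. norm (indicator {y..x} t *\<^sub>R w t))"
      unfolding set_lebesgue_integral_def by (rule integral_norm_bound)
    also have "\<dots> \<le> (LINT t|lborel. 2 * ((cmod (U t))\<^sup>2 + (cmod (v t))\<^sup>2))"
    proof (rule integral_mono)
      show "integrable lborel (\<lambda>t. norm (indicator {y..x} t *\<^sub>R w t))"
        using prim_onD(1)[OF p that] unfolding set_integrable_def by (rule integrable_norm)
      show "norm (indicator {y..x} t *\<^sub>R w t) \<le> 2 * ((cmod (U t))\<^sup>2 + (cmod (v t))\<^sup>2)" for t
        using wb[of t] by (auto simp: indicator_def)
    qed (intro integrable_mult_right sum)
    also have "\<dots> = D" unfolding D_def by (rule integral_mult_right_zero)
    finally show ?thesis by simp
  qed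
  have "(LINT y|lborel. indicator {x-1..x} y *\<^sub>R ((cmod (U x))\<^sup>2 - D)) \<le> (LINT y|lborel. (cmod (U y))\<^sup>2)"
  proof (rule integral_mono)
    show "integrable lborel (\<lambda>y. indicator {x-1..x} y *\<^sub>R ((cmod (U x))\<^sup>2 - D))"
      using borel_integrable_atLeastAtMost'[of "x-1" x "\<lambda>y. (cmod (U x))\<^sup>2 - D"]
      by (simp add: set_integrable_def)
    show "indicator {x-1..x} y *\<^sub>R ((cmod (U x))\<^sup>2 - D) \<le> (cmod (U y))\<^sup>2" for y
      using step[of y] by (auto simp: indicator_def)
  qed (rule L2_integrable[OF U])
  then show ?thesis by (simp add: D_def)
qed

section \<open>Solutions as absolutely continuous functions\<close>

text \<open>\<open>v\<close> is prescribed at every point by \<open>v_eq\<close>, not merely almost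
  everywhere, since its boundary values at the edge of the support are used. The integral over {..x}
  includes an atom at \<open>x\<close>, so there \<open>v\<close> carries the value from the right.
  \<open>c\<close> is the constant of integration.\<close>

locale ode_solution = compact_signed_measure +
  fixes h :: real and z :: complex and g U v \<Gamma> :: "real \<Rightarrow> complex" and c :: complex
  assumes h_pos: "h > 0"
    and g_L2: "g \<in> L2" and U_L2: "U \<in> L2" and v_L2: "v \<in> L2"
    and U_bounded: "bounded (range U)"
    and U_prim: "\<And>r. prim_on r U v"
    and \<Gamma>_prim: "\<And>r. prim_on r \<Gamma> (\<lambda>x. g x + z * U x)"
    and v_eq: "\<And>x. of_real (h\<^sup>2) * v x = c + signed_integral V (\<lambda>y. indicator {..x} y *\<^sub>R U y) - \<Gamma> x"

text \<open>Du Bois-Reymond's lemma is applied twice: to \<open>u\<close> minus a primitive of its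
  weak derivative, and to h^2 u' minus the cumulative integral of \<open>u V\<close> plus a
  primitive of \<open>g + z u\<close>.\<close>

lemma (in compact_signed_measure) solution_ode:
  assumes sol: "solves_shifted V h z u g" and g: "g \<in> L2" and h: "h > 0"
  obtains U v \<Gamma> c where "ode_solution V R h z g U v \<Gamma> c" "AE x in lborel. u x = U x"
proof -
  have u: "u \<in> L2" "u \<in> H1" using sol by (auto simp: solves_shifted_def P_domain_def H1_def)
  then obtain v0 where v0: "v0 \<in> L2" "weak_derivative u v0" by (auto simp: H1_def)
  have e: "(\<lambda>x. u x - prim v0 x) \<in> L1_loc"
    by (intro L1_loc_diff L2_L1_loc u continuous_L1_loc L1_loc_prim_continuous v0)
  have "(LINT x|lborel. (u x - prim v0 x) * vderiv \<phi> x) = 0" if \<phi>: "\<phi> \<in> test_functions" for \<phi>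
  proof -
    have "(LINT x|lborel. (u x - prim v0 x) * vderiv \<phi> x)
        = (LINT x|lborel. u x * vderiv \<phi> x) - (LINT x|lborel. prim v0 x * vderiv \<phi> x)"
      unfolding left_diff_distrib
      by (intro Bochner_Integration.integral_diff L1_loc_mult_test L2_L1_loc u test_vderiv \<phi>
          continuous_L1_loc L1_loc_prim_continuous v0)
    also have "(LINT x|lborel. u x * vderiv \<phi> x) = - (LINT x|lborel. v0 x * \<phi> x)"
      using v0 \<phi> by (auto simp: weak_derivative_def)
    also have "(LINT x|lborel. prim v0 x * vderiv \<phi> x) = - (LINT x|lborel. v0 x * \<phi> x)"
      by (intro weak_of_prim_on prim_on_prim L2_L1_loc v0 \<phi>)
    finally show ?thesis by simp
  qed
  then obtain c0 where c0: "AE x in lborel. u x - prim v0 x = c0"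
    using du_bois_reymond[OF e] by blast
  define U where "U x = c0 + prim v0 x" for x
  have uU: "AE x in lborel. u x = U x"
    using c0 unfolding U_def by eventually_elim (simp add: algebra_simps)
  have U0: "prim_on r U v0" for r
  proof (rule prim_onI)
    fix t assume "r \<le> t"
    from prim_onD[OF prim_on_prim[OF L2_L1_loc[OF v0(1)]] this]
    show "set_integrable lborel {r..t} v0" "U t = U r + (LINT x:{r..t}|lborel. v0 x)"
      by (auto simp: U_def)
  qed
  have cont: "continuous_on UNIV U" by (rule prim_on_continuous[OF U0])
  have [measurable]: "U \<in> borel_measurable borel" using cont by (rule borel_measurable_continuous_onI)
  have U_L2: "U \<in> L2" by (rule L2_cong_AE[OF u(1) _ uU]) simp
  \<comment> \<open>The uniform bound identifies \<open>U\<close> with \<open>cont_rep u\<close>,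
    the representative that multiplies \<open>V\<close>, and makes the cumulative integral locally
    integrable.\<close>
  define K where "K = sqrt ((LINT y|lborel. (cmod (U y))\<^sup>2)
    + 2 * (LINT y|lborel. (cmod (U y))\<^sup>2 + (cmod (v0 y))\<^sup>2))"
  have K: "cmod (U x) \<le> K" for x
    unfolding K_def by (rule real_le_rsqrt[OF H1_bounded[OF U_L2 v0(1) U0]])
  have bdd: "bounded (range U)" using K by (auto simp: bounded_iff)
  have rep: "cont_rep u = U" by (rule cont_rep_eqI[OF cont bdd uU])
  define \<Gamma> where "\<Gamma> = prim (\<lambda>x. g x + z * U x)"
  have gU: "(\<lambda>x. g x + z * U x) \<in> L1_loc" by (intro L1_loc_add L1_loc_cmult L2_L1_loc g U_L2)
  have \<Gamma>: "prim_on r \<Gamma> (\<lambda>x. g x + z * U x)" for r unfolding \<Gamma>_def by (rule prim_on_prim[OF gU])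
  define m where "m x = S (\<lambda>y. indicator {..x} y *\<^sub>R U y)" for x
  have m: "m \<in> L1_loc" unfolding m_def by (rule S_partial_L1_loc[OF _ K]) simp
  have [measurable]: "m \<in> borel_measurable borel" "\<Gamma> \<in> borel_measurable borel"
    using m L1_loc_prim_continuous[OF gU] borel_measurable_continuous_onI
    by (auto simp: L1_loc_def \<Gamma>_def)
  define e where "e x = of_real (h\<^sup>2) * v0 x - m x + \<Gamma> x" for x
  have \<Gamma>': "\<Gamma> \<in> L1_loc" unfolding \<Gamma>_def by (intro continuous_L1_loc L1_loc_prim_continuous gU)
  have hv: "(\<lambda>x. of_real (h\<^sup>2) * v0 x) \<in> L1_loc" by (intro L1_loc_cmult L2_L1_loc v0)
  have e_loc: "e \<in> L1_loc" unfolding e_def by (intro L1_loc_add L1_loc_diff hv m \<Gamma>')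
  have "(LINT x|lborel. e x * vderiv \<phi> x) = 0" if \<phi>: "\<phi> \<in> test_functions" for \<phi>
  proof -
    have \<phi>': "vderiv \<phi> \<in> test_functions" by (rule test_vderiv[OF \<phi>])
    have 1: "(LINT x|lborel. of_real (h\<^sup>2) * v0 x * vderiv \<phi> x) = - of_real (h\<^sup>2) * dist_of u (vderiv (vderiv \<phi>))"
    proof -
      have "(LINT x|lborel. of_real (h\<^sup>2) * v0 x * vderiv \<phi> x) = of_real (h\<^sup>2) * (LINT x|lborel. v0 x * vderiv \<phi> x)"
        unfolding mult.assoc by simp
      moreover have "dist_of u (vderiv (vderiv \<phi>)) = - (LINT x|lborel. v0 x * vderiv \<phi> x)"
        using v0 \<phi>' by (auto simp: weak_derivative_def dist_of_def)
      ultimately show ?thesis by simp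
    qed
    have 2: "S (\<lambda>y. U y * \<phi> y) = - (LINT x|lborel. m x * vderiv \<phi> x)"
      unfolding m_def by (rule S_partial_test[OF _ K \<phi>]) simp
    have "(LINT x|lborel. \<Gamma> x * vderiv \<phi> x) = - (LINT x|lborel. (g x + z * U x) * \<phi> x)"
      by (rule weak_of_prim_on[OF \<Gamma> gU \<phi>])
    also have "(LINT x|lborel. (g x + z * U x) * \<phi> x) = dist_of g \<phi> + (LINT x|lborel. z * (U x * \<phi> x))"
      unfolding dist_of_def distrib_right mult.assoc
      by (intro Bochner_Integration.integral_add L1_loc_mult_test L2_L1_loc g U_L2 \<phi>
          integrable_mult_right)
    also have "(LINT x|lborel. z * (U x * \<phi> x)) = z * dist_of u \<phi>"
    proof -
      have "(LINT x|lborel. U x * \<phi> x) = (LINT x|lborel. u x * \<phi> x)"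
        using uU L2_measurable[OF u(1)] test_measurable[OF \<phi>]
        by (intro integral_cong_AE) (auto elim!: AE_mp)
      then show ?thesis by (simp add: dist_of_def)
    qed
    finally have 3: "(LINT x|lborel. \<Gamma> x * vderiv \<phi> x) = - (dist_of g \<phi> + z * dist_of u \<phi>)" .
    have "P_dist V h u \<phi> - z * dist_of u \<phi> = dist_of g \<phi>"
      using sol \<phi> by (auto simp: solves_shifted_def)
    then have 4: "- of_real (h\<^sup>2) * dist_of u (vderiv (vderiv \<phi>)) + S (\<lambda>y. U y * \<phi> y) - z * dist_of u \<phi> = dist_of g \<phi>"
      by (simp add: P_dist_def rep)
    have eq: "(LINT x|lborel. e x * vderiv \<phi> x) = (LINT x|lborel. of_real (h\<^sup>2) * v0 x * vderiv \<phi> x)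
        - (LINT x|lborel. m x * vderiv \<phi> x) + (LINT x|lborel. \<Gamma> x * vderiv \<phi> x)"
      unfolding e_def distrib_right left_diff_distrib
      using L1_loc_mult_test[OF hv \<phi>'] L1_loc_mult_test[OF m \<phi>'] L1_loc_mult_test[OF \<Gamma>' \<phi>']
      by simp
    have M: "(LINT x|lborel. m x * vderiv \<phi> x) = - S (\<lambda>y. U y * \<phi> y)" using 2 by simp
    have "A - - B + - (G + Z) = 0" if "A + B - Z = G" for A B G Z :: complex
      using that by (simp add: algebra_simps)
    from this[OF 4] show ?thesis unfolding eq M 1 3 .
  qed
  then obtain c where c: "AE x in lborel. e x = c" using du_bois_reymond[OF e_loc] by blast
  \<comment> \<open>The weak derivative is changed on a null set into the function that satisfies
    the first-order equation everywhere; \<open>U\<close> remains its primitive.\<close>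
  define v where "v x = (c + m x - \<Gamma> x) / of_real (h\<^sup>2)" for x
  have [measurable]: "v \<in> borel_measurable borel" unfolding v_def by measurable
  have v0v: "AE x in lborel. v0 x = v x"
    using c unfolding e_def v_def by eventually_elim (use h in \<open>simp add: field_simps\<close>)
  have v_L2: "v \<in> L2" by (rule L2_cong_AE[OF v0(1) _ v0v]) simp
  have "prim_on r U v" for r
  proof (rule prim_onI)
    fix t assume "r \<le> t"
    show "set_integrable lborel {r..t} v" by (intro L1_loc_set_integrable L2_L1_loc v_L2)
    have "(LINT x:{r..t}|lborel. v0 x) = (LINT x:{r..t}|lborel. v x)"
      using L2_measurable[OF v0(1)] v0v by (intro set_lebesgue_integral_cong_AE) (auto elim: AE_mp)
    then show "U t = U r + (LINT x:{r..t}|lborel. v x)"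
      using prim_onD(2)[OF U0 \<open>r \<le> t\<close>] by simp
  qed
  moreover have "of_real (h\<^sup>2) * v x = c + m x - \<Gamma> x" for x using h by (simp add: v_def)
  ultimately have "ode_solution V R h z g U v \<Gamma> c"
    using h g U_L2 v_L2 bdd \<Gamma> by unfold_locales (auto simp: m_def)
  then show ?thesis using that uU by blast
qed

section \<open>The energy identity and uniqueness\<close>

lemma lborel_reflect:
  fixes f :: "real \<Rightarrow> 'a::euclidean_space"
  shows "(LINT x|lborel. f (- x)) = (LINT x|lborel. f x)"
    and "integrable lborel (\<lambda>x. f (- x)) \<longleftrightarrow> integrable lborel f"
  using lborel_integral_real_affine[of "-1" f 0] lborel_integrable_real_affine_iff[of "-1" f 0] by simp_all

lemma L2_reflect: "f \<in> L2 \<Longrightarrow> (\<lambda>x. f (- x)) \<in> L2"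
  unfolding L2_def using lborel_reflect(2)[of "\<lambda>x. (cmod (f x))\<^sup>2"] by auto

text \<open>The left half line is treated as the right half line of the reflected functions. The
  derivative changes sign once per reflection, so the second-order equation keeps its form.\<close>

lemma prim_on_reflect:
  assumes "\<And>r. prim_on r U v"
  shows "prim_on r (\<lambda>x. U (- x)) (\<lambda>x. - v (- x))"
proof (rule prim_onI)
  fix t assume t: "r \<le> t"
  define F where "F y = indicat_real {-t..-r} y *\<^sub>R v y" for y
  have eq: "indicat_real {r..t} x *\<^sub>R - v (- x) = - F (- x)" for x
    by (auto simp: indicator_def F_def)
  have i: "integrable lborel F"
    using prim_onD(1)[OF assms, of "-t" "-r"] t by (simp add: set_integrable_def F_def[abs_def])
  show "set_integrable lborel {r..t} (\<lambda>x. - v (- x))"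
    unfolding set_integrable_def eq using lborel_reflect(2)[of F] i by (intro Bochner_Integration.integrable_minus) simp
  have "(LINT x:{r..t}|lborel. - v (- x)) = - (LINT x:{-t..-r}|lborel. v x)"
    unfolding set_lebesgue_integral_def eq using lborel_reflect(1)[of F] by (simp add: F_def)
  then show "U (- t) = U (- r) + (LINT x:{r..t}|lborel. - v (- x))"
    using prim_onD(2)[OF assms, of "-t" "-r"] t by simp
qed

lemma L2_set_integrable_mult:
  assumes "f \<in> L2" "g \<in> L2" "A \<in> sets borel" shows "set_integrable lborel A (\<lambda>x. f x * g x)"
  unfolding set_integrable_def using L2_mult_integrable[OF assms(1,2)] assms(3)
  by (intro integrable_mult_indicator) auto

text \<open>Multiply -h^2 U'' = g + z U by cnj U and integrate by parts; h^2 v cnj U and its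
  derivative are both integrable, so nothing is left at infinity.\<close>

lemma half_line_Green:
  assumes U: "U \<in> L2" and v: "v \<in> L2" and g: "g \<in> L2"
    and pU: "prim_on r U v" and pv: "prim_on r v (\<lambda>x. - (g x + z * U x) / of_real (h\<^sup>2))" and h: "h > 0"
  shows "(LINT x:{r..}|lborel. of_real (h\<^sup>2) * (v x * cnj (v x)) - (g x + z * U x) * cnj (U x))
    = - of_real (h\<^sup>2) * v r * cnj (U r)"
proof -
  have "prim_on r (\<lambda>x. of_real (h\<^sup>2) * (v x * cnj (U x)))
      (\<lambda>x. of_real (h\<^sup>2) * ((- (g x + z * U x) / of_real (h\<^sup>2)) * cnj (U x) + v x * cnj (v x)))"
    by (intro prim_on_cmult prim_on_mult pv prim_on_cnj pU)
  moreover have "(\<lambda>x. of_real (h\<^sup>2) * ((- (g x + z * U x) / of_real (h\<^sup>2)) * cnj (U x) + v x * cnj (v x)))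
      = (\<lambda>x. of_real (h\<^sup>2) * (v x * cnj (v x)) - (g x + z * U x) * cnj (U x))"
    using h by (auto simp: field_simps)
  ultimately have p: "prim_on r (\<lambda>x. of_real (h\<^sup>2) * (v x * cnj (U x)))
      (\<lambda>x. of_real (h\<^sup>2) * (v x * cnj (v x)) - (g x + z * U x) * cnj (U x))" by simp
  show ?thesis
    using prim_on_integral[OF p] L2_set_integrable_mult[OF v L2_cnj[OF v], of "{r..}"]
      L2_set_integrable_mult[OF v L2_cnj[OF U], of "{r..}"]
      L2_set_integrable_mult[OF L2_add[OF g L2_cmult[OF U]] L2_cnj[OF U], of "{r..}" z]
    by (simp add: mult.assoc set_integral_diff)
qed

context ode_solution
begin

lemma U_cont: "continuous_on UNIV U" by (rule prim_on_continuous[OF U_prim])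

lemma U_meas [measurable]: "U \<in> borel_measurable borel"
  using U_cont by (rule borel_measurable_continuous_onI)

lemma \<Gamma>_meas [measurable]: "\<Gamma> \<in> borel_measurable borel"
  by (intro borel_measurable_continuous_onI prim_on_continuous[OF \<Gamma>_prim])

lemma g_meas [measurable]: "g \<in> borel_measurable borel" by (rule L2_measurable[OF g_L2])

lemma v_meas [measurable]: "v \<in> borel_measurable borel" by (rule L2_measurable[OF v_L2])

text \<open>The limit of \<open>v\<close> at -R from the left. It differs from
  \<open>v (- R)\<close> by the contribution of an atom of \<open>V\<close> at -R.\<close>

definition vl :: complex where "vl = (c - \<Gamma> (- R)) / of_real (h\<^sup>2)"

text \<open>Derivative of the reflected \<open>U\<close>, corrected at the single point R so that it
  is absolutely continuous on the closed half line even when \<open>V\<close> has an atom at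
  -R.\<close>

definition vL :: "real \<Rightarrow> complex" where "vL = (\<lambda>x. - v (- x))(R := - vl)"

lemma v_right:
  assumes "R \<le> x" shows "of_real (h\<^sup>2) * v x = c + S U - \<Gamma> x"
proof -
  have "S (\<lambda>y. indicator {..x} y *\<^sub>R U y) = S U"
    by (rule S_cong) (use assms in \<open>auto simp: indicator_def\<close>)
  then show ?thesis using v_eq[of x] by simp
qed

lemma v_left:
  assumes "x < - R" shows "of_real (h\<^sup>2) * v x = c - \<Gamma> x"
proof -
  have "S (\<lambda>y. indicator {..x} y *\<^sub>R U y) = S (\<lambda>y. 0)"
    by (rule S_cong) (use assms in \<open>auto simp: indicator_def\<close>)
  then show ?thesis using v_eq[of x] by (simp add: signed_integral_def)
qed

text \<open>From R on the cumulative integral is the constant \<open>S U\<close>, so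
  \<open>v\<close> is absolutely continuous there although it may jump inside the support.\<close>

lemma v_prim_right: "prim_on R v (\<lambda>x. - (g x + z * U x) / of_real (h\<^sup>2))"
proof (rule prim_onI)
  fix t assume t: "R \<le> t"
  have "- a / b = (- 1 / b) * a" for a b :: complex by simp
  note eq = this[of "g _ + z * U _" "of_real (h\<^sup>2)"]
  show "set_integrable lborel {R..t} (\<lambda>x. - (g x + z * U x) / of_real (h\<^sup>2))"
    unfolding eq by (intro set_integrable_mult_right prim_onD(1)[OF \<Gamma>_prim t])
  have "of_real (h\<^sup>2) * v t = of_real (h\<^sup>2) * v R - (\<Gamma> t - \<Gamma> R)"
    using v_right[OF t] v_right[of R] by simp
  then have "v t = v R - (\<Gamma> t - \<Gamma> R) / of_real (h\<^sup>2)" using h_pos by (simp add: field_simps)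
  also have "(\<Gamma> t - \<Gamma> R) / of_real (h\<^sup>2) = - (LINT x:{R..t}|lborel. - (g x + z * U x) / of_real (h\<^sup>2))"
    unfolding eq set_integral_mult_right using prim_onD(2)[OF \<Gamma>_prim t] by simp
  finally show "v t = v R + (LINT x:{R..t}|lborel. - (g x + z * U x) / of_real (h\<^sup>2))" by simp
qed

lemma vL_eq:
  assumes "R \<le> x" shows "of_real (h\<^sup>2) * vL x = - (c - \<Gamma> (- x))"
proof (cases "x = R")
  case True
  then show ?thesis using h_pos by (simp add: vL_def vl_def)
next
  case False
  then show ?thesis using assms v_left[of "- x"] by (simp add: vL_def)
qed

lemma vL_AE: "AE x in lborel. - v (- x) = vL x"
  using AE_lborel_singleton[of R] by eventually_elim (simp add: vL_def)

lemma vL_L2: "vL \<in> L2"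
proof (rule L2_cong_AE)
  show "(\<lambda>x. - 1 * v (- x)) \<in> L2" by (intro L2_cmult L2_reflect v_L2)
  show "vL \<in> borel_measurable borel" unfolding vL_def fun_upd_def by measurable
qed (use vL_AE in simp)

lemma U_prim_left: "prim_on R (\<lambda>x. U (- x)) vL"
proof (rule prim_onI)
  fix t assume t: "R \<le> t"
  note p = prim_onD[OF prim_on_reflect[OF U_prim, of R] t]
  show "set_integrable lborel {R..t} vL" by (intro L1_loc_set_integrable L2_L1_loc vL_L2)
  have "(LINT x:{R..t}|lborel. - v (- x)) = (LINT x:{R..t}|lborel. vL x)"
    using vL_AE L2_measurable[OF vL_L2]
    by (intro set_lebesgue_integral_cong_AE) (auto elim: AE_mp)
  then show "U (- t) = U (- R) + (LINT x:{R..t}|lborel. vL x)" using p(2) by simp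
qed

lemma vL_prim: "prim_on R vL (\<lambda>x. - (g (- x) + z * U (- x)) / of_real (h\<^sup>2))"
proof (rule prim_onI)
  fix t assume t: "R \<le> t"
  note p = prim_onD[OF prim_on_reflect[OF \<Gamma>_prim, of R] t]
  show "set_integrable lborel {R..t} (\<lambda>x. - (g (- x) + z * U (- x)) / of_real (h\<^sup>2))"
    using p(1) by simp
  have "of_real (h\<^sup>2) * vL t = of_real (h\<^sup>2) * vL R + (\<Gamma> (- t) - \<Gamma> (- R))"
    using vL_eq[OF t] vL_eq[of R] by simp
  then have "vL t = vL R + (\<Gamma> (- t) - \<Gamma> (- R)) / of_real (h\<^sup>2)" using h_pos by (simp add: field_simps)
  also have "(\<Gamma> (- t) - \<Gamma> (- R)) / of_real (h\<^sup>2) = (LINT x:{R..t}|lborel. - (g (- x) + z * U (- x)) / of_real (h\<^sup>2))"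
    using p(2) by (simp add: set_lebesgue_integral_def)
  finally show "vL t = vL R + (LINT x:{R..t}|lborel. - (g (- x) + z * U (- x)) / of_real (h\<^sup>2))" .
qed

text \<open>Formally (-h^2 U'' - z U - g) cnj U after one integration by parts, so its integral
  should be minus the integral of |U|^2 against \<open>V\<close>. As \<open>U\<close> is not a test
  function, this is verified piece by piece.\<close>

definition T :: "real \<Rightarrow> complex" where
  "T x = of_real (h\<^sup>2) * (v x * cnj (v x)) - (g x + z * U x) * cnj (U x)"

lemma T_integrable: "integrable lborel T"
  unfolding T_def
  by (intro Bochner_Integration.integrable_diff integrable_mult_right L2_mult_integrable L2_cnj
      L2_add L2_cmult g_L2 U_L2 v_L2)

lemma T_right: "(LINT x:{R..}|lborel. T x) = - of_real (h\<^sup>2) * v R * cnj (U R)"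
  unfolding T_def by (rule half_line_Green[OF U_L2 v_L2 g_L2 U_prim v_prim_right h_pos])

lemma T_left: "(LINT x:{..-R}|lborel. T x) = (c - \<Gamma> (- R)) * cnj (U (- R))"
proof -
  have "(LINT x:{..-R}|lborel. T x) = (LINT x:{R..}|lborel. T (- x))"
    unfolding set_lebesgue_integral_def
    by (subst lborel_reflect(1)[symmetric]) (simp add: indicator_def cong: if_cong)
  also have "\<dots> = (LINT x:{R..}|lborel. of_real (h\<^sup>2) * (vL x * cnj (vL x))
      - (g (- x) + z * U (- x)) * cnj (U (- x)))"
  proof (rule set_lebesgue_integral_cong_AE)
    show "AE x in lborel. x \<in> {R..} \<longrightarrow> T (- x) = of_real (h\<^sup>2) * (vL x * cnj (vL x))
      - (g (- x) + z * U (- x)) * cnj (U (- x))"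
      using vL_AE
    proof eventually_elim
      case (elim x)
      show ?case unfolding elim[symmetric] by (simp add: T_def)
    qed
    have [measurable]: "T \<in> borel_measurable borel" using T_integrable by simp
    have [measurable]: "vL \<in> borel_measurable borel" by (rule L2_measurable[OF vL_L2])
    have [measurable]: "cnj \<in> borel_measurable borel"
      by (intro borel_measurable_continuous_onI continuous_intros)
    show "(\<lambda>x. T (- x)) \<in> borel_measurable lborel" by measurable
    show "(\<lambda>x. of_real (h\<^sup>2) * (vL x * cnj (vL x))
      - (g (- x) + z * U (- x)) * cnj (U (- x))) \<in> borel_measurable lborel" by measurable
  qed simp_all
  also have "\<dots> = - of_real (h\<^sup>2) * vL R * cnj (U (- R))"
    by (rule half_line_Green[OF L2_reflect[OF U_L2] vL_L2 L2_reflect[OF g_L2] U_prim_left vL_prim h_pos])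
  also have "\<dots> = (c - \<Gamma> (- R)) * cnj (U (- R))" using vL_eq[of R] by simp
  finally show ?thesis .
qed

lemma U_norm_bound: obtains K where "K > 0" "\<And>x. cmod (U x) \<le> K"
  using U_bounded that unfolding bounded_pos by (metis rangeI)

text \<open>On the support \<open>v\<close> may be discontinuous. Its part
  \<open>c - \<Gamma>\<close> obeys the product rule, its part from the cumulative integral is
  handled by Fubini against \<open>V\<close>; together they leave boundary terms and minus the
  potential energy.\<close>

lemma T_middle: "(LINT x:{-R..R}|lborel. T x)
  = of_real (h\<^sup>2) * v R * cnj (U R) - S (\<lambda>y. U y * cnj (U y)) - (c - \<Gamma> (- R)) * cnj (U (- R))"
proof -
  have RR: "- R \<le> R" using R_pos by simp
  obtain K where K: "K > 0" "\<And>x. cmod (U x) \<le> K" using U_norm_bound by blast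
  define b where "b x = indicator {-R..R} x *\<^sub>R cnj (v x)" for x
  have pc: "prim_on (-R) (\<lambda>x. cnj (U x)) (\<lambda>x. cnj (v x))" by (intro prim_on_cnj U_prim)
  have b: "integrable lborel b"
    using prim_onD(1)[OF pc RR] unfolding b_def set_integrable_def .
  define m where "m x = S (\<lambda>y. indicator {..x} y *\<^sub>R U y)" for x
  have m_int: "integrable lborel (\<lambda>x. b x * m x)"
    and m_eq: "(LINT x|lborel. b x * m x) = S (\<lambda>y. U y * (LINT x|lborel. indicator {y..} x *\<^sub>R b x))"
    unfolding m_def by (rule S_Fubini[OF U_meas K(2) b])+
  have [measurable]: "cnj \<in> borel_measurable borel"
    by (intro borel_measurable_continuous_onI continuous_intros)
  have mb[measurable]: "(\<lambda>y. LINT x|lborel. indicator {y..} x *\<^sub>R b x) \<in> borel_measurable borel"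
  proof -
    have [measurable]: "b \<in> borel_measurable borel" using b by simp
    have "(\<lambda>y. LINT x|lborel. (if y \<le> x then b x else 0)) \<in> borel_measurable borel" by measurable
    moreover have "(\<lambda>x. if y \<le> x then b x else 0) = (\<lambda>x. indicator {y..} x *\<^sub>R b x)" for y
      by (auto simp: indicator_def)
    ultimately show ?thesis by simp
  qed
  have "S (\<lambda>y. U y * (LINT x|lborel. indicator {y..} x *\<^sub>R b x)) = S (\<lambda>y. U y * cnj (U R) - U y * cnj (U y))"
  proof (rule S_cong)
    fix y assume "\<bar>y\<bar> \<le> R"
    then have "(LINT x|lborel. indicator {y..} x *\<^sub>R b x) = cnj (U R) - cnj (U y)"
      unfolding b_def by (intro set_integral_prim_ge[OF pc]) auto
    then show "U y * (LINT x|lborel. indicator {y..} x *\<^sub>R b x) = U y * cnj (U R) - U y * cnj (U y)"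
      by (simp add: right_diff_distrib)
  qed measurable
  also have "\<dots> = S (\<lambda>y. U y * cnj (U R)) - S (\<lambda>y. U y * cnj (U y))"
    by (rule S_diff[where B = "K * K" and C = "K * K"])
      (use K less_imp_le[OF K(1)] in \<open>auto simp: norm_mult intro!: mult_mono\<close>)
  also have "S (\<lambda>y. U y * cnj (U R)) = cnj (U R) * S U" using S_cmult[of "cnj (U R)" U] by (simp add: mult.commute)
  finally have m_val: "(LINT x|lborel. b x * m x) = cnj (U R) * S U - S (\<lambda>y. U y * cnj (U y))"
    using m_eq by simp
  have "prim_on (-R) (\<lambda>x. c) (\<lambda>x. 0)"
    by (rule prim_on_C1) auto
  moreover have "prim_on (-R) (\<lambda>x. - 1 * \<Gamma> x) (\<lambda>x. - 1 * (g x + z * U x))"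
    by (intro prim_on_cmult \<Gamma>_prim)
  ultimately have "prim_on (-R) (\<lambda>x. (c + - 1 * \<Gamma> x) * cnj (U x))
      (\<lambda>x. (0 + - 1 * (g x + z * U x)) * cnj (U x) + (c + - 1 * \<Gamma> x) * cnj (v x))"
    by (intro prim_on_mult prim_on_add pc)
  moreover have "(\<lambda>x. (0 + - 1 * (g x + z * U x)) * cnj (U x) + (c + - 1 * \<Gamma> x) * cnj (v x))
      = (\<lambda>x. - ((g x + z * U x) * cnj (U x)) + (c - \<Gamma> x) * cnj (v x))" by (simp add: fun_eq_iff algebra_simps)
  ultimately have P: "prim_on (-R) (\<lambda>x. (c - \<Gamma> x) * cnj (U x))
      (\<lambda>x. - ((g x + z * U x) * cnj (U x)) + (c - \<Gamma> x) * cnj (v x))" by simp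
  from prim_onD(1)[OF P RR]
  have i: "set_integrable lborel {-R..R} (\<lambda>x. - ((g x + z * U x) * cnj (U x)) + (c - \<Gamma> x) * cnj (v x))" .
  have e: "(LINT x:{-R..R}|lborel. - ((g x + z * U x) * cnj (U x)) + (c - \<Gamma> x) * cnj (v x))
      = (c - \<Gamma> R) * cnj (U R) - (c - \<Gamma> (-R)) * cnj (U (-R))"
    using prim_onD(2)[OF P RR] by (simp add: algebra_simps)
  have T: "indicator {-R..R} x *\<^sub>R T x
      = indicator {-R..R} x *\<^sub>R (- ((g x + z * U x) * cnj (U x)) + (c - \<Gamma> x) * cnj (v x)) + b x * m x" for x
  proof -
    have "T x = - ((g x + z * U x) * cnj (U x)) + (c - \<Gamma> x) * cnj (v x) + cnj (v x) * m x"
    proof -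
      have "of_real (h\<^sup>2) * (v x * cnj (v x)) = (c + m x - \<Gamma> x) * cnj (v x)"
        using v_eq[of x] unfolding m_def mult.assoc[symmetric] by (simp only:)
      then show ?thesis unfolding T_def by (simp add: algebra_simps)
    qed
    then show ?thesis by (simp add: b_def indicator_def)
  qed
  have "(LINT x:{-R..R}|lborel. T x) = (LINT x:{-R..R}|lborel. - ((g x + z * U x) * cnj (U x)) + (c - \<Gamma> x) * cnj (v x))
      + (LINT x|lborel. b x * m x)"
    unfolding set_lebesgue_integral_def T
    using i m_int by (intro Bochner_Integration.integral_add) (simp_all add: set_integrable_def)
  also have "\<dots> = ((c + S U - \<Gamma> R) * cnj (U R)) - S (\<lambda>y. U y * cnj (U y)) - (c - \<Gamma> (-R)) * cnj (U (-R))"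
    unfolding e m_val by (simp add: algebra_simps)
  finally show ?thesis using v_right[of R] by simp
qed

text \<open>At R both neighbouring pieces use the right value \<open>v R\<close>, at -R both use the
  left limit \<open>vl\<close>, so the boundary terms cancel and an atom at either end is counted in
  the middle piece.\<close>

lemma T_total: "(LINT x|lborel. T x) = - S (\<lambda>y. U y * cnj (U y))"
proof -
  have iA: "integrable lborel (\<lambda>x. indicator A x *\<^sub>R T x)" if "A \<in> sets borel" for A
    using T_integrable that by (intro integrable_mult_indicator) auto
  have [measurable]: "T \<in> borel_measurable borel" using T_integrable by simp
  have "(LINT x|lborel. T x) = (LINT x|lborel. indicator {..-R} x *\<^sub>R T x
      + (indicator {-R..R} x *\<^sub>R T x + indicator {R..} x *\<^sub>R T x))"
  proof (rule integral_cong_AE)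
    show "AE x in lborel. T x = indicator {..-R} x *\<^sub>R T x
      + (indicator {-R..R} x *\<^sub>R T x + indicator {R..} x *\<^sub>R T x)"
      using AE_lborel_singleton[of R] AE_lborel_singleton[of "-R"]
      by eventually_elim (use R_pos in \<open>auto simp: indicator_def\<close>)
  qed measurable
  also have "\<dots> = (LINT x:{..-R}|lborel. T x) + ((LINT x:{-R..R}|lborel. T x) + (LINT x:{R..}|lborel. T x))"
    unfolding set_lebesgue_integral_def by (simp add: iA)
  also have "\<dots> = - S (\<lambda>y. U y * cnj (U y))"
    unfolding T_left T_middle T_right by simp
  finally show ?thesis .
qed

text \<open>The potential is real and drops out of the imaginary part, whatever its size. This one
  identity yields uniqueness and the bound on \<open>\<epsilon>\<close> times the squared
  norm.\<close>

lemma Im_identity: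
  "Im z * (LINT x|lborel. (cmod (U x))\<^sup>2) = - Im (LINT x|lborel. g x * cnj (U x))"
proof -
  have "S (\<lambda>y. U y * cnj (U y)) = S (\<lambda>y. complex_of_real ((cmod (U y))\<^sup>2))"
    by (simp only: complex_norm_square)
  then have "Im (LINT x|lborel. T x) = 0" unfolding T_total using S_real[of "\<lambda>y. (cmod (U y))\<^sup>2"] by simp
  moreover have "(LINT x|lborel. T x) = of_real (h\<^sup>2) * of_real (LINT x|lborel. (cmod (v x))\<^sup>2)
      - ((LINT x|lborel. g x * cnj (U x)) + z * of_real (LINT x|lborel. (cmod (U x))\<^sup>2))"
  proof -
    have "T x = of_real (h\<^sup>2) * of_real ((cmod (v x))\<^sup>2) - (g x * cnj (U x) + z * of_real ((cmod (U x))\<^sup>2))" for x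
      unfolding T_def complex_norm_square by (simp add: algebra_simps)
    then have eq: "T = (\<lambda>x. of_real (h\<^sup>2) * of_real ((cmod (v x))\<^sup>2)
        - (g x * cnj (U x) + z * of_real ((cmod (U x))\<^sup>2)))" by (rule ext)
    have "integrable lborel (\<lambda>x. complex_of_real ((cmod (v x))\<^sup>2))"
      "integrable lborel (\<lambda>x. complex_of_real ((cmod (U x))\<^sup>2))"
      using L2_integrable[OF v_L2] L2_integrable[OF U_L2] by (auto simp only: complex_of_real_integrable_eq)
    then show ?thesis
      unfolding eq using L2_mult_integrable[OF g_L2 L2_cnj[OF U_L2]]
      by (simp only: Bochner_Integration.integral_diff Bochner_Integration.integral_add
          Bochner_Integration.integrable_add integral_mult_right_zero integrable_mult_right
          integral_complex_of_real)
  qed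
  ultimately show ?thesis by simp
qed

text \<open>Injectivity of P - z. It is used for uniqueness and again, in the existence proof, to
  exclude a vanishing determinant.\<close>

lemma trivial_if_homogeneous:
  assumes "Im z \<noteq> 0" "AE x in lborel. g x = 0"
  shows "U x = 0"
proof -
  have "(LINT x|lborel. g x * cnj (U x)) = (LINT x::real|lborel. 0)"
    using assms(2) L2_mult_integrable[OF g_L2 L2_cnj[OF U_L2]]
    by (intro integral_cong_AE) (auto elim!: AE_mp)
  then have "(LINT x|lborel. (cmod (U x))\<^sup>2) = 0" using Im_identity assms(1) by simp
  then have "AE x in lborel. U x = 0"
    using L2_integrable[OF U_L2] by (subst (asm) integral_nonneg_eq_0_iff_AE) auto
  then have "U = (\<lambda>x. 0)" by (intro AE_continuous_eq U_cont) auto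
  then show ?thesis by simp
qed

end

lemma (in compact_signed_measure) ode_solution_diff:
  assumes "ode_solution V R h z g1 U1 v1 \<Gamma>1 c1" "ode_solution V R h z g2 U2 v2 \<Gamma>2 c2"
  shows "ode_solution V R h z (\<lambda>x. g1 x + - 1 * g2 x) (\<lambda>x. U1 x + - 1 * U2 x) (\<lambda>x. v1 x + - 1 * v2 x)
    (\<lambda>x. \<Gamma>1 x + - 1 * \<Gamma>2 x) (c1 - c2)"
proof -
  interpret a: ode_solution V R h z g1 U1 v1 \<Gamma>1 c1 by fact
  interpret b: ode_solution V R h z g2 U2 v2 \<Gamma>2 c2 by fact
  obtain K1 where K1: "\<And>x. cmod (U1 x) \<le> K1" using a.U_norm_bound by metis
  obtain K2 where K2: "\<And>x. cmod (U2 x) \<le> K2" using b.U_norm_bound by metis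
  show ?thesis
  proof unfold_locales
    have "cmod (U1 x + - 1 * U2 x) \<le> K1 + K2" for x
      using norm_triangle_ineq4[of "U1 x" "U2 x"] K1[of x] K2[of x] by simp
    then show "bounded (range (\<lambda>x. U1 x + - 1 * U2 x))" by (auto simp: bounded_iff)
    fix r
    have "prim_on r (\<lambda>x. \<Gamma>1 x + - 1 * \<Gamma>2 x) (\<lambda>x. g1 x + z * U1 x + - 1 * (g2 x + z * U2 x))"
      by (intro prim_on_add prim_on_cmult a.\<Gamma>_prim b.\<Gamma>_prim)
    then show "prim_on r (\<lambda>x. \<Gamma>1 x + - 1 * \<Gamma>2 x) (\<lambda>x. g1 x + - 1 * g2 x + z * (U1 x + - 1 * U2 x))"
      by (simp add: algebra_simps)
  next
    fix x
    have "S (\<lambda>y. indicator {..x} y *\<^sub>R U1 y - indicator {..x} y *\<^sub>R U2 y)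
        = S (\<lambda>y. indicator {..x} y *\<^sub>R U1 y) - S (\<lambda>y. indicator {..x} y *\<^sub>R U2 y)"
    proof (rule S_diff[where B = K1 and C = K2])
      fix y
      have "0 \<le> K1" "0 \<le> K2" using K1[of y] K2[of y] norm_ge_zero order_trans by blast+
      then show "cmod (indicator {..x} y *\<^sub>R U1 y) \<le> K1" "cmod (indicator {..x} y *\<^sub>R U2 y) \<le> K2"
        using K1[of y] K2[of y] by (auto simp: indicator_def)
    qed measurable
    moreover have "(\<lambda>y. indicator {..x} y *\<^sub>R U1 y - indicator {..x} y *\<^sub>R U2 y)
        = (\<lambda>y. indicator {..x} y *\<^sub>R (U1 y + - 1 * U2 y))" by (auto simp: algebra_simps)
    ultimately show "of_real (h\<^sup>2) * (v1 x + - 1 * v2 x) = c1 - c2 + S (\<lambda>y. indicator {..x} y *\<^sub>R (U1 y + - 1 * U2 y))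
        - (\<Gamma>1 x + - 1 * \<Gamma>2 x)"
      using a.v_eq[of x] b.v_eq[of x] by (simp add: right_diff_distrib)
  qed (intro L2_add L2_cmult a.g_L2 b.g_L2 a.U_L2 b.U_L2 a.v_L2 b.v_L2 prim_on_add prim_on_cmult
      a.U_prim b.U_prim a.h_pos)+
qed

lemma (in compact_signed_measure) solution_unique:
  assumes "solves_shifted V h z u g" "solves_shifted V h z w g" "g \<in> L2" "h > 0" "Im z \<noteq> 0"
  shows "AE x in lborel. w x = u x"
proof -
  obtain U1 v1 \<Gamma>1 c1 where 1: "ode_solution V R h z g U1 v1 \<Gamma>1 c1" "AE x in lborel. u x = U1 x"
    using solution_ode[OF assms(1,3,4)] by blast
  obtain U2 v2 \<Gamma>2 c2 where 2: "ode_solution V R h z g U2 v2 \<Gamma>2 c2" "AE x in lborel. w x = U2 x"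
    using solution_ode[OF assms(2,3,4)] by blast
  interpret d: ode_solution V R h z "\<lambda>x. g x + - 1 * g x" "\<lambda>x. U1 x + - 1 * U2 x" "\<lambda>x. v1 x + - 1 * v2 x"
    "\<lambda>x. \<Gamma>1 x + - 1 * \<Gamma>2 x" "c1 - c2" by (rule ode_solution_diff[OF 1(1) 2(1)])
  have "U1 x + - 1 * U2 x = 0" for x by (rule d.trivial_if_homogeneous[OF assms(5)]) simp
  then have "U1 = U2" by (simp add: fun_eq_iff)
  show ?thesis using 1(2) 2(2) by eventually_elim (simp add: \<open>U1 = U2\<close>)
qed

section \<open>The exterior estimate\<close>

lemma set_integral_Re:
  "set_integrable M A f \<Longrightarrow> Re (LINT x:A|M. f x) = (LINT x:A|M. Re (f x))"
  and set_integrable_Re: "set_integrable M A f \<Longrightarrow> set_integrable M A (\<lambda>x. Re (f x))"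
  for f :: "real \<Rightarrow> complex"
proof -
  assume "set_integrable M A f"
  then have i: "integrable M (\<lambda>x. indicat_real A x *\<^sub>R f x)" by (simp add: set_integrable_def)
  have eq: "(\<lambda>x. indicat_real A x *\<^sub>R Re (f x)) = (\<lambda>x. Re (indicat_real A x *\<^sub>R f x))" by auto
  show "Re (LINT x:A|M. f x) = (LINT x:A|M. Re (f x))"
    unfolding set_lebesgue_integral_def eq using i by (rule integral_Re[symmetric])
  show "set_integrable M A (\<lambda>x. Re (f x))"
    unfolding set_integrable_def eq using i by (rule integrable_Re)
qed

lemma L2_set_integrable_bound:
  fixes b :: "real \<Rightarrow> 'b::{banach, second_countable_topology}"
  assumes "U \<in> L2" "v \<in> L2" "f \<in> L2" and [measurable]: "b \<in> borel_measurable borel" "A \<in> sets borel"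
    and bound: "\<And>x. x \<in> A \<Longrightarrow> norm (b x) \<le> K * ((cmod (U x))\<^sup>2 + (cmod (v x))\<^sup>2 + (cmod (f x))\<^sup>2)"
  shows "set_integrable lborel A b"
proof (rule set_integrable_bound)
  have "integrable lborel (\<lambda>x. K * ((cmod (U x))\<^sup>2 + (cmod (v x))\<^sup>2 + (cmod (f x))\<^sup>2))"
    using assms(1-3) by (intro integrable_mult_right Bochner_Integration.integrable_add L2_integrable)
  then show "set_integrable lborel A (\<lambda>x. K * ((cmod (U x))\<^sup>2 + (cmod (v x))\<^sup>2 + (cmod (f x))\<^sup>2))"
    unfolding set_integrable_def by (intro integrable_mult_indicator) auto
  show "set_borel_measurable lborel A b" unfolding set_borel_measurable_def by measurable
  show "AE x in lborel. x \<in> A \<longrightarrow> norm (b x) \<le> norm (K * ((cmod (U x))\<^sup>2 + (cmod (v x))\<^sup>2 + (cmod (f x))\<^sup>2))"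
  proof (intro AE_I2 impI)
    fix x assume "x \<in> A"
    from order_trans[OF bound[OF this] abs_ge_self] show "norm (b x) \<le> norm (K * ((cmod (U x))\<^sup>2 + (cmod (v x))\<^sup>2 + (cmod (f x))\<^sup>2))"
      by simp
  qed
qed

lemma two_mult_le_squares: "2 * (a * b) \<le> s * a\<^sup>2 + b\<^sup>2 / s" if "s > 0" for a b s :: real
proof -
  have "0 \<le> (s * a - b)\<^sup>2 / s" using that by simp
  also have "\<dots> = s * a\<^sup>2 + b\<^sup>2 / s - 2 * (a * b)"
    using that by (simp add: power2_diff field_simps power2_eq_square)
  finally show ?thesis by simp
qed

text \<open>A Morawetz-type multiplier that vanishes at the edge \<open>R\<close> of the support: since \<open>W(R) = 0\<close>, no
  boundary terms appear and the interior, where \<open>V\<close> lives, does not enter.\<close>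

locale half_line =
  fixes R h E \<delta> \<epsilon> :: real and z :: complex and f U v :: "real \<Rightarrow> complex"
  assumes R: "R > 0" and h: "h > 0" and E: "E > 0" and \<delta>: "\<delta> > 0"
    and h\<delta>: "h * \<delta> \<le> 1 / 2" and \<epsilon>: "0 < \<epsilon>" "\<epsilon> \<le> 1"
    and Re_z: "Re z = E" and z_E: "cmod (z - of_real E) = \<epsilon>"
    and U: "U \<in> L2" and v: "v \<in> L2" and f: "f \<in> L2"
    and pU: "prim_on R U v" and pv: "prim_on R v (\<lambda>x. - (f x + z * U x) / of_real (h\<^sup>2))"
begin

definition W where "W x = (1 + R) powr (- \<delta>) - (1 + x) powr (- \<delta>)" for x
text \<open>On the half line this is also \<delta> times the square of
  \<open>weight \<delta>\<close>, so the norm in the theorem is the one that the derivative of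
  \<open>W\<close> generates.\<close>

definition w where "w x = \<delta> * (1 + x) powr (- 1 - \<delta>)" for x

lemma W_deriv: "x \<ge> R \<Longrightarrow> (W has_real_derivative w x) (at x)"
proof -
  assume x: "x \<ge> R"
  have "((\<lambda>x. (1 + x) powr (- \<delta>)) has_real_derivative (- \<delta> * (1 + x) powr (- \<delta> - 1)) * 1) (at x)"
    by (rule DERIV_chain2[OF has_real_derivative_powr]) (use x R in \<open>auto intro!: derivative_eq_intros\<close>)
  from DERIV_diff[OF DERIV_const[of "(1 + R) powr (- \<delta>)"] this] show ?thesis
    unfolding W_def[abs_def] w_def by (rule DERIV_cong) (simp add: minus_diff_commute)
qed

lemma w_cont: "continuous_on {R..} w"
  unfolding w_def[abs_def] using R by (intro continuous_intros) auto

lemma w_pos: "x \<ge> R \<Longrightarrow> w x > 0"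
  unfolding w_def using R \<delta> by simp

lemma w_le: "x \<ge> R \<Longrightarrow> w x \<le> \<delta>"
proof -
  assume "x \<ge> R"
  then have "(1 + x) powr (- 1 - \<delta>) \<le> 1 powr (- 1 - \<delta>)"
    using R \<delta> by (intro powr_mono2') auto
  then show ?thesis unfolding w_def using \<delta> by simp
qed

lemma W_bounds: "x \<ge> R \<Longrightarrow> 0 \<le> W x" "x \<ge> R \<Longrightarrow> W x \<le> 1"
proof -
  assume "x \<ge> R"
  then have "(1 + x) powr (- \<delta>) \<le> (1 + R) powr (- \<delta>)" "(1 + R) powr (- \<delta>) \<le> 1"
    using R \<delta> powr_mono2'[of "- \<delta>" 1 "1 + R"] by (auto intro!: powr_mono2')
  moreover have "0 \<le> (1 + x) powr (- \<delta>)" by simp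
  ultimately show "0 \<le> W x" "W x \<le> 1" unfolding W_def by (simp_all del: powr_ge_zero)
qed

lemma W_R: "W R = 0" by (simp add: W_def)

lemma meas [measurable]: "W \<in> borel_measurable borel" "w \<in> borel_measurable borel"
  "U \<in> borel_measurable borel" "v \<in> borel_measurable borel" "f \<in> borel_measurable borel"
  "cnj \<in> borel_measurable borel"
  using U v f unfolding W_def[abs_def] w_def[abs_def]
  by (auto simp: L2_measurable intro!: borel_measurable_continuous_onI[of cnj] continuous_intros)

lemma pW: "prim_on R (\<lambda>x. of_real (W x)) (\<lambda>x. of_real (w x))"
  by (intro prim_on_C1 has_vector_derivative_of_real continuous_on_of_real w_cont)
    (simp add: W_deriv has_real_derivative_iff_has_vector_derivative[symmetric])

definition q where "q x = - (f x + z * U x) / of_real (h\<^sup>2)" for x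
text \<open>One integrable majorant, up to constants, for all the quadratic expressions whose
  integrability has to be checked.\<close>

definition Q where "Q x = (cmod (U x))\<^sup>2 + (cmod (v x))\<^sup>2 + (cmod (f x))\<^sup>2" for x

lemma pq: "prim_on R v q"
  using pv by (simp add: q_def[abs_def])

lemma q_meas [measurable]: "q \<in> borel_measurable borel"
  unfolding q_def[abs_def] by measurable

lemma set_int:
  fixes b :: "real \<Rightarrow> 'b::{banach, second_countable_topology}"
  assumes "b \<in> borel_measurable borel" "\<And>x. x \<in> {R..} \<Longrightarrow> norm (b x) \<le> K * Q x"
  shows "set_integrable lborel {R..} b"
  by (rule L2_set_integrable_bound[OF U v f assms(1) _ assms(2)[unfolded Q_def]]) simp

lemma products: "cmod (f x) * cmod (U x) \<le> Q x" "cmod (U x) * cmod (v x) \<le> Q x" "cmod (f x) * cmod (v x) \<le> Q x"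
  "(cmod (U x))\<^sup>2 \<le> Q x" "(cmod (v x))\<^sup>2 \<le> Q x" "0 \<le> Q x"
  using L2_mult_bound[of "f x" "U x"] L2_mult_bound[of "U x" "v x"] L2_mult_bound[of "f x" "v x"]
  unfolding norm_mult Q_def
  by (auto intro: order_trans simp: add_increasing add_increasing2)

lemma q_bound: "cmod (q x) \<le> (1 + cmod z) / h\<^sup>2 * (cmod (f x) + cmod (U x))"
proof -
  have "cmod (f x + z * U x) \<le> cmod (f x) + cmod z * cmod (U x)"
    by (metis norm_mult norm_triangle_ineq)
  also have "\<dots> \<le> (1 + cmod z) * (cmod (f x) + cmod (U x))"
    by (simp add: algebra_simps)
  finally have "cmod (f x + z * U x) / h\<^sup>2 \<le> (1 + cmod z) * (cmod (f x) + cmod (U x)) / h\<^sup>2"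
    by (intro divide_right_mono) auto
  moreover have "cmod (q x) = cmod (f x + z * U x) / h\<^sup>2"
    unfolding q_def by (simp only: norm_divide norm_minus_cancel norm_of_real) simp
  ultimately show ?thesis by simp
qed

text \<open>Of the four integrals \<open>A_int\<close> is the target and \<open>X_int\<close> the
  forcing. \<open>N_int\<close> has no weight and is affordable only with a factor
  \<open>\<epsilon>\<close>; \<open>P_int\<close> is the kinetic energy, bounded only with the
  weight W^2 that vanishes at R.\<close>

definition A_int where "A_int = (LINT x:{R..}|lborel. w x * (cmod (U x))\<^sup>2)"
definition N_int where "N_int = (LINT x:{R..}|lborel. (cmod (U x))\<^sup>2)"
definition P_int where "P_int = (LINT x:{R..}|lborel. (W x * h * cmod (v x))\<^sup>2)"
definition X_int where "X_int = (LINT x:{R..}|lborel. cmod (f x) * cmod (U x))"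

lemma integrable_parts:
  "set_integrable lborel {R..} (\<lambda>x. w x * (cmod (U x))\<^sup>2)"
  "set_integrable lborel {R..} (\<lambda>x. (cmod (U x))\<^sup>2)"
  "set_integrable lborel {R..} (\<lambda>x. (W x * h * cmod (v x))\<^sup>2)"
  "set_integrable lborel {R..} (\<lambda>x. cmod (f x) * cmod (U x))"
proof -
  show "set_integrable lborel {R..} (\<lambda>x. w x * (cmod (U x))\<^sup>2)"
  proof (rule set_int[where K = \<delta>])
    fix x assume "x \<in> {R..}"
    then have x: "0 < w x" "w x \<le> \<delta>" using w_pos w_le by auto
    then show "norm (w x * (cmod (U x))\<^sup>2) \<le> \<delta> * Q x"
      using products[of x] by (auto simp: abs_mult intro!: mult_mono)
  qed measurable
  show "set_integrable lborel {R..} (\<lambda>x. (cmod (U x))\<^sup>2)"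
    using products by (intro set_int[where K = 1]) auto
  show "set_integrable lborel {R..} (\<lambda>x. (W x * h * cmod (v x))\<^sup>2)"
  proof (rule set_int[where K = "h\<^sup>2"])
    fix x assume "x \<in> {R..}"
    then have x: "0 \<le> W x" "W x \<le> 1" using W_bounds by auto
    then have "(W x * h * cmod (v x))\<^sup>2 \<le> (1 * h * cmod (v x))\<^sup>2"
      using h by (intro power_mono mult_right_mono) auto
    also have "\<dots> \<le> h\<^sup>2 * Q x"
      using products[of x] by (auto simp: power_mult_distrib intro!: mult_left_mono)
    finally show "norm ((W x * h * cmod (v x))\<^sup>2) \<le> h\<^sup>2 * Q x" by simp
  qed measurable
  show "set_integrable lborel {R..} (\<lambda>x. cmod (f x) * cmod (U x))"
    using products by (intro set_int[where K = 1]) auto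
qed

definition M where "M = (1 + cmod z) / h\<^sup>2"

lemma M_nonneg: "M \<ge> 0" by (simp add: M_def)

lemma q_products: "cmod (q x) * cmod (U x) \<le> 2 * M * Q x" "cmod (q x) * cmod (v x) \<le> 2 * M * Q x"
proof -
  have "cmod (q x) * cmod (U x) \<le> M * (cmod (f x) + cmod (U x)) * cmod (U x)"
    unfolding M_def by (intro mult_right_mono q_bound) simp
  also have "\<dots> = M * (cmod (f x) * cmod (U x) + (cmod (U x))\<^sup>2)" by (simp add: algebra_simps power2_eq_square)
  also have "\<dots> \<le> M * (Q x + Q x)" using products[of x] M_nonneg by (intro mult_left_mono add_mono) auto
  finally show "cmod (q x) * cmod (U x) \<le> 2 * M * Q x" by simp
  have "cmod (q x) * cmod (v x) \<le> M * (cmod (f x) + cmod (U x)) * cmod (v x)"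
    unfolding M_def by (intro mult_right_mono q_bound) simp
  also have "\<dots> = M * (cmod (f x) * cmod (v x) + cmod (U x) * cmod (v x))" by (simp add: algebra_simps)
  also have "\<dots> \<le> M * (Q x + Q x)" using products[of x] M_nonneg by (intro mult_left_mono add_mono) auto
  finally show "cmod (q x) * cmod (v x) \<le> 2 * M * Q x" by simp
qed

lemma h2q: "of_real (h\<^sup>2) * q x = - (f x + z * U x)"
  using h by (simp add: q_def)

text \<open>Multiply the equation by \<open>W\<^sup>2 cnj U\<close>.\<close>

lemma P_int_le: "P_int \<le> 2 * X_int + (2 * E + 1) * N_int"
proof -
  define B where "B x = of_real (h\<^sup>2) * ((of_real (W x) * of_real (W x)) * (v x * cnj (U x)))" for x
  define b where "b x = of_real (h\<^sup>2) * ((of_real (w x) * of_real (W x) + of_real (W x) * of_real (w x)) * (v x * cnj (U x))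
      + (of_real (W x) * of_real (W x)) * (q x * cnj (U x) + v x * cnj (v x)))" for x
  have p: "prim_on R B b"
    unfolding B_def b_def by (intro prim_on_cmult prim_on_mult pW pq prim_on_cnj pU)
  have iB: "set_integrable lborel {R..} B"
  proof (rule set_int[where K = "h\<^sup>2"])
    show "B \<in> borel_measurable borel" unfolding B_def[abs_def] by measurable
    fix x assume "x \<in> {R..}"
    then have x: "0 \<le> W x" "W x \<le> 1" using W_bounds by auto
    have "norm (B x) = h\<^sup>2 * ((W x * W x) * (cmod (U x) * cmod (v x)))"
      using x by (simp add: B_def norm_mult norm_power)
    also have "\<dots> \<le> h\<^sup>2 * ((1 * 1) * Q x)"
      using x products[of x] by (intro mult_left_mono mult_mono) auto
    finally show "norm (B x) \<le> h\<^sup>2 * Q x" by simp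
  qed
  have ib: "set_integrable lborel {R..} b"
  proof (rule set_int[where K = "h\<^sup>2 * (2 * \<delta> + (2 * M + 1))"])
    show "b \<in> borel_measurable borel" unfolding b_def[abs_def] by measurable
    fix x assume "x \<in> {R..}"
    then have x: "0 \<le> W x" "W x \<le> 1" "0 < w x" "w x \<le> \<delta>" using W_bounds w_pos w_le by auto
    have "norm (b x) \<le> h\<^sup>2 * ((2 * (w x * W x)) * (cmod (U x) * cmod (v x))
        + (W x * W x) * (cmod (q x) * cmod (U x) + (cmod (v x))\<^sup>2))"
    proof -
      have 1: "cmod (of_real (w x) * of_real (W x) + of_real (W x) * of_real (w x)) = 2 * (w x * W x)"
        using x by (simp flip: of_real_mult of_real_add)
      have 2: "cmod (q x * cnj (U x) + v x * cnj (v x)) \<le> cmod (q x) * cmod (U x) + (cmod (v x))\<^sup>2"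
        by (rule order_trans[OF norm_triangle_ineq]) (simp add: norm_mult power2_eq_square)
      have 3: "cmod (of_real (W x) * of_real (W x)) = W x * W x" using x by (simp add: norm_mult)
      have "cmod ((of_real (w x) * of_real (W x) + of_real (W x) * of_real (w x)) * (v x * cnj (U x))
        + (of_real (W x) * of_real (W x)) * (q x * cnj (U x) + v x * cnj (v x)))
        \<le> (2 * (w x * W x)) * (cmod (U x) * cmod (v x)) + (W x * W x) * (cmod (q x) * cmod (U x) + (cmod (v x))\<^sup>2)"
        by (rule order_trans[OF norm_triangle_ineq], unfold norm_mult[of "_ + _"] norm_mult[of "of_real _ * of_real _"] 1 3)
          (use x 2 in \<open>auto simp: norm_mult mult.commute[of "cmod (v x)"] intro!: add_mono mult_left_mono\<close>)
      then show ?thesis unfolding b_def norm_mult[of "of_real (h\<^sup>2)"] by (simp add: mult_left_mono norm_power)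
    qed
    also have "\<dots> \<le> h\<^sup>2 * ((2 * (\<delta> * 1)) * Q x + (1 * 1) * (2 * M * Q x + Q x))"
    proof (rule mult_left_mono[OF add_mono])
      have "w x * W x \<le> \<delta> * 1" using x \<delta> by (intro mult_mono) auto
      then show "2 * (w x * W x) * (cmod (U x) * cmod (v x)) \<le> 2 * (\<delta> * 1) * Q x"
        using x \<delta> products[of x] by (intro mult_mono) auto
      have "W x * W x \<le> 1 * 1" using x by (intro mult_mono) auto
      moreover have "cmod (q x) * cmod (U x) + (cmod (v x))\<^sup>2 \<le> 2 * M * Q x + Q x"
        using products[of x] q_products[of x] by (intro add_mono) auto
      ultimately show "W x * W x * (cmod (q x) * cmod (U x) + (cmod (v x))\<^sup>2) \<le> 1 * 1 * (2 * M * Q x + Q x)"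
        by (rule mult_mono) auto
    qed simp
    finally show "norm (b x) \<le> h\<^sup>2 * (2 * \<delta> + (2 * M + 1)) * Q x" by (simp add: algebra_simps)
  qed
  have "(LINT x:{R..}|lborel. b x) = 0"
    using prim_on_integral[OF p iB ib] by (simp add: B_def W_R)
  then have z0: "(LINT x:{R..}|lborel. Re (b x)) = 0" using set_integral_Re[OF ib] by simp
  have "(LINT x:{R..}|lborel. (1 / 2) * (W x * h * cmod (v x))\<^sup>2 - (cmod (f x) * cmod (U x) + (E + 1 / 2) * (cmod (U x))\<^sup>2))
    \<le> (LINT x:{R..}|lborel. Re (b x))"
  proof (rule set_integral_mono)
    show "set_integrable lborel {R..} (\<lambda>x. (1 / 2) * (W x * h * cmod (v x))\<^sup>2 - (cmod (f x) * cmod (U x) + (E + 1 / 2) * (cmod (U x))\<^sup>2))"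
      by (intro set_integral_diff(1) set_integral_add(1) set_integrable_mult_right integrable_parts)
    show "set_integrable lborel {R..} (\<lambda>x. Re (b x))" by (rule set_integrable_Re[OF ib])
    fix x assume "x \<in> {R..}"
    then have x: "0 \<le> W x" "W x \<le> 1" "0 < w x" "w x \<le> \<delta>" using W_bounds w_pos w_le by auto
    have beq: "b x = of_real (2 * w x * W x * h\<^sup>2) * (v x * cnj (U x))
        + of_real (W x * W x) * ((of_real (h\<^sup>2) * q x) * cnj (U x) + of_real (h\<^sup>2) * (v x * cnj (v x)))"
      unfolding b_def by (simp add: algebra_simps)
    have qU: "(of_real (h\<^sup>2) * q x) * cnj (U x) = - (f x * cnj (U x)) - z * of_real ((cmod (U x))\<^sup>2)"
      unfolding h2q complex_norm_square by (simp add: algebra_simps)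
    have vv: "v x * cnj (v x) = of_real ((cmod (v x))\<^sup>2)" by (simp only: complex_norm_square)
    have Reb: "Re (b x) = 2 * w x * W x * h\<^sup>2 * Re (v x * cnj (U x))
        + (W x * W x) * (- Re (f x * cnj (U x)) - E * (cmod (U x))\<^sup>2 + h\<^sup>2 * (cmod (v x))\<^sup>2)"
      unfolding beq qU vv using Re_z by simp
    have "- Re (v x * cnj (U x)) \<le> cmod (v x * cnj (U x))"
      using complex_Re_le_cmod[of "- (v x * cnj (U x))"] by simp
    then have 1: "- Re (v x * cnj (U x)) \<le> cmod (U x) * cmod (v x)" by (simp add: norm_mult mult.commute)
    have 2: "Re (f x * cnj (U x)) \<le> cmod (f x) * cmod (U x)"
      using complex_Re_le_cmod[of "f x * cnj (U x)"] by (simp add: norm_mult)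
    have WW: "W x * W x \<le> 1" using mult_mono[OF x(2,2)] x by simp
    have 3: "(W x * W x) * (Re (f x * cnj (U x)) + E * (cmod (U x))\<^sup>2)
        \<le> 1 * (cmod (f x) * cmod (U x) + E * (cmod (U x))\<^sup>2)"
    proof -
      have "(W x * W x) * (Re (f x * cnj (U x)) + E * (cmod (U x))\<^sup>2)
          \<le> (W x * W x) * (cmod (f x) * cmod (U x) + E * (cmod (U x))\<^sup>2)"
        using x 2 by (intro mult_left_mono) auto
      also have "\<dots> \<le> 1 * (cmod (f x) * cmod (U x) + E * (cmod (U x))\<^sup>2)"
        using WW E by (intro mult_right_mono) auto
      finally show ?thesis .
    qed
    \<comment> \<open>The derivative of W^2 gives 2 w W. Young's inequality with weight 1/2 spends
      half of the kinetic term; w <= \<delta> and h \<delta> <= 1/2 reduce the rest to at most |U|^2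
      / 2.\<close>
    have 4: "2 * w x * W x * h\<^sup>2 * (- Re (v x * cnj (U x)))
        \<le> (1 / 2) * (W x * h * cmod (v x))\<^sup>2 + (1 / 2) * (cmod (U x))\<^sup>2"
    proof -
      have "2 * w x * W x * h\<^sup>2 * (- Re (v x * cnj (U x))) \<le> 2 * w x * W x * h\<^sup>2 * (cmod (U x) * cmod (v x))"
        using x 1 by (intro mult_left_mono) auto
      also have "\<dots> = 2 * ((W x * h * cmod (v x)) * (w x * h * cmod (U x)))"
        by (simp add: power2_eq_square algebra_simps)
      also have "\<dots> \<le> (1 / 2) * (W x * h * cmod (v x))\<^sup>2 + (w x * h * cmod (U x))\<^sup>2 / (1 / 2)"
        by (rule two_mult_le_squares) simp
      also have "(w x * h * cmod (U x))\<^sup>2 \<le> (1 / 2 * cmod (U x))\<^sup>2"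
      proof -
        have "w x * h \<le> \<delta> * h" using x h by (intro mult_right_mono) auto
        then have "w x * h \<le> 1 / 2" using h\<delta> by (simp add: mult.commute)
        then show ?thesis using x h by (intro power_mono mult_right_mono) auto
      qed
      finally show ?thesis by (simp add: power_mult_distrib power2_eq_square)
    qed
    have 5: "(W x * h * cmod (v x))\<^sup>2 = (W x * W x) * (h\<^sup>2 * (cmod (v x))\<^sup>2)"
      by (simp add: power2_eq_square algebra_simps)
    show "(1 / 2) * (W x * h * cmod (v x))\<^sup>2 - (cmod (f x) * cmod (U x) + (E + 1 / 2) * (cmod (U x))\<^sup>2) \<le> Re (b x)"
      using 3 4 unfolding Reb 5 by (simp add: algebra_simps)
  qed
  also have "\<dots> = 0" by (rule z0)
  finally have "(1 / 2) * P_int - (X_int + (E + 1 / 2) * N_int) \<le> 0"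
    by (subst (asm) set_integral_diff(2), (intro set_integral_add(1) set_integrable_mult_right integrable_parts)+,
      subst (asm) set_integral_add(2), (intro set_integrable_mult_right integrable_parts)+)
      (simp add: P_int_def X_int_def N_int_def)
  then show ?thesis by (simp add: algebra_simps)
qed

text \<open>Differentiate \<open>W (h\<^sup>2 \<bar>U'\<bar>\<^sup>2 + E \<bar>U\<bar>\<^sup>2)\<close>.\<close>

lemma A_int_le:
  assumes G: "set_integrable lborel {R..} (\<lambda>x. (cmod (f x))\<^sup>2 / w x)"
  shows "E * A_int \<le> (LINT x:{R..}|lborel. (cmod (f x))\<^sup>2 / w x) / h\<^sup>2 + \<epsilon> / h * (N_int + P_int)"
proof -
  define B where "B x = of_real (W x) * (of_real (h\<^sup>2) * (v x * cnj (v x)) + of_real E * (U x * cnj (U x)))" for x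
  define b where "b x = of_real (w x) * (of_real (h\<^sup>2) * (v x * cnj (v x)) + of_real E * (U x * cnj (U x)))
    + of_real (W x) * (of_real (h\<^sup>2) * (q x * cnj (v x) + v x * cnj (q x)) + of_real E * (v x * cnj (U x) + U x * cnj (v x)))" for x
  have p: "prim_on R B b"
    unfolding B_def b_def by (intro prim_on_mult pW prim_on_add prim_on_cmult pq prim_on_cnj pU)
  have F: "cmod (of_real (h\<^sup>2) * (v x * cnj (v x)) + of_real E * (U x * cnj (U x))) \<le> (h\<^sup>2 + E) * Q x" for x
  proof -
    have "cmod (of_real (h\<^sup>2) * (v x * cnj (v x)) + of_real E * (U x * cnj (U x)))
        \<le> h\<^sup>2 * (cmod (v x))\<^sup>2 + E * (cmod (U x))\<^sup>2"
      using E by (intro order_trans[OF norm_triangle_ineq]) (simp add: norm_mult norm_power power2_eq_square)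
    also have "\<dots> \<le> h\<^sup>2 * Q x + E * Q x" using products[of x] E by (intro add_mono mult_left_mono) auto
    finally show ?thesis by (simp add: algebra_simps)
  qed
  have iB: "set_integrable lborel {R..} B"
  proof (rule set_int[where K = "h\<^sup>2 + E"])
    show "B \<in> borel_measurable borel" unfolding B_def[abs_def] by measurable
    fix x assume "x \<in> {R..}"
    then have x: "0 \<le> W x" "W x \<le> 1" using W_bounds by auto
    have "norm (B x) \<le> 1 * ((h\<^sup>2 + E) * Q x)"
      unfolding B_def norm_mult[of "of_real (W x)"] using x F[of x] by (intro mult_mono) auto
    then show "norm (B x) \<le> (h\<^sup>2 + E) * Q x" by simp
  qed
  have ib: "set_integrable lborel {R..} b"
  proof (rule set_int[where K = "\<delta> * (h\<^sup>2 + E) + (h\<^sup>2 * (4 * M) + E * 2)"])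
    show "b \<in> borel_measurable borel" unfolding b_def[abs_def] by measurable
    fix x assume "x \<in> {R..}"
    then have x: "0 \<le> W x" "W x \<le> 1" "0 < w x" "w x \<le> \<delta>" using W_bounds w_pos w_le by auto
    have 1: "cmod (q x * cnj (v x) + v x * cnj (q x)) \<le> 4 * M * Q x"
      using q_products(2)[of x] norm_triangle_ineq[of "q x * cnj (v x)" "v x * cnj (q x)"]
        mult.commute[of "cmod (v x)" "cmod (q x)"]
      unfolding norm_mult complex_mod_cnj by linarith
    have 2: "cmod (v x * cnj (U x) + U x * cnj (v x)) \<le> 2 * Q x"
      using products(2)[of x] norm_triangle_ineq[of "v x * cnj (U x)" "U x * cnj (v x)"]
        mult.commute[of "cmod (v x)" "cmod (U x)"]
      unfolding norm_mult complex_mod_cnj by linarith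
    have 3: "cmod (of_real (h\<^sup>2) * (q x * cnj (v x) + v x * cnj (q x)) + of_real E * (v x * cnj (U x) + U x * cnj (v x)))
      \<le> h\<^sup>2 * (4 * M * Q x) + E * (2 * Q x)"
      by (rule order_trans[OF norm_triangle_ineq], unfold norm_mult[of "of_real _"])
        (use 1 2 E in \<open>auto simp: norm_power intro!: add_mono mult_left_mono\<close>)
    have "norm (b x) \<le> w x * ((h\<^sup>2 + E) * Q x) + W x * (h\<^sup>2 * (4 * M * Q x) + E * (2 * Q x))"
      unfolding b_def
      by (rule order_trans[OF norm_triangle_ineq], unfold norm_mult[of "of_real (w x)"] norm_mult[of "of_real (W x)"])
        (use F[of x] 3 x in \<open>auto intro!: add_mono mult_left_mono\<close>)
    also have "\<dots> \<le> \<delta> * ((h\<^sup>2 + E) * Q x) + 1 * (h\<^sup>2 * (4 * M * Q x) + E * (2 * Q x))"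
      using x products(6)[of x] E M_nonneg by (intro add_mono mult_right_mono add_nonneg_nonneg mult_nonneg_nonneg) auto
    finally show "norm (b x) \<le> (\<delta> * (h\<^sup>2 + E) + (h\<^sup>2 * (4 * M) + E * 2)) * Q x"
      by (simp add: algebra_simps)
  qed
  have "(LINT x:{R..}|lborel. b x) = 0"
    using prim_on_integral[OF p iB ib] by (simp add: B_def W_R)
  then have z0: "(LINT x:{R..}|lborel. Re (b x)) = 0" using set_integral_Re[OF ib] by simp
  have "(LINT x:{R..}|lborel. E * (w x * (cmod (U x))\<^sup>2)
      - ((1 / h\<^sup>2) * ((cmod (f x))\<^sup>2 / w x) + (\<epsilon> / h) * ((cmod (U x))\<^sup>2 + (W x * h * cmod (v x))\<^sup>2)))
    \<le> (LINT x:{R..}|lborel. Re (b x))"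
  proof (rule set_integral_mono)
    show "set_integrable lborel {R..} (\<lambda>x. E * (w x * (cmod (U x))\<^sup>2)
      - ((1 / h\<^sup>2) * ((cmod (f x))\<^sup>2 / w x) + (\<epsilon> / h) * ((cmod (U x))\<^sup>2 + (W x * h * cmod (v x))\<^sup>2)))"
      by (intro set_integral_diff(1) set_integral_add(1) set_integrable_mult_right integrable_parts G)
    show "set_integrable lborel {R..} (\<lambda>x. Re (b x))" by (rule set_integrable_Re[OF ib])
    fix x assume "x \<in> {R..}"
    then have x: "0 \<le> W x" "W x \<le> 1" "0 < w x" using W_bounds w_pos by auto
    \<comment> \<open>The part E U of z U cancels against the derivative of E |U|^2, so besides the
      forcing only z - E remains, of modulus \<open>\<epsilon>\<close>.\<close>
    have "(of_real (h\<^sup>2) * q x) * cnj (v x) + of_real E * (U x * cnj (v x))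
        = - (f x * cnj (v x)) - (z - of_real E) * U x * cnj (v x)"
      unfolding h2q by (simp add: algebra_simps)
    then have "of_real (h\<^sup>2) * (q x * cnj (v x)) + of_real E * (U x * cnj (v x))
        = - (f x * cnj (v x)) - (z - of_real E) * U x * cnj (v x)" by (simp only: mult.assoc)
    moreover have "Re (of_real (h\<^sup>2) * (q x * cnj (v x) + v x * cnj (q x)) + of_real E * (v x * cnj (U x) + U x * cnj (v x)))
        = 2 * Re (of_real (h\<^sup>2) * (q x * cnj (v x)) + of_real E * (U x * cnj (v x)))"
    proof -
      have "Re (of_real c * (a * cnj d + d * cnj a) + of_real e * (d * cnj k + k * cnj d))
          = 2 * Re (of_real c * (a * cnj d) + of_real e * (k * cnj d))" for c e :: real and a d k :: complex
        by (simp add: algebra_simps)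
      then show ?thesis by blast
    qed
    moreover have "cmod (f x * cnj (v x)) = cmod (f x) * cmod (v x)"
      "cmod ((z - of_real E) * U x * cnj (v x)) = \<epsilon> * (cmod (U x) * cmod (v x))"
      by (simp_all add: norm_mult z_E)
    ultimately have low: "Re (of_real (h\<^sup>2) * (q x * cnj (v x) + v x * cnj (q x)) + of_real E * (v x * cnj (U x) + U x * cnj (v x)))
      \<ge> - 2 * (cmod (f x) * cmod (v x)) - 2 * (\<epsilon> * (cmod (U x) * cmod (v x)))"
      using complex_Re_le_cmod[of "f x * cnj (v x)"] complex_Re_le_cmod[of "(z - of_real E) * U x * cnj (v x)"] by simp
    have K: "of_real (w x) * (of_real (h\<^sup>2) * (v x * cnj (v x)) + of_real E * (U x * cnj (U x)))
        = complex_of_real (w x * (h\<^sup>2 * (cmod (v x))\<^sup>2 + E * (cmod (U x))\<^sup>2))"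
      by (simp only: complex_norm_square of_real_mult of_real_add)
    have gen: "Re (of_real r * y) = r * Re y" for r y by simp
    have Reb: "Re (b x) = w x * (h\<^sup>2 * (cmod (v x))\<^sup>2 + E * (cmod (U x))\<^sup>2)
      + W x * Re (of_real (h\<^sup>2) * (q x * cnj (v x) + v x * cnj (q x)) + of_real E * (v x * cnj (U x) + U x * cnj (v x)))"
      by (simp only: b_def K plus_complex.sel(1) gen Re_complex_of_real)
    \<comment> \<open>Young's inequality with weight w h^2 uses up exactly the positive term w h^2
      |v|^2 and leaves |f|^2 / (w h^2) as the cost.\<close>
    have 1: "2 * (W x * (cmod (f x) * cmod (v x))) \<le> w x * h\<^sup>2 * (cmod (v x))\<^sup>2 + (1 / h\<^sup>2) * ((cmod (f x))\<^sup>2 / w x)"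
    proof -
      have "2 * (W x * (cmod (f x) * cmod (v x))) \<le> 2 * (1 * (cmod (f x) * cmod (v x)))"
        using x by (intro mult_left_mono mult_right_mono) auto
      also have "\<dots> = 2 * (cmod (v x) * cmod (f x))" by simp
      also have "\<dots> \<le> (w x * h\<^sup>2) * (cmod (v x))\<^sup>2 + (cmod (f x))\<^sup>2 / (w x * h\<^sup>2)"
        using x h by (intro two_mult_le_squares) auto
      finally show ?thesis by (simp add: field_simps)
    qed
    \<comment> \<open>The factor \<open>W\<close> stays with \<open>v\<close>, because only W^2
      |v|^2 is controlled; pairing |U| with W h |v| is what produces the coefficient
      \<open>\<epsilon> / h\<close>.\<close>
    have 2: "2 * (\<epsilon> * (W x * (cmod (U x) * cmod (v x)))) \<le> (\<epsilon> / h) * ((cmod (U x))\<^sup>2 + (W x * h * cmod (v x))\<^sup>2)"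
    proof -
      have "2 * (\<epsilon> * (W x * (cmod (U x) * cmod (v x)))) = (\<epsilon> / h) * (2 * (cmod (U x) * (W x * h * cmod (v x))))"
        using h by (simp add: field_simps)
      also have "\<dots> \<le> (\<epsilon> / h) * (1 * (cmod (U x))\<^sup>2 + (W x * h * cmod (v x))\<^sup>2 / 1)"
        using \<epsilon> h by (intro mult_left_mono two_mult_le_squares) auto
      finally show ?thesis by simp
    qed
    have "W x * (- 2 * (cmod (f x) * cmod (v x)) - 2 * (\<epsilon> * (cmod (U x) * cmod (v x)))) \<le> W x *
      Re (of_real (h\<^sup>2) * (q x * cnj (v x) + v x * cnj (q x)) + of_real E * (v x * cnj (U x) + U x * cnj (v x)))"
      using low x by (intro mult_left_mono) auto
    then show "E * (w x * (cmod (U x))\<^sup>2)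
      - ((1 / h\<^sup>2) * ((cmod (f x))\<^sup>2 / w x) + (\<epsilon> / h) * ((cmod (U x))\<^sup>2 + (W x * h * cmod (v x))\<^sup>2)) \<le> Re (b x)"
      using 1 2 unfolding Reb by (simp add: algebra_simps)
  qed
  also have "\<dots> = 0" by (rule z0)
  finally have "E * A_int - ((1 / h\<^sup>2) * (LINT x:{R..}|lborel. (cmod (f x))\<^sup>2 / w x) + (\<epsilon> / h) * (N_int + P_int)) \<le> 0"
    by (subst (asm) set_integral_diff(2), (intro set_integral_add(1) set_integrable_mult_right integrable_parts G)+,
      subst (asm) set_integral_add(2), (intro set_integral_add(1) set_integrable_mult_right integrable_parts G)+)
      (simp only: set_integral_mult_right set_integral_add(2)[OF integrable_parts(2,3)] A_int_def N_int_def P_int_def)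
  then show ?thesis by simp
qed

text \<open>\<open>P_int_le\<close> is inserted into \<open>A_int_le\<close>. The factor
  \<open>\<epsilon>\<close>, at most 1, is dropped in front of \<open>X_int\<close> but kept with
  \<open>N_int\<close>, where the imaginary part identity asks for it.\<close>

lemma half_line_estimate:
  assumes G: "set_integrable lborel {R..} (\<lambda>x. (cmod (f x))\<^sup>2 / w x)"
  shows "E * A_int \<le> (LINT x:{R..}|lborel. (cmod (f x))\<^sup>2 / w x) / h\<^sup>2
    + (2 * X_int + (2 * E + 2) * (\<epsilon> * N_int)) / h"
proof -
  have X: "X_int \<ge> 0" unfolding X_int_def set_lebesgue_integral_def
    by (intro Bochner_Integration.integral_nonneg) simp
  have "\<epsilon> * (N_int + P_int) \<le> \<epsilon> * (2 * X_int + (2 * E + 2) * N_int)"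
    using P_int_le \<epsilon> by (intro mult_left_mono) (auto simp: algebra_simps)
  also have "\<dots> = \<epsilon> * (2 * X_int) + (2 * E + 2) * (\<epsilon> * N_int)" by (simp add: algebra_simps)
  also have "\<epsilon> * (2 * X_int) \<le> 1 * (2 * X_int)" using X \<epsilon> by (intro mult_right_mono) auto
  finally have "\<epsilon> * (N_int + P_int) / h \<le> (2 * X_int + (2 * E + 2) * (\<epsilon> * N_int)) / h"
    using h by (intro divide_right_mono) auto
  then show ?thesis using A_int_le[OF G] by simp
qed

end

text \<open>Young's inequality, balanced so that the forcing costs only half of the left side E *
  \<open>A_int\<close> of \<open>half_line_estimate\<close>; what remains is the data term, of order
  1/h^2.\<close>

lemma (in half_line) X_int_le:
  assumes G: "set_integrable lborel {R..} (\<lambda>x. (cmod (f x))\<^sup>2 / w x)" and k: "k \<ge> 0"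
  shows "k / h * X_int \<le> E / 2 * A_int + k\<^sup>2 / (2 * E * h\<^sup>2) * (LINT x:{R..}|lborel. (cmod (f x))\<^sup>2 / w x)"
proof -
  have "(LINT x:{R..}|lborel. k / h * (cmod (f x) * cmod (U x)))
    \<le> (LINT x:{R..}|lborel. E / 2 * (w x * (cmod (U x))\<^sup>2) + k\<^sup>2 / (2 * E * h\<^sup>2) * ((cmod (f x))\<^sup>2 / w x))"
  proof (rule set_integral_mono)
    fix x assume "x \<in> {R..}"
    then have w: "w x > 0" using w_pos by simp
    have "k / h * (cmod (f x) * cmod (U x)) = 2 * (cmod (U x) * (k * cmod (f x) / (2 * h)))" by simp
    also have "\<dots> \<le> (E / 2 * w x) * (cmod (U x))\<^sup>2 + (k * cmod (f x) / (2 * h))\<^sup>2 / (E / 2 * w x)"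
      using E w by (intro two_mult_le_squares) simp
    finally show "k / h * (cmod (f x) * cmod (U x))
        \<le> E / 2 * (w x * (cmod (U x))\<^sup>2) + k\<^sup>2 / (2 * E * h\<^sup>2) * ((cmod (f x))\<^sup>2 / w x)"
      using E h w by (simp add: power_mult_distrib power_divide field_simps power2_eq_square)
  qed (intro set_integral_add(1) set_integrable_mult_right integrable_parts G)+
  then show ?thesis
    unfolding set_integral_add(2)[OF set_integrable_mult_right[OF integrable_parts(1)] set_integrable_mult_right[OF G]]
      set_integral_mult_right X_int_def A_int_def .
qed

section \<open>Joining the two half lines\<close>

lemma integral_exterior_split:
  fixes F :: "real \<Rightarrow> real"
  assumes F: "integrable lborel F" and z: "\<forall>x. \<bar>x\<bar> \<le> R \<longrightarrow> F x = 0" and R: "R > 0"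
  shows "(LINT x|lborel. F x) = (LINT x:{R..}|lborel. F x) + (LINT x:{R..}|lborel. F (- x))"
    and "set_integrable lborel {R..} F" "set_integrable lborel {R..} (\<lambda>x. F (- x))"
proof -
  define F2 where "F2 x = indicator {..-R} x *\<^sub>R F x" for x
  have i: "integrable lborel (\<lambda>x. indicator A x *\<^sub>R F x)" if "A \<in> sets borel" for A
    using F that by (intro integrable_mult_indicator) auto
  have F2: "integrable lborel F2" unfolding F2_def by (rule i) simp
  have F2': "F2 (- x) = indicator {R..} x *\<^sub>R F (- x)" for x by (simp add: F2_def indicator_def)
  show "set_integrable lborel {R..} F" unfolding set_integrable_def by (rule i) simp
  show "set_integrable lborel {R..} (\<lambda>x. F (- x))"
    unfolding set_integrable_def F2'[symmetric] using F2 lborel_reflect(2)[of F2] by simp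
  have "F x = indicator {R..} x *\<^sub>R F x + F2 x" for x
    using R z by (auto simp: F2_def indicator_def)
  then have "(LINT x|lborel. F x) = (LINT x|lborel. indicator {R..} x *\<^sub>R F x + F2 x)" by presburger
  also have "\<dots> = (LINT x|lborel. indicator {R..} x *\<^sub>R F x) + (LINT x|lborel. F2 x)"
    by (intro Bochner_Integration.integral_add i F2) simp
  also have "(LINT x|lborel. F2 x) = (LINT x|lborel. F2 (- x))" by (rule lborel_reflect(1)[symmetric])
  finally show "(LINT x|lborel. F x) = (LINT x:{R..}|lborel. F x) + (LINT x:{R..}|lborel. F (- x))"
    unfolding F2' set_lebesgue_integral_def .
qed

definition ext_weight :: "real \<Rightarrow> real \<Rightarrow> real \<Rightarrow> real" where
  "ext_weight R \<delta> x = weight \<delta> x * exterior_ind R x"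

lemma weight_bounds: "0 \<le> weight \<delta> x" "\<delta> > 0 \<Longrightarrow> weight \<delta> x \<le> 1"
  unfolding weight_def using powr_mono2'[of "- ((1 + \<delta>) / 2)" 1 "\<bar>x\<bar> + 1"] by auto

lemma ext_weight_bounds: "0 \<le> ext_weight R \<delta> x" "\<delta> > 0 \<Longrightarrow> ext_weight R \<delta> x \<le> 1"
  unfolding ext_weight_def exterior_ind_def using weight_bounds[of \<delta> x] by (auto simp: indicator_def)

lemma ext_weight_measurable [measurable]: "ext_weight R \<delta> \<in> borel_measurable borel"
  unfolding ext_weight_def[abs_def] weight_def exterior_ind_def by measurable

lemma ext_weight_inside: "\<bar>x\<bar> \<le> R \<Longrightarrow> ext_weight R \<delta> x = 0"
  by (simp add: ext_weight_def exterior_ind_def)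

lemma ext_weight_uminus: "ext_weight R \<delta> (- x) = ext_weight R \<delta> x"
  by (simp add: ext_weight_def exterior_ind_def weight_def indicator_def)

lemma weight_sq: "x \<ge> 0 \<Longrightarrow> (weight \<delta> x)\<^sup>2 = (1 + x) powr (- 1 - \<delta>)"
proof -
  assume "x \<ge> 0"
  have "(weight \<delta> x)\<^sup>2 = (\<bar>x\<bar> + 1) powr (- ((1 + \<delta>) / 2) + - ((1 + \<delta>) / 2))"
    unfolding weight_def power2_eq_square by (rule powr_add[symmetric])
  also have "- ((1 + \<delta>) / 2) + - ((1 + \<delta>) / 2) = - 1 - \<delta>" by (simp add: field_simps)
  finally show ?thesis using \<open>x \<ge> 0\<close> by (simp add: add.commute)
qed

text \<open>With k = 2E + 4: k = 2 + (2E + 2) is the coefficient of the forcing once the term with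
  eps is absorbed, k^2 / (2E) and the factor 2/E come from giving up half of E A, and each
  1/\<delta> under the root from one conversion between \<open>w\<close> and the squared weight.
  Neither \<open>R\<close> nor \<open>V\<close> occurs.\<close>

definition res_const :: "real \<Rightarrow> real \<Rightarrow> real" where
  "res_const E \<delta> = sqrt (2 / (E * \<delta>\<^sup>2) * (1 + (2 * E + 4)\<^sup>2 / (2 * E)))"

lemma (in ode_solution) exterior_estimate:
  assumes E: "E > 0" and \<delta>: "\<delta> > 0" and h\<delta>: "h * \<delta> \<le> 1 / 2" and \<epsilon>: "0 < \<epsilon>" "\<epsilon> \<le> 1"
    and z: "z = complex_of_real E - complex_of_real (\<sigma> * \<epsilon>) * \<i>" and \<sigma>: "\<sigma> \<in> {1, -1}"
    and f: "f \<in> L2" and g: "\<And>x. g x = of_real (ext_weight R \<delta> x) * f x"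
  shows "L2_norm (\<lambda>x. of_real (ext_weight R \<delta> x) * U x) \<le> res_const E \<delta> / h * L2_norm f"
proof -
  have Rez: "Re z = E" using z by simp
  have zE: "cmod (z - of_real E) = \<epsilon>" using z \<sigma> \<epsilon> by (auto simp: norm_mult)
  have Imz: "\<bar>Im z\<bar> = \<epsilon>" using z \<sigma> \<epsilon> by auto
  interpret r: half_line R h E \<delta> \<epsilon> z g U v
    by unfold_locales (intro R_pos h_pos E \<delta> h\<delta> \<epsilon> Rez zE U_L2 v_L2 g_L2 U_prim v_prim_right)+
  interpret l: half_line R h E \<delta> \<epsilon> z "\<lambda>x. g (- x)" "\<lambda>x. U (- x)" vL
    by unfold_locales (intro R_pos h_pos E \<delta> h\<delta> \<epsilon> Rez zE L2_reflect U_L2 vL_L2 g_L2 U_prim_left vL_prim)+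
  define e where "e = ext_weight R \<delta>"
  have [measurable]: "e \<in> borel_measurable borel" unfolding e_def by measurable
  have e01: "0 \<le> e x" "e x \<le> 1" "cmod (of_real (e x)) \<le> 1" for x
    unfolding e_def using ext_weight_bounds(1)[of R \<delta> x] ext_weight_bounds(2)[of \<delta> R x] \<delta> by auto
  have e0: "e x = 0" if "\<bar>x\<bar> \<le> R" for x unfolding e_def by (rule ext_weight_inside[OF that])
  have em: "e (- x) = e x" for x unfolding e_def by (rule ext_weight_uminus)
  have g: "g x = of_real (e x) * f x" for x unfolding e_def by (rule g)
  have ew: "(e x)\<^sup>2 = r.w x / \<delta>" if "x > R" for x
    using that \<delta> weight_sq[of x \<delta>] R_pos
    by (simp add: e_def ext_weight_def exterior_ind_def r.w_def)
  have ew': "(e x)\<^sup>2 \<le> r.w x / \<delta>" if "x \<ge> R" for x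
    using ew[of x] e0[of R] r.w_pos[of x] that \<delta> R_pos by (cases "x = R") auto
  \<comment> \<open>The squared exterior weight in |g|^2 cancels \<open>w\<close> up to 1/\<delta>;
    \<open>F\<close> is |g|^2 / w with this quotient carried out on both sides of the
    support.\<close>
  define F where "F x = indicator {x. R < \<bar>x\<bar>} x * (cmod (f x))\<^sup>2 / \<delta>" for x
  have fi: "integrable lborel (\<lambda>x. (cmod (f x))\<^sup>2)" by (rule L2_integrable[OF f])
  have F: "integrable lborel F"
    unfolding F_def using integrable_mult_indicator[OF _ fi, of "{x. R < \<bar>x\<bar>}"] by simp
  have F0: "\<forall>x. \<bar>x\<bar> \<le> R \<longrightarrow> F x = 0" by (simp add: F_def)
  note sF = integral_exterior_split[OF F F0 R_pos]
  have Gr: "(cmod (g x))\<^sup>2 / r.w x = F x" if "x \<in> {R..}" for x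
  proof (cases "x = R")
    case False
    then have x: "x > R" using that by simp
    then have "(cmod (g x))\<^sup>2 = r.w x / \<delta> * (cmod (f x))\<^sup>2"
      using ew[OF x] e01[of x] by (simp add: g norm_mult power_mult_distrib)
    then show ?thesis using r.w_pos[of x] x \<delta> R_pos by (simp add: F_def)
  qed (use R_pos in \<open>simp add: g e0 F0\<close>)
  have Gl: "(cmod (g (- x)))\<^sup>2 / r.w x = F (- x)" if "x \<in> {R..}" for x
  proof (cases "x = R")
    case False
    then have x: "x > R" using that by simp
    then have "(cmod (g (- x)))\<^sup>2 = r.w x / \<delta> * (cmod (f (- x)))\<^sup>2"
      using ew[OF x] e01[of x] by (simp add: g em norm_mult power_mult_distrib)
    then show ?thesis using r.w_pos[of x] x \<delta> R_pos by (simp add: F_def)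
  qed (use R_pos in \<open>simp add: g e0 F0\<close>)
  have iGr: "set_integrable lborel {R..} (\<lambda>x. (cmod (g x))\<^sup>2 / r.w x)"
    using sF(2) by (subst set_integrable_cong[OF refl refl Gr]) auto
  have iGl: "set_integrable lborel {R..} (\<lambda>x. (cmod (g (- x)))\<^sup>2 / r.w x)"
    using sF(3) by (subst set_integrable_cong[OF refl refl Gl]) auto
  define G where "G = (LINT x:{R..}|lborel. (cmod (g x))\<^sup>2 / r.w x) + (LINT x:{R..}|lborel. (cmod (g (- x)))\<^sup>2 / r.w x)"
  have "G = (LINT x:{R..}|lborel. F x) + (LINT x:{R..}|lborel. F (- x))"
    unfolding G_def by (intro arg_cong2[where f = "(+)"] set_lebesgue_integral_cong) (simp_all add: Gr Gl)
  also have "\<dots> = (LINT x|lborel. F x)" by (rule sF(1)[symmetric])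
  also have "\<dots> \<le> (LINT x|lborel. (cmod (f x))\<^sup>2 / \<delta>)"
    by (rule integral_mono[OF F]) (use fi \<delta> in \<open>auto simp: F_def indicator_def\<close>)
  also have "\<dots> = (LINT x|lborel. (cmod (f x))\<^sup>2) / \<delta>" by simp
  finally have G: "G \<le> (LINT x|lborel. (cmod (f x))\<^sup>2) / \<delta>" .
  define X where "X = r.X_int + l.X_int"
  have giU: "integrable lborel (\<lambda>x. cmod (g x) * cmod (U x))"
    using integrable_norm[OF L2_mult_integrable[OF g_L2 U_L2]] by (simp add: norm_mult)
  have X: "(LINT x|lborel. cmod (g x) * cmod (U x)) = X"
    unfolding X_def r.X_int_def l.X_int_def
    by (rule integral_exterior_split(1)[OF giU _ R_pos]) (simp add: g e0)
  \<comment> \<open>The two exterior masses add up to at most the full squared norm, which times |Im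
    z| = \<epsilon> is at most the integral of |g U|; \<open>g\<close> vanishes inside, so this is
    the exterior forcing \<open>X\<close> again.\<close>
  have "\<epsilon> * (r.N_int + l.N_int) \<le> \<epsilon> * (LINT x|lborel. (cmod (U x))\<^sup>2)"
  proof -
    define H where "H x = indicator {x. R < \<bar>x\<bar>} x * (cmod (U x))\<^sup>2" for x
    have H: "integrable lborel H"
      unfolding H_def using integrable_mult_indicator[OF _ L2_integrable[OF U_L2], of "{x. R < \<bar>x\<bar>}"] by simp
    have H0: "\<forall>x. \<bar>x\<bar> \<le> R \<longrightarrow> H x = 0" by (simp add: H_def)
    note sH = integral_exterior_split[OF H H0 R_pos]
    have "r.N_int = (LINT x:{R..}|lborel. H x)"
      unfolding r.N_int_def
    proof (rule set_lebesgue_integral_cong_AE)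
      show "AE x\<in>{R..} in lborel. (cmod (U x))\<^sup>2 = H x"
        using AE_lborel_singleton[of R] by eventually_elim (use R_pos in \<open>auto simp: H_def\<close>)
    qed (use H in auto)
    moreover have "l.N_int = (LINT x:{R..}|lborel. H (- x))"
      unfolding l.N_int_def
    proof (rule set_lebesgue_integral_cong_AE)
      have [measurable]: "H \<in> borel_measurable borel" using H by simp
      show "(\<lambda>x. H (- x)) \<in> borel_measurable lborel" by measurable
      show "AE x\<in>{R..} in lborel. (cmod (U (- x)))\<^sup>2 = H (- x)"
        using AE_lborel_singleton[of R] by eventually_elim (use R_pos in \<open>auto simp: H_def\<close>)
    qed auto
    ultimately have "r.N_int + l.N_int = (LINT x|lborel. H x)" using sH(1) by simp
    also have "\<dots> \<le> (LINT x|lborel. (cmod (U x))\<^sup>2)"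
      by (rule integral_mono[OF H L2_integrable[OF U_L2]]) (simp add: H_def indicator_def)
    finally show ?thesis using \<epsilon> by (intro mult_left_mono) auto
  qed
  also have "\<dots> = \<bar>Im z * (LINT x|lborel. (cmod (U x))\<^sup>2)\<bar>"
    by (simp add: abs_mult Imz integral_nonneg_AE)
  also have "\<dots> = \<bar>Im (LINT x|lborel. g x * cnj (U x))\<bar>" unfolding Im_identity by simp
  also have "\<dots> \<le> cmod (LINT x|lborel. g x * cnj (U x))" by (rule abs_Im_le_cmod)
  also have "\<dots> \<le> (LINT x|lborel. cmod (g x * cnj (U x)))" by (rule integral_norm_bound)
  also have "\<dots> = X" using X by (simp add: norm_mult)
  finally have N: "\<epsilon> * (r.N_int + l.N_int) \<le> X" .
  define A where "A = r.A_int + l.A_int"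
  define k where "k = 2 * E + 4"
  have "E * A \<le> G / h\<^sup>2 + (2 * X + (2 * E + 2) * (\<epsilon> * (r.N_int + l.N_int))) / h"
    using r.half_line_estimate[OF iGr] l.half_line_estimate[OF iGl]
    by (simp add: A_def G_def X_def algebra_simps add_divide_distrib)
  also have "\<dots> \<le> G / h\<^sup>2 + (2 * X + (2 * E + 2) * X) / h"
    using N E h_pos by (intro add_left_mono divide_right_mono mult_left_mono) auto
  also have "\<dots> = G / h\<^sup>2 + k / h * X" by (simp add: k_def algebra_simps)
  also have "k / h * X \<le> E / 2 * A + k\<^sup>2 / (2 * E * h\<^sup>2) * G"
    using r.X_int_le[OF iGr, of k] l.X_int_le[OF iGl, of k] E
    by (simp add: A_def G_def X_def k_def distrib_left)
  finally have "E * A \<le> G / h\<^sup>2 + (E / 2 * A + k\<^sup>2 / (2 * E * h\<^sup>2) * G)" by simp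
  then have "E / 2 * A \<le> G / h\<^sup>2 + k\<^sup>2 / (2 * E * h\<^sup>2) * G" by linarith
  also have "\<dots> = (1 + k\<^sup>2 / (2 * E)) / h\<^sup>2 * G" using E h_pos by (simp add: field_simps)
  finally have "2 / E * (E / 2 * A) \<le> 2 / E * ((1 + k\<^sup>2 / (2 * E)) / h\<^sup>2 * G)"
    using E by (intro mult_left_mono) auto
  then have "A \<le> 2 / E * ((1 + k\<^sup>2 / (2 * E)) / h\<^sup>2 * G)" using E by simp
  also have "\<dots> \<le> 2 / E * ((1 + k\<^sup>2 / (2 * E)) / h\<^sup>2 * ((LINT x|lborel. (cmod (f x))\<^sup>2) / \<delta>))"
    using G E by (intro mult_left_mono) auto
  finally have A: "A \<le> 2 / E * ((1 + k\<^sup>2 / (2 * E)) / h\<^sup>2 * ((LINT x|lborel. (cmod (f x))\<^sup>2) / \<delta>))" .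
  define Y where "Y x = (cmod (of_real (e x) * U x))\<^sup>2" for x
  have Y: "integrable lborel Y"
    unfolding Y_def by (intro L2_integrable L2_bounded_mult[OF U_L2 _ e01(3)]) simp
  have Y0: "\<forall>x. \<bar>x\<bar> \<le> R \<longrightarrow> Y x = 0" by (simp add: Y_def e0)
  note sY = integral_exterior_split[OF Y Y0 R_pos]
  have Yeq: "Y x = (e x)\<^sup>2 * (cmod (U x))\<^sup>2" for x using e01 by (simp add: Y_def norm_mult power_mult_distrib)
  have "(LINT x:{R..}|lborel. Y x) \<le> (LINT x:{R..}|lborel. (1 / \<delta>) * (r.w x * (cmod (U x))\<^sup>2))"
  proof (rule set_integral_mono[OF sY(2)])
    fix x assume "x \<in> {R..}"
    then have "(e x)\<^sup>2 * (cmod (U x))\<^sup>2 \<le> (r.w x / \<delta>) * (cmod (U x))\<^sup>2"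
      using ew'[of x] by (intro mult_right_mono) auto
    then show "Y x \<le> 1 / \<delta> * (r.w x * (cmod (U x))\<^sup>2)" by (simp add: Yeq)
  qed (intro set_integrable_mult_right r.integrable_parts)
  moreover have "(LINT x:{R..}|lborel. Y (- x)) \<le> (LINT x:{R..}|lborel. (1 / \<delta>) * (r.w x * (cmod (U (- x)))\<^sup>2))"
  proof (rule set_integral_mono[OF sY(3)])
    fix x assume "x \<in> {R..}"
    then have "(e x)\<^sup>2 * (cmod (U (- x)))\<^sup>2 \<le> (r.w x / \<delta>) * (cmod (U (- x)))\<^sup>2"
      using ew'[of x] by (intro mult_right_mono) auto
    then show "Y (- x) \<le> 1 / \<delta> * (r.w x * (cmod (U (- x)))\<^sup>2)" by (simp add: Yeq em)
  qed (intro set_integrable_mult_right l.integrable_parts)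
  ultimately have "(LINT x|lborel. Y x) \<le> A / \<delta>"
    unfolding sY(1) A_def r.A_int_def l.A_int_def set_integral_mult_right by (simp add: add_divide_distrib)
  also have "\<dots> \<le> (2 / E * ((1 + k\<^sup>2 / (2 * E)) / h\<^sup>2 * ((LINT x|lborel. (cmod (f x))\<^sup>2) / \<delta>))) / \<delta>"
    using A \<delta> by (intro divide_right_mono) auto
  also have "\<dots> = (2 / (E * \<delta>\<^sup>2) * (1 + k\<^sup>2 / (2 * E))) / h\<^sup>2 * (LINT x|lborel. (cmod (f x))\<^sup>2)"
  proof -
    have "(2 / E * (a / h\<^sup>2 * (n / \<delta>))) / \<delta> = (2 / (E * \<delta>\<^sup>2) * a) / h\<^sup>2 * n" for a n :: real
      by (simp add: power2_eq_square mult_ac)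
    then show ?thesis .
  qed
  finally have "L2_norm (\<lambda>x. of_real (e x) * U x)
      \<le> sqrt ((2 / (E * \<delta>\<^sup>2) * (1 + k\<^sup>2 / (2 * E))) / h\<^sup>2 * (LINT x|lborel. (cmod (f x))\<^sup>2))"
    unfolding L2_norm_def Y_def[symmetric] by simp
  also have "\<dots> = res_const E \<delta> / h * L2_norm f"
    using h_pos unfolding real_sqrt_mult real_sqrt_divide res_const_def L2_norm_def k_def by simp
  finally show ?thesis by (simp add: e_def)
qed

section \<open>The free Green's function\<close>

lemma continuous_param_integral:
  fixes f :: "real \<Rightarrow> real \<Rightarrow> complex"
  assumes [measurable]: "\<And>x. f x \<in> borel_measurable M"
    and cont: "\<And>y. continuous_on UNIV (\<lambda>x. f x y)"
    and dom: "\<And>x0 L. \<exists>d. integrable M d \<and> (\<forall>x y. \<bar>x - x0\<bar> \<le> L \<longrightarrow> cmod (f x y) \<le> d y)"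
  shows "continuous_on UNIV (\<lambda>x. LINT y|M. f x y)"
proof (subst continuous_on_eq_continuous_at, simp, intro ballI)
  fix x :: real
  show "isCont (\<lambda>x. LINT y|M. f x y) x"
    unfolding continuous_at_sequentially comp_def
  proof (intro allI impI)
    fix s :: "nat \<Rightarrow> real" assume s: "s \<longlonglongrightarrow> x"
    have "Bseq (\<lambda>n. s n - x)"
      by (intro convergent_imp_Bseq convergentI[of _ "x - x"] tendsto_intros s)
    then obtain L where L: "\<And>n. \<bar>s n - x\<bar> \<le> L" by (auto simp: Bseq_def)
    obtain d where d: "integrable M d" "\<And>x' y. \<bar>x' - x\<bar> \<le> L \<Longrightarrow> cmod (f x' y) \<le> d y"
      using dom[of x L] by blast
    show "(\<lambda>n. LINT y|M. f (s n) y) \<longlonglongrightarrow> (LINT y|M. f x y)"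
    proof (rule integral_dominated_convergence[OF _ _ d(1)])
      show "AE y in M. (\<lambda>n. f (s n) y) \<longlonglongrightarrow> f x y"
      proof (intro AE_I2)
        fix y
        have "isCont (\<lambda>x. f x y) x" using cont[of y] by (simp add: continuous_on_eq_continuous_at)
        then show "(\<lambda>n. f (s n) y) \<longlonglongrightarrow> f x y" using s by (rule isCont_tendsto_compose)
      qed
      show "AE y in M. cmod (f (s n) y) \<le> d y" for n using d(2)[OF L] by simp
    qed measurable
  qed
qed

text \<open>Allows a corner at one point, as the kernel has on the diagonal; continuity there is
  what lets the fundamental theorem pass over it.\<close>

lemma prim_on_strong:
  assumes cont: "continuous_on UNIV C" and c: "c \<in> L1_loc"
    and der: "\<And>x. x \<noteq> y \<Longrightarrow> (C has_vector_derivative c x) (at x)"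
  shows "prim_on r C c"
proof (rule prim_onI)
  fix t assume t: "r \<le> t"
  show i: "set_integrable lborel {r..t} c" by (rule L1_loc_set_integrable[OF c])
  have "(c has_integral C t - C r) {r..t}"
    by (rule fundamental_theorem_of_calculus_interior_strong[of "{y}"])
      (use t der continuous_on_subset[OF cont] in auto)
  then show "C t = C r + (LINT x:{r..t}|lborel. c x)"
    using set_borel_integral_eq_integral(2)[OF i] by (simp add: integral_unique)
qed

text \<open>Green's function of -h^2 d^2/dx^2 - z for z = -\<mu>^2 h^2, without its factor 1 / (2
  \<mu> h^2), which is restored in \<open>green_solution\<close>.\<close>

definition free_kernel :: "complex \<Rightarrow> real \<Rightarrow> real \<Rightarrow> complex" where
  "free_kernel \<mu> x y = exp (- \<mu> * of_real \<bar>x - y\<bar>)"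

text \<open>The derivative in \<open>x\<close> off the diagonal; \<open>sgn\<close> makes it 0 on
  the diagonal, which for fixed \<open>y\<close> is a null set in \<open>x\<close>.\<close>

definition free_kernel' :: "complex \<Rightarrow> real \<Rightarrow> real \<Rightarrow> complex" where
  "free_kernel' \<mu> x y = - \<mu> * of_real (sgn (x - y)) * free_kernel \<mu> x y"

lemma free_kernel_cont: "continuous_on UNIV (\<lambda>x. free_kernel \<mu> x y)"
  unfolding free_kernel_def by (intro continuous_intros)

lemma free_kernel_measurable [measurable]:
  "(\<lambda>p. free_kernel \<mu> (fst p) (snd p)) \<in> borel_measurable (borel \<Otimes>\<^sub>M borel)"
  "(\<lambda>p. free_kernel' \<mu> (fst p) (snd p)) \<in> borel_measurable (borel \<Otimes>\<^sub>M borel)"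
  unfolding free_kernel'_def free_kernel_def sgn_if by measurable

lemma norm_free_kernel: "cmod (free_kernel \<mu> x y) = exp (- Re \<mu> * \<bar>x - y\<bar>)"
  by (simp add: free_kernel_def)

lemma norm_free_kernel': "cmod (free_kernel' \<mu> x y) \<le> cmod \<mu> * exp (- Re \<mu> * \<bar>x - y\<bar>)"
  by (auto simp: free_kernel'_def norm_mult norm_free_kernel sgn_if)

lemma exp_affine_deriv:
  "((\<lambda>x. c * exp (m * of_real (x - y))) has_vector_derivative c * m * exp (m * of_real (x - y))) (at x)"
  for c m :: complex
proof -
  have "((\<lambda>w. c * exp (m * (w - of_real y))) has_field_derivative c * m * exp (m * (of_real x - of_real y)))
      (at (of_real x))"
    by (auto intro!: derivative_eq_intros)
  from has_vector_derivative_real_field[OF this] show ?thesis by simp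
qed

lemma free_kernel_deriv:
  assumes "x \<noteq> y"
  shows "((\<lambda>x. free_kernel \<mu> x y) has_vector_derivative free_kernel' \<mu> x y) (at x)"
proof (cases "x > y")
  case True
  have "((\<lambda>x. 1 * exp (- \<mu> * of_real (x - y))) has_vector_derivative 1 * - \<mu> * exp (- \<mu> * of_real (x - y))) (at x)"
    by (rule exp_affine_deriv)
  then have "((\<lambda>x. free_kernel \<mu> x y) has_vector_derivative 1 * - \<mu> * exp (- \<mu> * of_real (x - y))) (at x)"
    by (rule has_vector_derivative_transform_within_open[where S = "{y<..}"])
      (use True in \<open>auto simp: free_kernel_def\<close>)
  then show ?thesis using True by (simp add: free_kernel'_def free_kernel_def)
next
  case False
  have "((\<lambda>x. 1 * exp (\<mu> * of_real (x - y))) has_vector_derivative 1 * \<mu> * exp (\<mu> * of_real (x - y))) (at x)"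
    by (rule exp_affine_deriv)
  then have "((\<lambda>x. free_kernel \<mu> x y) has_vector_derivative 1 * \<mu> * exp (\<mu> * of_real (x - y))) (at x)"
    by (rule has_vector_derivative_transform_within_open[where S = "{..<y}"])
      (use False assms in \<open>auto simp: free_kernel_def algebra_simps\<close>)
  then show ?thesis using False assms by (simp add: free_kernel'_def free_kernel_def algebra_simps)
qed

lemma bounded_L1_loc:
  assumes [measurable]: "f \<in> borel_measurable borel" and "\<And>x. cmod (f x) \<le> B"
  shows "f \<in> L1_loc"
  unfolding L1_loc_def
proof (intro CollectI conjI allI)
  fix a b :: real
  show "set_integrable lborel {a..b} f"
  proof (rule set_integrable_bound)
    show "set_integrable lborel {a..b} (\<lambda>x. B)"
      by (rule borel_integrable_atLeastAtMost') simp
    show "set_borel_measurable lborel {a..b} f" unfolding set_borel_measurable_def by measurable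
    show "AE x in lborel. x \<in> {a..b} \<longrightarrow> norm (f x) \<le> norm B"
      using assms(2) by (intro AE_I2) (auto intro: order_trans[OF _ abs_ge_self])
  qed
qed simp

lemma free_kernel'_L1_loc:
  assumes "Re \<mu> > 0" shows "(\<lambda>x. free_kernel' \<mu> x y) \<in> L1_loc"
proof (rule bounded_L1_loc)
  have "(\<lambda>x. (x, y)) \<in> borel \<rightarrow>\<^sub>M borel \<Otimes>\<^sub>M borel" by measurable
  from measurable_compose[OF this free_kernel_measurable(2)]
  show "(\<lambda>x. free_kernel' \<mu> x y) \<in> borel_measurable borel" by simp
  fix x
  have "cmod (free_kernel' \<mu> x y) \<le> cmod \<mu> * exp (- Re \<mu> * \<bar>x - y\<bar>)" by (rule norm_free_kernel')
  also have "\<dots> \<le> cmod \<mu> * 1" using assms by (intro mult_left_mono) auto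
  finally show "cmod (free_kernel' \<mu> x y) \<le> cmod \<mu>" by simp
qed

lemma free_kernel_test:
  assumes "Re \<mu> > 0" "\<phi> \<in> test_functions"
  shows "(LINT x|lborel. free_kernel \<mu> x y * vderiv \<phi> x) = - (LINT x|lborel. free_kernel' \<mu> x y * \<phi> x)"
  by (rule weak_of_prim_on[OF prim_on_strong[OF free_kernel_cont _ free_kernel_deriv]])
    (use assms in \<open>auto intro: free_kernel'_L1_loc\<close>)

text \<open>Adding the step of height \<open>2 \<mu>\<close> at \<open>y\<close> makes the derivative of the kernel absolutely continuous.\<close>

lemma free_kernel'_test:
  assumes \<mu>: "Re \<mu> > 0" and \<phi>: "\<phi> \<in> test_functions"
  shows "(LINT x|lborel. free_kernel' \<mu> x y * vderiv \<phi> x)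
    = - \<mu>\<^sup>2 * (LINT x|lborel. free_kernel \<mu> x y * \<phi> x) + 2 * \<mu> * \<phi> y"
proof -
  \<comment> \<open>The constant is chosen for continuity at \<open>y\<close>: both branches tend to
    \<mu> there.\<close>
  define D where "D x = (if x < y then \<mu> * exp (\<mu> * of_real (x - y)) else 2 * \<mu> - \<mu> * exp (- \<mu> * of_real (x - y)))" for x
  have D_eq: "D x = free_kernel' \<mu> x y + 2 * \<mu> * indicator {y..} x" if "x \<noteq> y" for x
    using that by (auto simp: D_def free_kernel'_def free_kernel_def algebra_simps)
  have cont: "continuous_on UNIV D"
  proof -
    have c1: "continuous_on ({..y} \<union> {y..}) (\<lambda>x. if x \<le> y then \<mu> * exp (\<mu> * of_real (x - y)) else 2 * \<mu> - \<mu> * exp (- \<mu> * of_real (x - y)))"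
      by (rule continuous_on_If) (auto intro!: continuous_intros)
    have c2: "{..y} \<union> {y..} = UNIV" by auto
    have c3: "(\<lambda>x. if x \<le> y then \<mu> * exp (\<mu> * of_real (x - y)) else 2 * \<mu> - \<mu> * exp (- \<mu> * of_real (x - y))) = D"
      by (auto simp: D_def)
    show ?thesis using c1 unfolding c2 c3 .
  qed
  have der: "(D has_vector_derivative \<mu>\<^sup>2 * free_kernel \<mu> x y) (at x)" if "x \<noteq> y" for x
  proof (cases "x < y")
    case True
    have "(D has_vector_derivative \<mu> * \<mu> * exp (\<mu> * of_real (x - y))) (at x)"
      by (rule has_vector_derivative_transform_within_open[OF exp_affine_deriv, where S = "{..<y}"])
        (use True in \<open>auto simp: D_def\<close>)
    then show ?thesis using True by (simp add: free_kernel_def power2_eq_square algebra_simps)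
  next
    case False
    have "((\<lambda>x. 2 * \<mu> + - \<mu> * exp (- \<mu> * of_real (x - y))) has_vector_derivative
        0 + - \<mu> * - \<mu> * exp (- \<mu> * of_real (x - y))) (at x)"
      by (intro has_vector_derivative_add has_vector_derivative_const exp_affine_deriv)
    then have "(D has_vector_derivative 0 + - \<mu> * - \<mu> * exp (- \<mu> * of_real (x - y))) (at x)"
      by (rule has_vector_derivative_transform_within_open[where S = "{y<..}"])
        (use False that in \<open>auto simp: D_def\<close>)
    then show ?thesis using False that by (simp add: free_kernel_def power2_eq_square)
  qed
  have kL: "(\<lambda>x. \<mu>\<^sup>2 * free_kernel \<mu> x y) \<in> L1_loc"
    by (intro L1_loc_cmult continuous_L1_loc free_kernel_cont)
  have \<phi>': "vderiv \<phi> \<in> test_functions" by (rule test_vderiv[OF \<phi>])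
  have "(LINT x|lborel. D x * vderiv \<phi> x) = - (LINT x|lborel. \<mu>\<^sup>2 * free_kernel \<mu> x y * \<phi> x)"
    by (rule weak_of_prim_on[OF prim_on_strong[OF cont kL der] kL \<phi>])
  also have "\<dots> = - \<mu>\<^sup>2 * (LINT x|lborel. free_kernel \<mu> x y * \<phi> x)"
    unfolding mult.assoc by simp
  finally have 1: "(LINT x|lborel. D x * vderiv \<phi> x) = - \<mu>\<^sup>2 * (LINT x|lborel. free_kernel \<mu> x y * \<phi> x)" .
  have i1: "integrable lborel (\<lambda>x. free_kernel' \<mu> x y * vderiv \<phi> x)"
    by (intro L1_loc_mult_test free_kernel'_L1_loc \<mu> \<phi>')
  have i2: "integrable lborel (\<lambda>x. indicat_real {y..} x *\<^sub>R vderiv \<phi> x)"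
    by (intro integrable_mult_indicator test_integrable \<phi>') simp
  have "(LINT x|lborel. D x * vderiv \<phi> x)
      = (LINT x|lborel. free_kernel' \<mu> x y * vderiv \<phi> x + 2 * \<mu> * (indicat_real {y..} x *\<^sub>R vderiv \<phi> x))"
  proof (rule integral_cong_AE)
    show "AE x in lborel. D x * vderiv \<phi> x
      = free_kernel' \<mu> x y * vderiv \<phi> x + 2 * \<mu> * (indicat_real {y..} x *\<^sub>R vderiv \<phi> x)"
      using AE_lborel_singleton[of y] by eventually_elim (auto simp: D_eq indicator_def algebra_simps)
    show "(\<lambda>x. D x * vderiv \<phi> x) \<in> borel_measurable lborel"
      using borel_measurable_continuous_onI[OF cont] test_measurable[OF \<phi>'] by simp
    show "(\<lambda>x. free_kernel' \<mu> x y * vderiv \<phi> x + 2 * \<mu> * (indicat_real {y..} x *\<^sub>R vderiv \<phi> x))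
      \<in> borel_measurable lborel"
      by (rule borel_measurable_integrable[OF Bochner_Integration.integrable_add[OF i1 integrable_mult_right[OF i2]]])
  qed
  also have "\<dots> = (LINT x|lborel. free_kernel' \<mu> x y * vderiv \<phi> x) + 2 * \<mu> * - \<phi> y"
    by (simp only: Bochner_Integration.integral_add[OF i1 integrable_mult_right[OF i2]]
        integral_mult_right_zero test_FTC_ge[OF \<phi>])
  finally show ?thesis using 1 by (simp add: algebra_simps)
qed

section \<open>Potentials with exponentially decaying kernels\<close>

lemma exp_decay_integrable:
  fixes a :: real assumes a: "a > 0"
  shows "integrable lborel (\<lambda>x. exp (- a * \<bar>x - y\<bar>))"
    and "(LINT x|lborel. exp (- a * \<bar>x - y\<bar>)) = (LINT x|lborel. exp (- a * \<bar>x\<bar>))"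
proof -
  have half: "integrable lborel (\<lambda>x. indicator {0..} x * exp (- a * x))"
  proof (rule integrableI_nonneg)
    have "(\<integral>\<^sup>+x. ennreal (exp (- a * x)) * indicator {0..} x \<partial>lborel) = ennreal (0 - (- exp (- a * 0) / a))"
    proof (rule nn_integral_FTC_atLeast)
      show "((\<lambda>x. - exp (- a * x) / a) has_real_derivative exp (- a * x)) (at x)" for x
        using a by (auto intro!: derivative_eq_intros)
      have "((\<lambda>x. - (exp (- (a * x)) / a)) \<longlongrightarrow> - (0 / a)) at_top"
        using a by (intro tendsto_intros filterlim_compose[OF exp_at_bot])
         (auto simp: filterlim_uminus_at_bot intro!: filterlim_tendsto_pos_mult_at_top filterlim_ident)
      then show "((\<lambda>x. - exp (- a * x) / a) \<longlongrightarrow> 0) at_top" by simp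
    qed auto
    moreover have "(\<integral>\<^sup>+x. ennreal (indicator {0..} x * exp (- a * x)) \<partial>lborel)
        = (\<integral>\<^sup>+x. ennreal (exp (- a * x)) * indicator {0..} x \<partial>lborel)"
      by (intro nn_integral_cong) (auto simp: indicator_def)
    ultimately show "(\<integral>\<^sup>+x. ennreal (indicator {0..} x * exp (- a * x)) \<partial>lborel) < \<infinity>" by simp
  qed auto
  define E where "E x = indicator {0..} x * exp (- a * x)" for x
  have E: "integrable lborel E" using half by (simp add: E_def[abs_def])
  have "integrable lborel (\<lambda>x. E x + E (- x))"
    using E lborel_reflect(2)[of E] by (intro Bochner_Integration.integrable_add) auto
  then have full: "integrable lborel (\<lambda>x. exp (- a * \<bar>x\<bar>))"
    by (rule Bochner_Integration.integrable_bound) (auto simp: E_def indicator_def)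
  show "integrable lborel (\<lambda>x. exp (- a * \<bar>x - y\<bar>))"
    using lborel_integrable_real_affine_iff[of 1 "\<lambda>x. exp (- a * \<bar>x\<bar>)" "- y"] full by simp
  show "(LINT x|lborel. exp (- a * \<bar>x - y\<bar>)) = (LINT x|lborel. exp (- a * \<bar>x\<bar>))"
    using lborel_integral_real_affine[of 1 "\<lambda>x. exp (- a * \<bar>x\<bar>)" "- y"] by simp
qed

text \<open>Serves three times: Lebesgue measure with \<open>k = g\<close>, and the two variations
  of \<open>V\<close> with a bounded density \<open>k\<close>. Lebesgue measure is infinite and
  \<open>g\<close> may be unbounded, hence hypotheses in terms of the integrated kernel and the
  square of \<open>k\<close>.\<close>

locale green_potential = sigma_finite_measure M for M :: "real measure" +
  fixes \<mu> :: complex and B :: real and k :: "real \<Rightarrow> complex"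
  assumes sets_M [simp, measurable_cong]: "sets M = sets borel"
    and \<mu>: "Re \<mu> > 0" and B: "B > 0"
    and e_int: "\<And>x. integrable M (\<lambda>y. exp (- Re \<mu> * \<bar>x - y\<bar>))"
    and e_le: "\<And>x. (LINT y|M. exp (- Re \<mu> * \<bar>x - y\<bar>)) \<le> B"
    and k_meas [measurable]: "k \<in> borel_measurable borel"
    and k_int: "integrable M (\<lambda>y. (cmod (k y))\<^sup>2)"
begin

abbreviation "e x y \<equiv> exp (- Re \<mu> * \<bar>x - y\<bar>)"

lemma e_le_1: "e x y \<le> 1" using \<mu> by simp

lemma ek2_int: "integrable M (\<lambda>y. e x y * (cmod (k y))\<^sup>2)"
  by (rule Bochner_Integration.integrable_bound[OF k_int])
    (use \<mu> in \<open>auto simp: abs_mult intro!: mult_left_le_one_le\<close>)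

lemma ek_int: "integrable M (\<lambda>y. e x y * cmod (k y))"
proof (rule Bochner_Integration.integrable_bound)
  show "integrable M (\<lambda>y. e x y + e x y * (cmod (k y))\<^sup>2)" using e_int ek2_int by simp
  have "t \<le> 1 + t\<^sup>2" for t :: real
    using zero_le_power2[of "t - 1 / 2"] by (simp add: power2_diff power2_eq_square algebra_simps)
  then have "e x y * cmod (k y) \<le> e x y * (1 + (cmod (k y))\<^sup>2)" for y by (intro mult_left_mono) auto
  then show "AE y in M. norm (e x y * cmod (k y)) \<le> norm (e x y + e x y * (cmod (k y))\<^sup>2)"
    by (intro AE_I2) (simp add: distrib_left)
qed simp

text \<open>Optimize \<open>t\<close> in \<open>\<integral> e(x, y) (t - \<bar>k(y)\<bar>)\<^sup>2 dM(y) \<ge> 0\<close>.\<close>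

lemma ek_sq_le: "(LINT y|M. e x y * cmod (k y))\<^sup>2 \<le> B * (LINT y|M. e x y * (cmod (k y))\<^sup>2)"
proof -
  define I where "I = (LINT y|M. e x y * cmod (k y))"
  define D where "D = (LINT y|M. e x y * (cmod (k y))\<^sup>2)"
  define t where "t = I / B"
  have "0 \<le> (LINT y|M. e x y * (t - cmod (k y))\<^sup>2)" by (intro Bochner_Integration.integral_nonneg) auto
  also have "(\<lambda>y. e x y * (t - cmod (k y))\<^sup>2)
      = (\<lambda>y. t\<^sup>2 * e x y - 2 * t * (e x y * cmod (k y)) + e x y * (cmod (k y))\<^sup>2)"
    by (simp add: fun_eq_iff power2_diff algebra_simps)
  also have "(LINT y|M. t\<^sup>2 * e x y - 2 * t * (e x y * cmod (k y)) + e x y * (cmod (k y))\<^sup>2)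
      = t\<^sup>2 * (LINT y|M. e x y) - 2 * t * I + D"
    unfolding I_def D_def using e_int ek_int ek2_int
    by (simp only: Bochner_Integration.integral_add Bochner_Integration.integral_diff integrable_mult_right
        Bochner_Integration.integrable_diff integral_mult_right_zero)
  also have "\<dots> \<le> t\<^sup>2 * B - 2 * t * I + D" using mult_left_mono[OF e_le, of "t\<^sup>2" x] by simp
  also have "\<dots> = D - I\<^sup>2 / B" using B by (simp add: t_def power2_eq_square field_simps)
  finally show ?thesis using B by (simp add: I_def D_def field_simps)
qed

definition ek_bound where "ek_bound = B + (LINT y|M. (cmod (k y))\<^sup>2)"

lemma ek_le: "(LINT y|M. e x y * cmod (k y)) \<le> ek_bound"
proof -
  have "(LINT y|M. e x y * cmod (k y)) \<le> (LINT y|M. e x y + (cmod (k y))\<^sup>2)"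
  proof (rule integral_mono[OF ek_int])
    fix y
    have "t \<le> 1 + t\<^sup>2" for t :: real
      using zero_le_power2[of "t - 1 / 2"] by (simp add: power2_diff power2_eq_square algebra_simps)
    then have "e x y * cmod (k y) \<le> e x y * (1 + (cmod (k y))\<^sup>2)" by (intro mult_left_mono) auto
    also have "\<dots> \<le> e x y + 1 * (cmod (k y))\<^sup>2"
      unfolding distrib_left using e_le_1[of x y] by (intro add_mono mult_right_mono) auto
    finally show "e x y * cmod (k y) \<le> e x y + (cmod (k y))\<^sup>2" by simp
  qed (use e_int k_int in simp)
  also have "\<dots> = (LINT y|M. e x y) + (LINT y|M. (cmod (k y))\<^sup>2)" using e_int k_int by simp
  also have "\<dots> \<le> ek_bound" unfolding ek_bound_def using e_le by simp
  finally show ?thesis .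
qed

text \<open>Integrating in \<open>x\<close> first gives the same constant for every
  \<open>y\<close>; together with \<open>ek_sq_le\<close> this is Schur's test for the L^2
  bound.\<close>

lemma ek2_integrable: "integrable lborel (\<lambda>x. LINT y|M. e x y * (cmod (k y))\<^sup>2)"
proof -
  interpret P: pair_sigma_finite M lborel by standard
  have "integrable (M \<Otimes>\<^sub>M lborel) (\<lambda>(y, x). e x y * (cmod (k y))\<^sup>2)"
  proof (rule P.Fubini_integrable)
    show "integrable M (\<lambda>y. LINT x|lborel. norm (case (y, x) of (y, x) \<Rightarrow> e x y * (cmod (k y))\<^sup>2))"
      using exp_decay_integrable(2)[OF \<mu>] k_int by (simp add: abs_mult)
    show "AE y in M. integrable lborel (\<lambda>x. case (y, x) of (y, x) \<Rightarrow> e x y * (cmod (k y))\<^sup>2)"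
      using exp_decay_integrable(1)[OF \<mu>] by simp
  qed measurable
  then show ?thesis by (rule P.integrable_snd)
qed

text \<open>\<open>J\<close> stands for the kernel and for its derivative, both bounded by a
  multiple of the exponential.\<close>

context
  fixes J :: "real \<Rightarrow> real \<Rightarrow> complex" and c :: real
  assumes J_meas: "(\<lambda>p. J (fst p) (snd p)) \<in> borel_measurable (borel \<Otimes>\<^sub>M borel)"
    and J_le: "\<And>x y. cmod (J x y) \<le> c * e x y"
begin

lemma J_meas': "J x \<in> borel_measurable borel" "(\<lambda>x. J x y) \<in> borel_measurable borel"
proof -
  have "(\<lambda>y. (x, y)) \<in> borel \<rightarrow>\<^sub>M borel \<Otimes>\<^sub>M borel" by measurable
  from measurable_compose[OF this J_meas] show "J x \<in> borel_measurable borel" by simp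
  have "(\<lambda>x. (x, y)) \<in> borel \<rightarrow>\<^sub>M borel \<Otimes>\<^sub>M borel" by measurable
  from measurable_compose[OF this J_meas] show "(\<lambda>x. J x y) \<in> borel_measurable borel" by simp
qed

lemma c_nonneg: "c \<ge> 0"
  using order_trans[OF norm_ge_zero J_le[of 0 0]] by simp

lemma Jk_le: "cmod (J x y * k y) \<le> c * (e x y * cmod (k y))"
  unfolding norm_mult mult.assoc[symmetric] by (intro mult_right_mono J_le) simp

lemma Jk_int: "integrable M (\<lambda>y. J x y * k y)"
proof (rule Bochner_Integration.integrable_bound[OF integrable_mult_right[OF ek_int[of x], of c]])
  note [measurable] = J_meas'(1)[of x]
  show "(\<lambda>y. J x y * k y) \<in> borel_measurable M" by measurable
qed (rule AE_I2, rule order_trans[OF Jk_le], simp)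

lemma Jk_norm_le: "cmod (LINT y|M. J x y * k y) \<le> c * (LINT y|M. e x y * cmod (k y))"
proof -
  have "cmod (LINT y|M. J x y * k y) \<le> (LINT y|M. cmod (J x y * k y))" by (rule integral_norm_bound)
  also have "\<dots> \<le> (LINT y|M. c * (e x y * cmod (k y)))"
    by (intro integral_mono integrable_norm Jk_int integrable_mult_right ek_int Jk_le)
  finally show ?thesis by simp
qed

lemma Jk_bounded: "cmod (LINT y|M. J x y * k y) \<le> c * ek_bound"
  using Jk_norm_le order_trans mult_left_mono[OF ek_le c_nonneg] by blast

lemma Jk_measurable: "(\<lambda>x. LINT y|M. J x y * k y) \<in> borel_measurable borel"
  using J_meas by measurable

lemma Jk_L2: "(\<lambda>x. LINT y|M. J x y * k y) \<in> L2"
  unfolding L2_def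
proof (intro CollectI conjI)
  show "(\<lambda>x. LINT y|M. J x y * k y) \<in> borel_measurable lborel" using Jk_measurable by simp
  show "integrable lborel (\<lambda>x. (cmod (LINT y|M. J x y * k y))\<^sup>2)"
  proof (rule Bochner_Integration.integrable_bound)
    show "integrable lborel (\<lambda>x. (c\<^sup>2 * B) * (LINT y|M. e x y * (cmod (k y))\<^sup>2))"
      by (intro integrable_mult_right ek2_integrable)
    have "(cmod (LINT y|M. J x y * k y))\<^sup>2 \<le> (c\<^sup>2 * B) * (LINT y|M. e x y * (cmod (k y))\<^sup>2)" for x
    proof -
      have "(cmod (LINT y|M. J x y * k y))\<^sup>2 \<le> (c * (LINT y|M. e x y * cmod (k y)))\<^sup>2"
        by (intro power_mono Jk_norm_le) simp
      also have "\<dots> \<le> c\<^sup>2 * (B * (LINT y|M. e x y * (cmod (k y))\<^sup>2))"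
        unfolding power_mult_distrib by (intro mult_left_mono ek_sq_le) simp
      finally show ?thesis by (simp add: mult.assoc)
    qed
    then show "AE x in lborel. norm ((cmod (LINT y|M. J x y * k y))\<^sup>2)
        \<le> norm ((c\<^sup>2 * B) * (LINT y|M. e x y * (cmod (k y))\<^sup>2))"
      by (intro AE_I2) (simp only: real_norm_def abs_power2, rule order_trans[OF _ abs_ge_self], simp)
    show "(\<lambda>x. (cmod (LINT y|M. J x y * k y))\<^sup>2) \<in> borel_measurable lborel"
      using Jk_measurable by simp
  qed
qed

lemma Jk_Fubini:
  assumes \<phi>: "\<phi> \<in> test_functions"
  shows "(LINT x|lborel. (LINT y|M. J x y * k y) * \<phi> x) = (LINT y|M. k y * (LINT x|lborel. J x y * \<phi> x))"
    and "integrable M (\<lambda>y. k y * (LINT x|lborel. J x y * \<phi> x))"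
proof -
  interpret P: pair_sigma_finite lborel M by standard
  note [measurable] = test_measurable[OF \<phi>] Jk_measurable
  have "integrable (lborel \<Otimes>\<^sub>M M) (\<lambda>(x, y). J x y * k y * \<phi> x)"
  proof (rule P.Fubini_integrable)
    show "(\<lambda>(x, y). J x y * k y * \<phi> x) \<in> borel_measurable (lborel \<Otimes>\<^sub>M M)"
      using J_meas by measurable
    show "integrable lborel (\<lambda>x. LINT y|M. norm (case (x, y) of (x, y) \<Rightarrow> J x y * k y * \<phi> x))"
    proof (rule Bochner_Integration.integrable_bound)
      show "integrable lborel (\<lambda>x. c * ek_bound * cmod (\<phi> x))"
        by (intro integrable_mult_right integrable_norm test_integrable \<phi>)
      show "(\<lambda>x. LINT y|M. norm (case (x, y) of (x, y) \<Rightarrow> J x y * k y * \<phi> x)) \<in> borel_measurable lborel"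
        using J_meas by measurable
      have "(LINT y|M. cmod (J x y * k y * \<phi> x)) \<le> c * ek_bound * cmod (\<phi> x)" for x
      proof -
        have "(LINT y|M. cmod (J x y * k y * \<phi> x)) = (LINT y|M. cmod (J x y * k y)) * cmod (\<phi> x)"
          unfolding norm_mult[of "_ * _"] by simp
        also have "\<dots> \<le> (LINT y|M. c * (e x y * cmod (k y))) * cmod (\<phi> x)"
          by (intro mult_right_mono integral_mono integrable_norm Jk_int integrable_mult_right ek_int Jk_le) simp
        also have "\<dots> = c * (LINT y|M. e x y * cmod (k y)) * cmod (\<phi> x)" by simp
        also have "\<dots> \<le> c * ek_bound * cmod (\<phi> x)"
          by (intro mult_right_mono mult_left_mono ek_le c_nonneg) simp
        finally show ?thesis .
      qed
      then show "AE x in lborel. norm (LINT y|M. norm (case (x, y) of (x, y) \<Rightarrow> J x y * k y * \<phi> x))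
          \<le> norm (c * ek_bound * cmod (\<phi> x))"
        by (intro AE_I2) (auto intro: order_trans[OF _ abs_ge_self])
    qed
    show "AE x in lborel. integrable M (\<lambda>y. case (x, y) of (x, y) \<Rightarrow> J x y * k y * \<phi> x)"
      using Jk_int by (intro AE_I2) simp
  qed
  note i = P.integral_fst[OF this] P.integral_snd[OF this] P.integrable_snd[OF this]
  have 1: "(LINT y|M. J x y * k y * \<phi> x) = (LINT y|M. J x y * k y) * \<phi> x" for x by simp
  have 2: "(LINT x|lborel. J x y * k y * \<phi> x) = k y * (LINT x|lborel. J x y * \<phi> x)" for y
  proof -
    have "(\<lambda>x. J x y * k y * \<phi> x) = (\<lambda>x. k y * (J x y * \<phi> x))" by (simp add: fun_eq_iff)
    then show ?thesis by (simp only: integral_mult_right_zero)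
  qed
  show "(LINT x|lborel. (LINT y|M. J x y * k y) * \<phi> x) = (LINT y|M. k y * (LINT x|lborel. J x y * \<phi> x))"
    using i(1,2) by (simp only: 1 2)
  show "integrable M (\<lambda>y. k y * (LINT x|lborel. J x y * \<phi> x))"
    using i(3) by (simp only: 2)
qed

end

definition pot :: "real \<Rightarrow> complex" where "pot x = (LINT y|M. free_kernel \<mu> x y * k y)"
definition pot' :: "real \<Rightarrow> complex" where "pot' x = (LINT y|M. free_kernel' \<mu> x y * k y)"

lemma kernel_le: "cmod (free_kernel \<mu> x y) \<le> 1 * e x y" "cmod (free_kernel' \<mu> x y) \<le> cmod \<mu> * e x y"
  using norm_free_kernel norm_free_kernel' by simp_all

lemma pot_L2: "pot \<in> L2" and pot'_L2: "pot' \<in> L2"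
  unfolding pot_def[abs_def] pot'_def[abs_def]
  by (rule Jk_L2[OF free_kernel_measurable(1) kernel_le(1)], rule Jk_L2[OF free_kernel_measurable(2) kernel_le(2)])

lemma pot_bounded: "cmod (pot x) \<le> 1 * ek_bound" and pot'_bounded: "cmod (pot' x) \<le> cmod \<mu> * ek_bound"
  unfolding pot_def pot'_def
  by (rule Jk_bounded[OF free_kernel_measurable(1) kernel_le(1)], rule Jk_bounded[OF free_kernel_measurable(2) kernel_le(2)])

lemma pot_continuous: "continuous_on UNIV pot"
  unfolding pot_def[abs_def]
proof (rule continuous_param_integral)
  show "(\<lambda>y. free_kernel \<mu> x y * k y) \<in> borel_measurable M" for x
    using Jk_int[OF free_kernel_measurable(1) kernel_le(1)] by (rule borel_measurable_integrable)
  show "continuous_on UNIV (\<lambda>x. free_kernel \<mu> x y * k y)" for y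
    by (intro continuous_intros free_kernel_cont)
  fix x0 L :: real
  \<comment> \<open>Moving \<open>x\<close> by at most \<open>L\<close> costs a factor exp(Re \<mu>
    * L), so one dominating function serves all \<open>x\<close> near \<open>x0\<close>.\<close>
  have "cmod (free_kernel \<mu> x y * k y) \<le> exp (Re \<mu> * L) * (e x0 y * cmod (k y))" if "\<bar>x - x0\<bar> \<le> L" for x y
  proof -
    have "\<bar>x0 - y\<bar> - L \<le> \<bar>x - y\<bar>" using that by linarith
    then have "Re \<mu> * (\<bar>x0 - y\<bar> - L) \<le> Re \<mu> * \<bar>x - y\<bar>" using \<mu> by (intro mult_left_mono) auto
    then have "e x y \<le> exp (Re \<mu> * L + - Re \<mu> * \<bar>x0 - y\<bar>)" by (simp add: algebra_simps)
    then have "e x y * cmod (k y) \<le> (exp (Re \<mu> * L) * e x0 y) * cmod (k y)"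
      unfolding exp_add by (rule mult_right_mono) simp
    then show ?thesis by (simp add: norm_mult norm_free_kernel mult.assoc)
  qed
  then show "\<exists>d. integrable M d \<and> (\<forall>x y. \<bar>x - x0\<bar> \<le> L \<longrightarrow> cmod (free_kernel \<mu> x y * k y) \<le> d y)"
    using ek_int[of x0] by (intro exI[of _ "\<lambda>y. exp (Re \<mu> * L) * (e x0 y * cmod (k y))"]) auto
qed

lemma pot_weak: "\<phi> \<in> test_functions \<Longrightarrow>
    (LINT x|lborel. pot x * vderiv \<phi> x) = - (LINT x|lborel. pot' x * \<phi> x)"
  unfolding pot_def pot'_def
  by (simp add: Jk_Fubini[OF free_kernel_measurable(1) kernel_le(1)] Jk_Fubini[OF free_kernel_measurable(2) kernel_le(2)]
      test_vderiv free_kernel_test[OF \<mu>])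

text \<open>On the compact support of \<open>\<phi>\<close> the exponential is bounded below, so the
  integrability of \<open>e 0 y * cmod (k y)\<close> is enough, even where \<open>k\<close> alone is
  not integrable.\<close>

lemma test_k_int: "\<phi> \<in> test_functions \<Longrightarrow> integrable M (\<lambda>y. k y * \<phi> y)"
proof -
  assume \<phi>: "\<phi> \<in> test_functions"
  have m: "k \<in> borel_measurable M" "\<phi> \<in> borel_measurable M"
    unfolding measurable_cong_sets[OF sets_M refl] by (rule k_meas, rule test_measurable[OF \<phi>])
  obtain C where C: "C > 0" "\<And>x. cmod (\<phi> x) \<le> C" using test_bounded[OF \<phi>] by blast
  obtain r where r: "r > 0" "\<And>x. r \<le> \<bar>x\<bar> \<Longrightarrow> \<phi> x = 0" using test_support[OF \<phi>] by blast
  show ?thesis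
  proof (rule Bochner_Integration.integrable_bound[OF integrable_mult_right[OF ek_int[of 0], of "C * exp (Re \<mu> * r)"]])
    have "cmod (k y * \<phi> y) \<le> C * exp (Re \<mu> * r) * (e 0 y * cmod (k y))" for y
    proof (cases "r \<le> \<bar>y\<bar>")
      case False
      then have "Re \<mu> * \<bar>y\<bar> \<le> Re \<mu> * r" using \<mu> by (intro mult_left_mono) auto
      then have "1 \<le> exp (Re \<mu> * r) * e 0 y" by (simp add: exp_add[symmetric])
      then have "C * 1 \<le> C * (exp (Re \<mu> * r) * e 0 y)" using C(1) by (intro mult_left_mono) auto
      then have "cmod (\<phi> y) \<le> C * (exp (Re \<mu> * r) * e 0 y)" using C(2)[of y] by linarith
      from mult_right_mono[OF this, of "cmod (k y)"] show ?thesis by (simp add: norm_mult mult_ac)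
    qed (use r C in simp)
    then show "AE y in M. norm (k y * \<phi> y) \<le> norm (C * exp (Re \<mu> * r) * (e 0 y * cmod (k y)))"
      by (intro AE_I2) (auto intro: order_trans[OF _ abs_ge_self])
  qed (intro borel_measurable_times m)
qed

text \<open>In the sense of distributions, -pot'' + \<mu>^2 pot = 2 \<mu> k M. The factor 2 \<mu>
  comes from the jump of the derivative of the kernel across the diagonal.\<close>

lemma pot'_weak:
  assumes \<phi>: "\<phi> \<in> test_functions"
  shows "(LINT x|lborel. pot' x * vderiv \<phi> x)
    = - \<mu>\<^sup>2 * (LINT x|lborel. pot x * \<phi> x) + 2 * \<mu> * (LINT y|M. k y * \<phi> y)"
proof -
  have "(LINT x|lborel. pot' x * vderiv \<phi> x) = (LINT y|M. k y * (LINT x|lborel. free_kernel' \<mu> x y * vderiv \<phi> x))"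
    unfolding pot'_def by (rule Jk_Fubini[OF free_kernel_measurable(2) kernel_le(2) test_vderiv[OF \<phi>]])
  also have "\<dots> = (LINT y|M. - \<mu>\<^sup>2 * (k y * (LINT x|lborel. free_kernel \<mu> x y * \<phi> x)) + 2 * \<mu> * (k y * \<phi> y))"
  proof -
    have "a * (- \<mu>\<^sup>2 * l + 2 * \<mu> * p) = - \<mu>\<^sup>2 * (a * l) + 2 * \<mu> * (a * p)" for a l p
      by (simp add: algebra_simps)
    then show ?thesis unfolding free_kernel'_test[OF \<mu> \<phi>] by (simp only:)
  qed
  also have "\<dots> = - \<mu>\<^sup>2 * (LINT y|M. k y * (LINT x|lborel. free_kernel \<mu> x y * \<phi> x)) + 2 * \<mu> * (LINT y|M. k y * \<phi> y)"
    using Jk_Fubini(2)[OF free_kernel_measurable(1) kernel_le(1) \<phi>] test_k_int[OF \<phi>]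
    by (simp only: Bochner_Integration.integral_add integrable_mult_right integral_mult_right_zero)
  also have "(LINT y|M. k y * (LINT x|lborel. free_kernel \<mu> x y * \<phi> x)) = (LINT x|lborel. pot x * \<phi> x)"
    unfolding pot_def by (rule Jk_Fubini(1)[OF free_kernel_measurable(1) kernel_le(1) \<phi>, symmetric])
  finally show ?thesis .
qed

end

section \<open>Existence\<close>

lemma test_integral_comb:
  assumes "p1 \<in> L2" "p2 \<in> L2" "p3 \<in> L2" "\<psi> \<in> test_functions"
  shows "(LINT x|lborel. c * (p1 x - (p2 x - p3 x)) * \<psi> x)
    = c * ((LINT x|lborel. p1 x * \<psi> x) - ((LINT x|lborel. p2 x * \<psi> x) - (LINT x|lborel. p3 x * \<psi> x)))"
proof -
  have "c * (p1 x - (p2 x - p3 x)) * \<psi> x = c * (p1 x * \<psi> x - (p2 x * \<psi> x - p3 x * \<psi> x))" for x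
    by (simp add: algebra_simps)
  then show ?thesis
    using assms by (simp only: integral_mult_right_zero Bochner_Integration.integral_diff
        Bochner_Integration.integrable_diff L1_loc_mult_test L2_L1_loc)
qed

context compact_signed_measure
begin

text \<open>A finite measure makes the bounded kernel and the bounded density integrable at once;
  the added 1 keeps the bound positive even for the zero measure.\<close>

lemma finite_green_potential:
  assumes "finite_measure M" "sets M = sets borel" "Re \<mu> > 0" and [measurable]: "k \<in> borel_measurable borel"
    and K: "\<And>x. cmod (k x) \<le> K"
  shows "green_potential M \<mu> (measure M UNIV + 1) k"
proof -
  interpret finite_measure M by fact
  have [simp, measurable_cong]: "sets M = sets borel" by fact
  have sp: "space M = UNIV" using sets_eq_imp_space_eq[OF assms(2)] by simp
  show ?thesis
  proof unfold_locales
    fix x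
    have le: "exp (- Re \<mu> * \<bar>x - y\<bar>) \<le> 1" for y using assms(3) by simp
    show i: "integrable M (\<lambda>y. exp (- Re \<mu> * \<bar>x - y\<bar>))"
      using le by (intro integrable_const_bound[of _ 1]) auto
    have "(LINT y|M. exp (- Re \<mu> * \<bar>x - y\<bar>)) \<le> (LINT y|M. 1)"
      using i le by (intro integral_mono) auto
    then show "(LINT y|M. exp (- Re \<mu> * \<bar>x - y\<bar>)) \<le> measure M UNIV + 1"
      by (simp add: sp)
    have "(cmod (k y))\<^sup>2 \<le> K\<^sup>2" for y using K by (intro power_mono) auto
    then show "integrable M (\<lambda>y. (cmod (k y))\<^sup>2)"
      by (intro integrable_const_bound[of _ "K\<^sup>2"]) auto
  qed (use assms(3) measure_nonneg[of M UNIV] in \<open>auto intro: add_nonneg_pos\<close>)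
qed

lemma lborel_green_potential:
  assumes "Re \<mu> > 0" "g \<in> L2"
  shows "green_potential lborel \<mu> ((LINT x|lborel. exp (- Re \<mu> * \<bar>x\<bar>)) + 1) g"
proof
  fix x
  note e = exp_decay_integrable[OF assms(1), of x]
  show "integrable lborel (\<lambda>y. exp (- Re \<mu> * \<bar>x - y\<bar>))" using e(1) by (simp add: abs_minus_commute)
  show "(LINT y|lborel. exp (- Re \<mu> * \<bar>x - y\<bar>)) \<le> (LINT x|lborel. exp (- Re \<mu> * \<bar>x\<bar>)) + 1"
    using e(2) by (simp add: abs_minus_commute)
  show "0 < (LINT x|lborel. exp (- Re \<mu> * \<bar>x\<bar>)) + 1"
    by (intro add_nonneg_pos Bochner_Integration.integral_nonneg) auto
qed (use assms in \<open>auto simp: L2_measurable L2_integrable\<close>)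

text \<open>Only the values of \<open>k\<close> on [-R, R] enter the measure \<open>k V\<close>. A
  fixed point of the integral equation on [-R, R] therefore extends, by the formula for
  \<open>u\<close>, to a global square integrable solution with \<open>u V = k V\<close>.\<close>

lemma green_solution:
  assumes \<mu>: "Re \<mu> > 0" and h: "h > 0" and g: "g \<in> L2"
    and k: "k \<in> borel_measurable borel" and K: "\<And>x. cmod (k x) \<le> K"
    and u: "\<And>x. u x = 1 / (2 * \<mu> * of_real (h\<^sup>2)) *
      ((LINT y|lborel. free_kernel \<mu> x y * g y) - S (\<lambda>y. free_kernel \<mu> x y * k y))"
    and uk: "\<And>x. \<bar>x\<bar> \<le> R \<Longrightarrow> u x = k x"
  shows "continuous_on UNIV u" "solves_shifted V h (- \<mu>\<^sup>2 * of_real (h\<^sup>2)) u g"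
proof -
  interpret gl: green_potential lborel \<mu> "(LINT x|lborel. exp (- Re \<mu> * \<bar>x\<bar>)) + 1" g
    by (rule lborel_green_potential[OF \<mu> g])
  interpret gp: green_potential Vp \<mu> "measure Vp UNIV + 1" k
    by (rule finite_green_potential[OF p.finite_measure_axioms sets_Vp \<mu> k K])
  interpret gn: green_potential Vn \<mu> "measure Vn UNIV + 1" k
    by (rule finite_green_potential[OF n.finite_measure_axioms sets_Vn \<mu> k K])
  define c where "c = 1 / (2 * \<mu> * of_real (h\<^sup>2))"
  define z where "z = - \<mu>\<^sup>2 * of_real (h\<^sup>2)"
  have \<mu>0: "\<mu> \<noteq> 0" using \<mu> by auto
  have u_eq: "u = (\<lambda>x. c * (gl.pot x - (gp.pot x - gn.pot x)))"
    by (simp add: fun_eq_iff u c_def gl.pot_def gp.pot_def gn.pot_def signed_integral_def)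
  define v where "v x = c * (gl.pot' x - (gp.pot' x - gn.pot' x))" for x
  show cont: "continuous_on UNIV u"
    unfolding u_eq by (intro continuous_intros gl.pot_continuous gp.pot_continuous gn.pot_continuous)
  have L2_diff: "(\<lambda>x. f1 x - f2 x) \<in> L2" if "f1 \<in> L2" "f2 \<in> L2" for f1 f2
    using L2_add[OF that(1) L2_cmult[OF that(2), of "-1"]] by simp
  have u_L2: "u \<in> L2" unfolding u_eq by (intro L2_cmult L2_diff gl.pot_L2 gp.pot_L2 gn.pot_L2)
  have v_L2: "v \<in> L2" unfolding v_def by (intro L2_cmult L2_diff gl.pot'_L2 gp.pot'_L2 gn.pot'_L2)
  have bd: "cmod (c * (a1 - (a2 - a3))) \<le> cmod c * (b1 + (b2 + b3))"
    if "cmod a1 \<le> b1" "cmod a2 \<le> b2" "cmod a3 \<le> b3" for a1 a2 a3 b1 b2 b3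
  proof -
    have "cmod (a1 - (a2 - a3)) \<le> cmod a1 + (cmod a2 + cmod a3)"
      by (intro order_trans[OF norm_triangle_ineq4] add_mono norm_triangle_ineq4 order_refl)
    then show ?thesis unfolding norm_mult using that by (intro mult_left_mono) auto
  qed
  have "bounded (range u)"
    unfolding bounded_iff u_eq using bd[OF gl.pot_bounded gp.pot_bounded gn.pot_bounded] by auto
  then have rep: "cont_rep u = u" using cont by (intro cont_rep_eqI) auto
  have "v \<in> Linf"
    unfolding Linf_def
  proof (intro CollectI conjI exI AE_I2)
    show "v \<in> borel_measurable lborel" using L2_measurable[OF v_L2] by simp
    show "cmod (v x) \<le> cmod c * (cmod \<mu> * gl.ek_bound + (cmod \<mu> * gp.ek_bound + cmod \<mu> * gn.ek_bound))" for x
      unfolding v_def by (rule bd[OF gl.pot'_bounded gp.pot'_bounded gn.pot'_bounded])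
  qed
  have weak: "weak_derivative u v"
    unfolding weak_derivative_def
  proof (intro conjI ballI L2_L1_loc u_L2 v_L2)
    fix \<phi> assume \<phi>: "\<phi> \<in> test_functions"
    note \<phi>' = test_vderiv[OF \<phi>]
    show "(LINT x|lborel. u x * vderiv \<phi> x) = - (LINT x|lborel. v x * \<phi> x)"
      unfolding u_eq v_def test_integral_comb[OF gl.pot_L2 gp.pot_L2 gn.pot_L2 \<phi>']
        test_integral_comb[OF gl.pot'_L2 gp.pot'_L2 gn.pot'_L2 \<phi>]
        gl.pot_weak[OF \<phi>] gp.pot_weak[OF \<phi>] gn.pot_weak[OF \<phi>]
    proof -
      show "c * (- a1 - (- a2 - - a3)) = - (c * (a1 - (a2 - a3)))" for a1 a2 a3
        by (simp add: algebra_simps)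
    qed
  qed
  have P: "P_dist V h u \<phi> - z * dist_of u \<phi> = dist_of g \<phi>" if \<phi>: "\<phi> \<in> test_functions" for \<phi>
  proof -
    note \<phi>' = test_vderiv[OF \<phi>]
    have [measurable]: "u \<in> borel_measurable borel" "\<phi> \<in> borel_measurable borel" "k \<in> borel_measurable borel"
      using L2_measurable[OF u_L2] test_measurable[OF \<phi>] k by auto
    have Sk: "S (\<lambda>x. u x * \<phi> x) = S (\<lambda>x. k x * \<phi> x)"
      by (rule S_cong) (auto simp: uk)
    define D where "D = dist_of u \<phi>"
    define a1 where "a1 = (LINT x|lborel. gl.pot x * \<phi> x)"
    define a2 where "a2 = (LINT x|lborel. gp.pot x * \<phi> x)"
    define a3 where "a3 = (LINT x|lborel. gn.pot x * \<phi> x)"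
    define s2 where "s2 = (LINT x|Vp. k x * \<phi> x)"
    define s3 where "s3 = (LINT x|Vn. k x * \<phi> x)"
    have D: "D = c * (a1 - (a2 - a3))"
      unfolding D_def dist_of_def u_eq test_integral_comb[OF gl.pot_L2 gp.pot_L2 gn.pot_L2 \<phi>] a1_def a2_def a3_def ..
    have "dist_of u (vderiv (vderiv \<phi>)) = - (LINT x|lborel. v x * vderiv \<phi> x)"
      using weak \<phi>' by (simp add: weak_derivative_def dist_of_def)
    also have "(LINT x|lborel. v x * vderiv \<phi> x) = c * ((- \<mu>\<^sup>2 * a1 + 2 * \<mu> * dist_of g \<phi>)
        - ((- \<mu>\<^sup>2 * a2 + 2 * \<mu> * s2) - (- \<mu>\<^sup>2 * a3 + 2 * \<mu> * s3)))"
      unfolding v_def test_integral_comb[OF gl.pot'_L2 gp.pot'_L2 gn.pot'_L2 \<phi>']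
        gl.pot'_weak[OF \<phi>] gp.pot'_weak[OF \<phi>] gn.pot'_weak[OF \<phi>] dist_of_def a1_def a2_def a3_def s2_def s3_def ..
    also have "\<dots> = - \<mu>\<^sup>2 * D + c * (2 * \<mu>) * (dist_of g \<phi> - (s2 - s3))"
      unfolding D by (simp add: algebra_simps)
    also have "c * (2 * \<mu>) = 1 / of_real (h\<^sup>2)" using \<mu>0 h by (simp add: c_def)
    finally have "of_real (h\<^sup>2) * dist_of u (vderiv (vderiv \<phi>)) = of_real (h\<^sup>2) * \<mu>\<^sup>2 * D - (dist_of g \<phi> - (s2 - s3))"
      using h by (simp add: field_simps)
    then have "- of_real (h\<^sup>2) * dist_of u (vderiv (vderiv \<phi>)) + (s2 - s3) - - \<mu>\<^sup>2 * of_real (h\<^sup>2) * D = dist_of g \<phi>"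
      by (simp add: algebra_simps)
    moreover have "S (\<lambda>x. k x * \<phi> x) = s2 - s3" by (simp add: signed_integral_def s2_def s3_def)
    ultimately show ?thesis
      unfolding P_dist_def rep Sk z_def D_def[symmetric] by (simp only:)
  qed
  have "u \<in> P_domain V h"
    unfolding P_domain_def H1_def
  proof (intro CollectI conjI)
    show "\<exists>v\<in>L2. weak_derivative u v" using weak v_L2 by blast
    show "\<exists>v\<in>Linf. weak_derivative u v" using weak \<open>v \<in> Linf\<close> by blast
    show "\<exists>f\<in>L2. \<forall>\<phi>\<in>test_functions. P_dist V h u \<phi> = dist_of f \<phi>"
    proof (intro bexI ballI)
      show "(\<lambda>x. g x + z * u x) \<in> L2" by (intro L2_add g L2_cmult u_L2)
      fix \<phi> assume \<phi>: "\<phi> \<in> test_functions"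
      have "dist_of (\<lambda>x. g x + z * u x) \<phi> = (LINT x|lborel. g x * \<phi> x + z * (u x * \<phi> x))"
        unfolding dist_of_def by (simp add: distrib_right mult.assoc)
      also have "\<dots> = dist_of g \<phi> + z * dist_of u \<phi>"
        using L1_loc_mult_test[OF L2_L1_loc[OF g] \<phi>] L1_loc_mult_test[OF L2_L1_loc[OF u_L2] \<phi>]
        by (simp add: dist_of_def)
      finally show "P_dist V h u \<phi> = dist_of (\<lambda>x. g x + z * u x) \<phi>" using P[OF \<phi>] by (simp add: algebra_simps)
    qed
  qed (rule u_L2)
  then show "solves_shifted V h (- \<mu>\<^sup>2 * of_real (h\<^sup>2)) u g"
    unfolding solves_shifted_def z_def[symmetric] using P by blast
qed

section \<open>Volterra equations on the support of the potential\<close>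

lemma S_norm_le:
  assumes f: "f \<in> borel_measurable borel" and B: "\<And>x. \<bar>x\<bar> \<le> R \<Longrightarrow> cmod (f x) \<le> B"
  shows "cmod (S f) \<le> B * (measure Vp UNIV + measure Vn UNIV)"
proof -
  note i = S_integrable[OF f B]
  have "cmod (LINT y|Vp. f y) \<le> (LINT y|Vp. B)"
  proof (rule order_trans[OF integral_norm_bound integral_mono_AE[OF integrable_norm[OF i(1)] p.integrable_const]])
    show "AE y in Vp. norm (f y) \<le> B" using AE_Vp by eventually_elim (rule B)
  qed
  moreover have "cmod (LINT y|Vn. f y) \<le> (LINT y|Vn. B)"
  proof (rule order_trans[OF integral_norm_bound integral_mono_AE[OF integrable_norm[OF i(2)] n.integrable_const]])
    show "AE y in Vn. norm (f y) \<le> B" using AE_Vn by eventually_elim (rule B)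
  qed
  ultimately have "cmod (S f) \<le> (LINT y|Vp. B) + (LINT y|Vn. B)"
    unfolding signed_integral_def by (intro order_trans[OF norm_triangle_ineq4] add_mono)
  then show ?thesis by (simp add: algebra_simps)
qed

text \<open>Composition with it extends functions on [-R, R] by constants, so that the contraction
  can run in the complete space of bounded continuous functions on the line.\<close>

definition clamp_R :: "real \<Rightarrow> real" where "clamp_R x = max (- R) (min R x)"

lemma clamp_R: "\<bar>clamp_R x\<bar> \<le> R" "\<bar>x\<bar> \<le> R \<Longrightarrow> clamp_R x = x" "continuous_on A clamp_R"
  using R_pos by (auto simp: clamp_R_def intro!: continuous_intros)

text \<open>A Volterra equation, solved by contraction in the norm \<open>sup e\<^bsup>-\<theta>x\<^esup> \<bar>u(x)\<bar>\<close>. Atoms of \<open>V\<close> do no harm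
  because the kernel \<open>q\<close> vanishes at \<open>0\<close>.\<close>

lemma volterra:
  fixes q f :: "real \<Rightarrow> complex"
  assumes q: "continuous_on UNIV q" and q0: "\<And>t. t \<le> 0 \<Longrightarrow> q t = 0" and f: "continuous_on UNIV f"
  shows "\<exists>u K. continuous_on UNIV u \<and> (\<forall>x. cmod (u x) \<le> K) \<and>
    (\<forall>x. \<bar>x\<bar> \<le> R \<longrightarrow> u x = f x + S (\<lambda>y. q (x - y) * u y))"
proof -
  define m where "m = measure Vp UNIV + measure Vn UNIV"
  have m: "m \<ge> 0" by (simp add: m_def)
  \<comment> \<open>Chosen so that \<open>\<eta> * m\<close>, the contraction constant, is at most
    1/2; \<open>m + 1\<close> avoids division by 0.\<close>
  define \<eta> where "\<eta> = 1 / (2 * (m + 1))"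
  have \<eta>: "\<eta> > 0" "\<eta> * m \<le> 1 / 2" using m by (auto simp: \<eta>_def field_simps)
  obtain Q where Q: "Q > 0" "\<And>t. t \<in> {- (2 * R)..2 * R} \<Longrightarrow> cmod (q t) \<le> Q"
  proof -
    have "compact (q ` {- (2 * R)..2 * R})"
      by (intro compact_continuous_image continuous_on_subset[OF q]) auto
    then obtain Q where "Q > 0" "\<forall>y \<in> q ` {- (2 * R)..2 * R}. cmod y \<le> Q"
      using compact_imp_bounded bounded_pos by metis
    then show ?thesis using that by blast
  qed
  obtain d where d: "d > 0" "\<And>t. \<bar>t\<bar> < d \<Longrightarrow> cmod (q t) < \<eta>"
  proof -
    have "isCont q 0" using q by (simp add: continuous_on_eq_continuous_at)
    then obtain d where "d > 0" "\<forall>t. dist t 0 < d \<longrightarrow> dist (q t) (q 0) < \<eta>"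
      using \<eta>(1) unfolding continuous_at_eps_delta by metis
    then show ?thesis using that[of d] q0[of 0] by auto
  qed
  \<comment> \<open>Beyond \<open>d\<close> the weight has to reduce \<open>Q\<close> to
    \<open>\<eta>\<close>, and exp(\<theta> d) >= \<theta> d = Q / \<eta> does so. Below
    \<open>d\<close> the kernel is small by itself, being continuous and 0 at the origin.\<close>
  define \<theta> where "\<theta> = Q / (\<eta> * d)"
  have \<theta>: "\<theta> > 0" using Q \<eta> d by (simp add: \<theta>_def)
  define \<kappa> where "\<kappa> t = q t * of_real (exp (- \<theta> * t))" for t
  have \<kappa>_cont: "continuous_on UNIV \<kappa>" unfolding \<kappa>_def by (intro continuous_intros q)
  have \<kappa>: "cmod (\<kappa> t) \<le> \<eta>" if "\<bar>t\<bar> \<le> 2 * R" for t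
  proof (cases "t < d")
    case True
    show ?thesis
    proof (cases "t \<le> 0")
      case False
      then have "cmod (\<kappa> t) \<le> \<eta> * 1"
        unfolding \<kappa>_def norm_mult using True d(2)[of t] \<theta> \<eta> by (intro mult_mono) auto
      then show ?thesis by simp
    qed (use \<eta> in \<open>simp add: \<kappa>_def q0\<close>)
  next
    case False
    have "\<theta> * d \<le> exp (\<theta> * d)" using exp_ge_add_one_self[of "\<theta> * d"] by linarith
    also have "\<dots> \<le> exp (\<theta> * t)" using False \<theta> by simp
    finally have "Q / \<eta> \<le> exp (\<theta> * t)" using \<eta> d by (simp add: \<theta>_def)
    then have "Q \<le> \<eta> * exp (\<theta> * t)" using \<eta> by (simp add: field_simps)
    then have "Q * exp (- \<theta> * t) \<le> \<eta>" by (simp add: exp_minus field_simps)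
    moreover have "cmod (\<kappa> t) \<le> Q * exp (- \<theta> * t)"
      unfolding \<kappa>_def norm_mult using Q(1) Q(2)[of t] that by (intro mult_mono) (auto simp: abs_le_iff)
    ultimately show ?thesis by linarith
  qed
  \<comment> \<open>The unknown is w(x) = exp(-\<theta> x) u(x), for which the kernel becomes
    \<open>\<kappa>\<close>; contraction for \<open>w\<close> in the plain sup norm is the weighted
    contraction for u.\<close>
  define \<Psi> where "\<Psi> w x = of_real (exp (- \<theta> * x)) * f x + S (\<lambda>y. \<kappa> (x - clamp_R y) * apply_bcontfun w y)"
    for w :: "real \<Rightarrow>\<^sub>C complex" and x
  have F_cont: "continuous_on UNIV (\<lambda>y. \<kappa> (x - clamp_R y) * apply_bcontfun w y)" for w :: "real \<Rightarrow>\<^sub>C complex" and x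
    by (intro continuous_intros continuous_on_compose2[OF \<kappa>_cont] clamp_R) auto
  have F_meas: "(\<lambda>y. \<kappa> (x - clamp_R y) * apply_bcontfun w y) \<in> borel_measurable borel" for w :: "real \<Rightarrow>\<^sub>C complex" and x
    by (rule borel_measurable_continuous_onI[OF F_cont])
  have dom: "\<exists>D. \<forall>x y. \<bar>x - x0\<bar> \<le> L \<longrightarrow> cmod (\<kappa> (x - clamp_R y) * apply_bcontfun w y) \<le> D"
    for w :: "real \<Rightarrow>\<^sub>C complex" and x0 L :: real
  proof -
    define N where "N = \<bar>x0\<bar> + \<bar>L\<bar> + R"
    have "compact (\<kappa> ` {-N..N})"
      by (intro compact_continuous_image continuous_on_subset[OF \<kappa>_cont]) auto
    then obtain D where D: "D > 0" "\<forall>y \<in> \<kappa> ` {-N..N}. cmod y \<le> D"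
      using compact_imp_bounded bounded_pos by metis
    have "cmod (\<kappa> (x - clamp_R y) * apply_bcontfun w y) \<le> D * norm w" if "\<bar>x - x0\<bar> \<le> L" for x y
    proof -
      have "x - clamp_R y \<in> {-N..N}" using that clamp_R(1)[of y] by (auto simp: N_def)
      then show ?thesis unfolding norm_mult using D norm_bounded[of w y] by (intro mult_mono) auto
    qed
    then show ?thesis by blast
  qed
  have \<Psi>_cont: "continuous_on UNIV (\<Psi> w)" for w
  proof -
    have "continuous_on UNIV (\<lambda>x. LINT y|Vp. \<kappa> (x - clamp_R y) * apply_bcontfun w y)"
    proof (rule continuous_param_integral)
      show "(\<lambda>y. \<kappa> (x - clamp_R y) * apply_bcontfun w y) \<in> borel_measurable Vp" for x
        using F_meas by simp
      show "continuous_on UNIV (\<lambda>x. \<kappa> (x - clamp_R y) * apply_bcontfun w y)" for y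
        by (intro continuous_intros continuous_on_compose2[OF \<kappa>_cont]) auto
      fix x0 L :: real
      obtain D where "\<forall>x y. \<bar>x - x0\<bar> \<le> L \<longrightarrow> cmod (\<kappa> (x - clamp_R y) * apply_bcontfun w y) \<le> D" using dom by blast
      then show "\<exists>d. integrable Vp d \<and> (\<forall>x y. \<bar>x - x0\<bar> \<le> L \<longrightarrow> cmod (\<kappa> (x - clamp_R y) * apply_bcontfun w y) \<le> d y)"
        by (intro exI[of _ "\<lambda>y. D"]) auto
    qed
    moreover have "continuous_on UNIV (\<lambda>x. LINT y|Vn. \<kappa> (x - clamp_R y) * apply_bcontfun w y)"
    proof (rule continuous_param_integral)
      show "(\<lambda>y. \<kappa> (x - clamp_R y) * apply_bcontfun w y) \<in> borel_measurable Vn" for x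
        using F_meas by simp
      show "continuous_on UNIV (\<lambda>x. \<kappa> (x - clamp_R y) * apply_bcontfun w y)" for y
        by (intro continuous_intros continuous_on_compose2[OF \<kappa>_cont]) auto
      fix x0 L :: real
      obtain D where "\<forall>x y. \<bar>x - x0\<bar> \<le> L \<longrightarrow> cmod (\<kappa> (x - clamp_R y) * apply_bcontfun w y) \<le> D" using dom by blast
      then show "\<exists>d. integrable Vn d \<and> (\<forall>x y. \<bar>x - x0\<bar> \<le> L \<longrightarrow> cmod (\<kappa> (x - clamp_R y) * apply_bcontfun w y) \<le> d y)"
        by (intro exI[of _ "\<lambda>y. D"]) auto
    qed
    ultimately show ?thesis
      unfolding \<Psi>_def[abs_def] signed_integral_def by (intro continuous_intros f)
  qed
  define \<Phi> where "\<Phi> w = Bcontfun (\<lambda>x. \<Psi> w (clamp_R x))" for w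
  have \<Psi>_bc: "(\<lambda>x. \<Psi> w (clamp_R x)) \<in> bcontfun" for w
  proof -
    have "compact (\<Psi> w ` {-R..R})"
      by (intro compact_continuous_image continuous_on_subset[OF \<Psi>_cont]) auto
    then obtain D where D: "\<forall>y \<in> \<Psi> w ` {-R..R}. cmod y \<le> D"
      using compact_imp_bounded bounded_pos by metis
    show ?thesis
    proof (rule bcontfun_normI)
      show "continuous_on UNIV (\<lambda>x. \<Psi> w (clamp_R x))"
        by (intro continuous_on_compose2[OF \<Psi>_cont] clamp_R) auto
      show "norm (\<Psi> w (clamp_R x)) \<le> D" for x
        using D clamp_R(1)[of x] by (auto simp: abs_le_iff)
    qed
  qed
  have \<Phi>: "apply_bcontfun (\<Phi> w) x = \<Psi> w (clamp_R x)" for w x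
    unfolding \<Phi>_def by (simp add: Bcontfun_inverse[OF \<Psi>_bc])
  have contr: "dist (\<Phi> w) (\<Phi> w') \<le> 1 / 2 * dist w w'" for w w'
  proof (rule dist_bound)
    fix x
    define t where "t = clamp_R x"
    have t: "\<bar>t\<bar> \<le> R" unfolding t_def by (rule clamp_R)
    obtain D where D: "\<And>y. cmod (\<kappa> (t - clamp_R y) * apply_bcontfun w y) \<le> D" using dom[of t 0 w] by auto
    obtain D' where D': "\<And>y. cmod (\<kappa> (t - clamp_R y) * apply_bcontfun w' y) \<le> D'" using dom[of t 0 w'] by auto
    have "\<Psi> w t - \<Psi> w' t = S (\<lambda>y. \<kappa> (t - clamp_R y) * apply_bcontfun w y - \<kappa> (t - clamp_R y) * apply_bcontfun w' y)"
      unfolding \<Psi>_def by (subst S_diff[OF F_meas D F_meas D']) simp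
    also have "cmod \<dots> \<le> (\<eta> * dist w w') * (measure Vp UNIV + measure Vn UNIV)"
    proof (rule S_norm_le)
      show "(\<lambda>y. \<kappa> (t - clamp_R y) * apply_bcontfun w y - \<kappa> (t - clamp_R y) * apply_bcontfun w' y) \<in> borel_measurable borel"
        by (intro borel_measurable_diff F_meas)
      fix y
      have "\<bar>t - clamp_R y\<bar> \<le> 2 * R" using t clamp_R(1)[of y] by linarith
      then show "cmod (\<kappa> (t - clamp_R y) * apply_bcontfun w y - \<kappa> (t - clamp_R y) * apply_bcontfun w' y) \<le> \<eta> * dist w w'"
        unfolding right_diff_distrib[symmetric] norm_mult
        using \<kappa> dist_bounded[of w y w'] \<eta> by (intro mult_mono) (auto simp: dist_norm)
    qed
    also have "\<dots> = \<eta> * m * dist w w'" by (simp add: m_def algebra_simps)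
    also have "\<dots> \<le> 1 / 2 * dist w w'" using \<eta> by (intro mult_right_mono) auto
    finally show "dist (apply_bcontfun (\<Phi> w) x) (apply_bcontfun (\<Phi> w') x) \<le> 1 / 2 * dist w w'"
      unfolding \<Phi> t_def[symmetric] dist_norm .
  qed
  have "\<exists>!w. \<Phi> w = w"
    by (rule banach_fix_type[where c = "1 / 2"]) (use contr in auto)
  then obtain w where w: "\<Phi> w = w" by blast
  define u where "u x = of_real (exp (\<theta> * clamp_R x)) * apply_bcontfun w x" for x
  have u_cont: "continuous_on UNIV u" unfolding u_def by (intro continuous_intros clamp_R continuous_on_apply_bcontfun)
  have u_bd: "cmod (u x) \<le> exp (\<theta> * R) * norm w" for x
    unfolding u_def norm_mult using clamp_R(1)[of x] \<theta> norm_bounded[of w x] by (intro mult_mono) auto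
  have "u x = f x + S (\<lambda>y. q (x - y) * u y)" if x: "\<bar>x\<bar> \<le> R" for x
  proof -
    have "apply_bcontfun w x = \<Psi> w x" using \<Phi>[of w x] w clamp_R(2)[OF x] by simp
    then have "u x = of_real (exp (\<theta> * x)) * \<Psi> w x" by (simp add: u_def clamp_R(2)[OF x])
    also have "\<dots> = f x + of_real (exp (\<theta> * x)) * S (\<lambda>y. \<kappa> (x - clamp_R y) * apply_bcontfun w y)"
      unfolding \<Psi>_def distrib_left by (simp add: exp_minus flip: of_real_mult)
    also have "of_real (exp (\<theta> * x)) * S (\<lambda>y. \<kappa> (x - clamp_R y) * apply_bcontfun w y)
        = S (\<lambda>y. of_real (exp (\<theta> * x)) * (\<kappa> (x - clamp_R y) * apply_bcontfun w y))"
      by (rule S_cmult[symmetric])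
    also have "\<dots> = S (\<lambda>y. q (x - y) * u y)"
    proof (rule S_cong)
      show "(\<lambda>y. of_real (exp (\<theta> * x)) * (\<kappa> (x - clamp_R y) * apply_bcontfun w y)) \<in> borel_measurable borel"
        using F_meas by simp
      show "(\<lambda>y. q (x - y) * u y) \<in> borel_measurable borel"
        by (intro borel_measurable_continuous_onI continuous_intros u_cont continuous_on_compose2[OF q]) auto
      fix y assume y: "\<bar>y\<bar> \<le> R"
      have "exp (\<theta> * x) * exp (- \<theta> * (x - y)) = exp (\<theta> * y)"
        unfolding exp_add[symmetric] by (simp add: algebra_simps)
      then have "complex_of_real (exp (\<theta> * x)) * of_real (exp (- \<theta> * (x - y))) = of_real (exp (\<theta> * y))"
        by (simp only: of_real_mult[symmetric])
      then show "of_real (exp (\<theta> * x)) * (\<kappa> (x - clamp_R y) * apply_bcontfun w y) = q (x - y) * u y"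
        unfolding clamp_R(2)[OF y] \<kappa>_def u_def by (metis mult.assoc mult.left_commute)
    qed
    finally show ?thesis .
  qed
  then show ?thesis using u_cont u_bd by blast
qed

end

section \<open>Solvability of the full equation and the resolvent bound\<close>

context compact_signed_measure
begin

lemma S_diff_continuous:
  assumes "continuous_on UNIV f" "continuous_on UNIV g"
  shows "S (\<lambda>x. f x - g x) = S f - S g"
proof -
  have bd: "\<exists>B. \<forall>x. \<bar>x\<bar> \<le> R \<longrightarrow> cmod (F x) \<le> B" if "continuous_on UNIV F" for F :: "real \<Rightarrow> complex"
  proof -
    have "compact (F ` {-R..R})" by (intro compact_continuous_image continuous_on_subset[OF that]) auto
    then obtain B where "\<forall>y \<in> F ` {-R..R}. cmod y \<le> B"
      using compact_imp_bounded bounded_iff by metis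
    then show ?thesis by (intro exI[of _ B]) (auto simp: abs_le_iff)
  qed
  obtain B where B: "\<And>x. \<bar>x\<bar> \<le> R \<Longrightarrow> cmod (f x) \<le> B" using bd[OF assms(1)] by blast
  obtain C where C: "\<And>x. \<bar>x\<bar> \<le> R \<Longrightarrow> cmod (g x) \<le> C" using bd[OF assms(2)] by blast
  show ?thesis
    by (rule S_diff[OF borel_measurable_continuous_onI[OF assms(1)] B borel_measurable_continuous_onI[OF assms(2)] C])
qed

text \<open>Since \<open>exp (-\<mu>\<bar>x - y\<bar>)\<close> is \<open>exp (\<mu>(x - y))\<close> plus a Volterra kernel, the equation
  \<open>u = G g - G(u V)\<close> reduces to two Volterra equations and one scalar equation. The latter is
  solvable because its degeneracy would produce a solution of the homogeneous problem.\<close>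

lemma solution_exists:
  assumes Imz: "Im z \<noteq> 0" and h: "h > 0" and g: "g \<in> L2"
  shows "\<exists>u. solves_shifted V h z u g"
proof -
  \<comment> \<open>The principal root has nonnegative real part, and a purely imaginary root would
    make z real; so Re \<mu> > 0 and the kernel decays.\<close>
  define \<mu> where "\<mu> = csqrt (- z) / of_real h"
  have "Re (csqrt (- z)) \<noteq> 0"
  proof
    assume 0: "Re (csqrt (- z)) = 0"
    have "- z = csqrt (- z) * csqrt (- z)" using power2_csqrt[of "- z"] by (simp add: power2_eq_square)
    then have "Im (- z) = 2 * Re (csqrt (- z)) * Im (csqrt (- z))"
      by (metis Im_complex_div_lemma mult.commute mult.left_commute mult_2 times_complex.sel(2))
    then show False using Imz 0 by simp
  qed
  then have \<mu>: "Re \<mu> > 0" using csqrt_principal[of "- z"] h by (auto simp: \<mu>_def)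
  have \<mu>2: "- \<mu>\<^sup>2 * of_real (h\<^sup>2) = z" using h by (simp add: \<mu>_def power_divide)
  define c where "c = 1 / (2 * \<mu> * of_real (h\<^sup>2))"
  \<comment> \<open>The difference exp(\<mu> t) - exp(-\<mu> t) for t >= 0, continued by 0; writing
    it with \<open>max\<close> makes continuity immediate.\<close>
  define q where "q t = c * (exp (\<mu> * of_real (max 0 t)) - exp (- \<mu> * of_real (max 0 t)))" for t
  have q: "continuous_on UNIV q" unfolding q_def by (intro continuous_intros)
  have q0: "q t = 0" if "t \<le> 0" for t using that by (simp add: q_def max_def)
  define \<alpha> where "\<alpha> w = S (\<lambda>y. exp (- \<mu> * of_real y) * w y)" for w :: "real \<Rightarrow> complex"
  have kernel: "c * free_kernel \<mu> x y = c * exp (\<mu> * of_real x) * exp (- \<mu> * of_real y) - q (x - y)" for x y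
  proof -
    have e: "exp (\<mu> * of_real x) * exp (- \<mu> * of_real y) = exp (\<mu> * of_real (x - y))"
      by (simp add: exp_add[symmetric] algebra_simps)
    show ?thesis
      unfolding mult.assoc e by (cases "x \<le> y") (auto simp: q_def free_kernel_def algebra_simps max_def)
  qed
  have split: "c * S (\<lambda>y. free_kernel \<mu> x y * w y) = c * exp (\<mu> * of_real x) * \<alpha> w - S (\<lambda>y. q (x - y) * w y)"
    if w: "continuous_on UNIV w" for w x
  proof -
    have "c * S (\<lambda>y. free_kernel \<mu> x y * w y) = S (\<lambda>y. c * (free_kernel \<mu> x y * w y))" by (rule S_cmult[symmetric])
    also have "\<dots> = S (\<lambda>y. c * exp (\<mu> * of_real x) * (exp (- \<mu> * of_real y) * w y) - q (x - y) * w y)"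
      unfolding mult.assoc[symmetric] kernel left_diff_distrib by (simp only: mult.assoc)
    also have "\<dots> = S (\<lambda>y. c * exp (\<mu> * of_real x) * (exp (- \<mu> * of_real y) * w y)) - S (\<lambda>y. q (x - y) * w y)"
      by (intro S_diff_continuous continuous_intros w continuous_on_compose2[OF q]) auto
    finally show ?thesis unfolding S_cmult \<alpha>_def .
  qed
  interpret gl: green_potential lborel \<mu> "(LINT x|lborel. exp (- Re \<mu> * \<bar>x\<bar>)) + 1" g
    by (rule lborel_green_potential[OF \<mu> g])
  \<comment> \<open>Outside the Volterra part the unknown enters only through the number
    \<alpha>(u). \<open>u1\<close> is the response to the data, \<open>u2\<close> the response to
    exp(\<mu> x), and u = u1 - d u2 is a solution once d = c \<alpha>(u).\<close>
  have f1: "continuous_on UNIV (\<lambda>x. c * gl.pot x)" by (intro continuous_intros gl.pot_continuous)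
  obtain u1 K1 where u1: "continuous_on UNIV u1" "\<And>x. cmod (u1 x) \<le> K1"
    "\<And>x. \<bar>x\<bar> \<le> R \<Longrightarrow> u1 x = c * gl.pot x + S (\<lambda>y. q (x - y) * u1 y)"
    using volterra[OF q q0 f1] by blast
  have f2: "continuous_on UNIV (\<lambda>x. exp (\<mu> * complex_of_real x))" by (intro continuous_intros)
  obtain u2 K2 where u2: "continuous_on UNIV u2" "\<And>x. cmod (u2 x) \<le> K2"
    "\<And>x. \<bar>x\<bar> \<le> R \<Longrightarrow> u2 x = exp (\<mu> * of_real x) + S (\<lambda>y. q (x - y) * u2 y)"
    using volterra[OF q q0 f2] by blast
  \<comment> \<open>If this vanished, \<open>u2\<close> would satisfy the integral equation with g =
    0 and so be zero on [-R, R] by injectivity; but its Volterra equation at the origin would then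
    give u2(0) = 1.\<close>
  have nondeg: "1 + c * \<alpha> u2 \<noteq> 0"
  proof
    assume "1 + c * \<alpha> u2 = 0"
    then have a2: "c * \<alpha> u2 = - 1" by (simp add: add_eq_0_iff)
    define U where "U x = c * ((LINT y|lborel. free_kernel \<mu> x y * 0) - S (\<lambda>y. free_kernel \<mu> x y * u2 y))" for x
    have "U x = u2 x" if "\<bar>x\<bar> \<le> R" for x
    proof -
      have "U x = - (c * S (\<lambda>y. free_kernel \<mu> x y * u2 y))" by (simp add: U_def)
      also have "\<dots> = - ((c * \<alpha> u2) * exp (\<mu> * of_real x)) + S (\<lambda>y. q (x - y) * u2 y)"
        unfolding split[OF u2(1)] by (simp add: algebra_simps)
      also have "\<dots> = u2 x" unfolding a2 u2(3)[OF that] by simp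
      finally show ?thesis .
    qed
    note U = this
    have zero: "(\<lambda>x. 0) \<in> L2" by (simp add: L2_def)
    note sol = green_solution[OF \<mu> h zero borel_measurable_continuous_onI[OF u2(1)] u2(2) U_def[unfolded c_def] U]
    obtain U' v \<Gamma> d where U': "ode_solution V R h z (\<lambda>x. 0) U' v \<Gamma> d" "AE x in lborel. U x = U' x"
      using solution_ode[OF sol(2)[unfolded \<mu>2] zero h] by blast
    interpret o: ode_solution V R h z "\<lambda>x. 0" U' v \<Gamma> d by fact
    have "U' x = 0" for x by (rule o.trivial_if_homogeneous[OF Imz]) simp
    then have "AE x in lborel. U x = (\<lambda>x. 0) x" using U'(2) by simp
    then have "U = (\<lambda>x. 0)" by (intro AE_continuous_eq sol(1)) auto
    then have u20: "u2 x = 0" if "\<bar>x\<bar> \<le> R" for x using U[OF that] by simp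
    have "S (\<lambda>y. q (0 - y) * u2 y) = S (\<lambda>y. 0)"
      by (rule S_cong) (use u20 in \<open>auto intro!: borel_measurable_continuous_onI continuous_intros u2(1)
        continuous_on_compose2[OF q]\<close>)
    then have "u2 0 = 1" using u2(3)[of 0] R_pos by (simp add: signed_integral_def)
    then show False using u20[of 0] R_pos by simp
  qed
  \<comment> \<open>The scalar equation d = c (\<alpha>(u1) - d \<alpha>(u2)), solved for d.\<close>
  define d where "d = c * \<alpha> u1 / (1 + c * \<alpha> u2)"
  define u where "u x = u1 x - d * u2 x" for x
  have u_cont: "continuous_on UNIV u" unfolding u_def by (intro continuous_intros u1 u2)
  have u_bd: "cmod (u x) \<le> K1 + cmod d * K2" for x
    unfolding u_def by (rule order_trans[OF norm_triangle_ineq4])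
      (auto simp: norm_mult intro!: add_mono mult_left_mono u1 u2)
  have lin: "S (\<lambda>y. F y * u y) = S (\<lambda>y. F y * u1 y) - d * S (\<lambda>y. F y * u2 y)"
    if "continuous_on UNIV F" for F :: "real \<Rightarrow> complex"
  proof -
    have "S (\<lambda>y. F y * u y) = S (\<lambda>y. F y * u1 y - d * (F y * u2 y))"
      by (simp add: u_def right_diff_distrib mult.left_commute)
    also have "\<dots> = S (\<lambda>y. F y * u1 y) - S (\<lambda>y. d * (F y * u2 y))"
      by (intro S_diff_continuous continuous_intros that u1 u2)
    finally show ?thesis unfolding S_cmult .
  qed
  have \<alpha>u: "\<alpha> u = \<alpha> u1 - d * \<alpha> u2" unfolding \<alpha>_def by (rule lin) (intro continuous_intros)
  have d: "d = c * \<alpha> u" unfolding \<alpha>u using nondeg by (simp add: d_def field_simps)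
  define U where "U x = c * (gl.pot x - S (\<lambda>y. free_kernel \<mu> x y * u y))" for x
  have "U x = u x" if x: "\<bar>x\<bar> \<le> R" for x
  proof -
    have "S (\<lambda>y. q (x - y) * u y) = S (\<lambda>y. q (x - y) * u1 y) - d * S (\<lambda>y. q (x - y) * u2 y)"
      by (rule lin) (intro continuous_intros continuous_on_compose2[OF q], auto)
    then have "u x = c * gl.pot x - d * exp (\<mu> * of_real x) + S (\<lambda>y. q (x - y) * u y)"
      unfolding u_def[of x] u1(3)[OF x] u2(3)[OF x] by (simp add: right_diff_distrib distrib_left)
    also have "\<dots> = c * gl.pot x - c * S (\<lambda>y. free_kernel \<mu> x y * u y)"
      unfolding split[OF u_cont] using d by (simp add: algebra_simps)
    finally show ?thesis by (simp add: U_def right_diff_distrib)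
  qed
  from green_solution(2)[OF \<mu> h g borel_measurable_continuous_onI[OF u_cont] u_bd U_def[unfolded gl.pot_def c_def] this]
  show ?thesis unfolding \<mu>2 by blast
qed

lemma resolvent_bijective: "Im z \<noteq> 0 \<Longrightarrow> h > 0 \<Longrightarrow> P_shift_bijective V h z"
  unfolding P_shift_bijective_def using solution_exists solution_unique by metis

text \<open>\<open>resolvent\<close> picks some solution. It agrees almost everywhere with an
  absolutely continuous one, to which the exterior estimate applies, and the L^2 norm does not
  distinguish the two.\<close>

lemma resolvent_estimate:
  assumes E: "E > 0" and \<delta>: "\<delta> > 0" and h: "h > 0" "h * \<delta> \<le> 1 / 2" and \<epsilon>: "0 < \<epsilon>" "\<epsilon> \<le> 1"
    and z: "z = complex_of_real E - complex_of_real (\<sigma> * \<epsilon>) * \<i>" and \<sigma>: "\<sigma> \<in> {1, -1}"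
  shows "L2_opnorm (mult_op (weight \<delta>) \<circ> mult_op (exterior_ind R) \<circ> resolvent V h z
    \<circ> mult_op (exterior_ind R) \<circ> mult_op (weight \<delta>)) \<le> ennreal (res_const E \<delta> / h)"
  unfolding L2_opnorm_def
proof (rule SUP_least)
  fix f assume "f \<in> {f \<in> L2. L2_norm f \<le> 1}"
  then have f: "f \<in> L2" "L2_norm f \<le> 1" by auto
  have Imz: "Im z \<noteq> 0" using z \<sigma> \<epsilon> by auto
  have e: "cmod (of_real (ext_weight R \<delta> x)) \<le> 1" for x
    using ext_weight_bounds(1)[of R \<delta> x] ext_weight_bounds(2)[of \<delta> R x] \<delta> by simp
  define g where "g x = of_real (ext_weight R \<delta> x) * f x" for x
  have g: "g \<in> L2" unfolding g_def[abs_def] by (rule L2_bounded_mult[OF f(1) _ e]) simp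
  define u where "u = resolvent V h z g"
  have sol: "solves_shifted V h z u g"
    unfolding u_def resolvent_def by (rule someI_ex[OF solution_exists[OF Imz h(1) g]])
  then have u: "u \<in> L2" by (auto simp: solves_shifted_def P_domain_def H1_def)
  obtain U v \<Gamma> c where U: "ode_solution V R h z g U v \<Gamma> c" "AE x in lborel. u x = U x"
    using solution_ode[OF sol g h(1)] by blast
  interpret ode_solution V R h z g U v \<Gamma> c by fact
  define T where "T x = of_real (ext_weight R \<delta> x) * u x" for x
  have T: "T \<in> L2" unfolding T_def[abs_def] by (rule L2_bounded_mult[OF u _ e]) simp
  have "(LINT x|lborel. (cmod (T x))\<^sup>2) = (LINT x|lborel. (cmod (of_real (ext_weight R \<delta> x) * U x))\<^sup>2)"
  proof (rule integral_cong_AE)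
    show "AE x in lborel. (cmod (T x))\<^sup>2 = (cmod (of_real (ext_weight R \<delta> x) * U x))\<^sup>2"
      using U(2) by eventually_elim (simp add: T_def)
  qed (use L2_measurable[OF T] in auto)
  then have "L2_norm T = L2_norm (\<lambda>x. of_real (ext_weight R \<delta> x) * U x)" by (simp add: L2_norm_def)
  also have "\<dots> \<le> res_const E \<delta> / h * L2_norm f"
    by (rule exterior_estimate[OF E \<delta> h(2) \<epsilon> z \<sigma> f(1) g_def])
  also have "\<dots> \<le> res_const E \<delta> / h * 1"
    using f(2) E h by (intro mult_left_mono) (auto simp: res_const_def)
  finally have le: "L2_norm T \<le> res_const E \<delta> / h" by simp
  have gf: "mult_op (exterior_ind R) (mult_op (weight \<delta>) f) = g"
    by (simp add: fun_eq_iff mult_op_def g_def ext_weight_def)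
  have eq: "(mult_op (weight \<delta>) \<circ> mult_op (exterior_ind R) \<circ> resolvent V h z
    \<circ> mult_op (exterior_ind R) \<circ> mult_op (weight \<delta>)) f = T"
    unfolding comp_apply gf u_def[symmetric] by (simp add: fun_eq_iff mult_op_def T_def ext_weight_def)
  show "(if (mult_op (weight \<delta>) \<circ> mult_op (exterior_ind R) \<circ> resolvent V h z
    \<circ> mult_op (exterior_ind R) \<circ> mult_op (weight \<delta>)) f \<in> L2
    then ennreal (L2_norm ((mult_op (weight \<delta>) \<circ> mult_op (exterior_ind R) \<circ> resolvent V h z
    \<circ> mult_op (exterior_ind R) \<circ> mult_op (weight \<delta>)) f)) else \<infinity>) \<le> ennreal (res_const E \<delta> / h)"
    unfolding eq using T le by (simp add: ennreal_leI)
qed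

end

text \<open>Bijectivity is part of the conclusion because \<open>resolvent\<close> is defined by
  choice, and the norm bound speaks about an inverse only together with it. Here P - z = P - E + i
  \<sigma> \<epsilon>, so \<open>\<sigma>\<close> carries the choice of sign.\<close>

theorem theorem1p7:
  fixes \<delta> E R\<^sub>0 :: real
  assumes "\<delta> > 0" and "E > 0" and "R\<^sub>0 > 0"
  shows "\<exists>C>0. \<forall>V :: real \<Rightarrow> real set \<Rightarrow> real.
    (\<forall>h>0. finite_signed_borel_measure (V h) \<and> signed_supported_in (V h) {-R\<^sub>0..R\<^sub>0}) \<longrightarrow>
    (\<forall>\<epsilon> h :: real. \<forall>\<sigma>\<in>{1, -1 :: real}.
       0 < \<epsilon> \<longrightarrow> \<epsilon> \<le> 1 \<longrightarrow> 0 < h \<longrightarrow> h \<le> inverse 2 * inverse \<delta> * (1 + R\<^sub>0) powr (- \<delta>) \<longrightarrow>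
       (let z = complex_of_real E - complex_of_real (\<sigma> * \<epsilon>) * \<i>
        in P_shift_bijective (V h) h z \<and>
           L2_opnorm (mult_op (weight \<delta>) \<circ> mult_op (exterior_ind R\<^sub>0) \<circ> resolvent (V h) h z
                        \<circ> mult_op (exterior_ind R\<^sub>0) \<circ> mult_op (weight \<delta>))
             \<le> ennreal (C / h)))"
proof (intro exI[of _ "res_const E \<delta>"] conjI allI impI ballI)
  show "0 < res_const E \<delta>"
    unfolding res_const_def
    by (intro real_sqrt_gt_zero mult_pos_pos divide_pos_pos add_pos_nonneg divide_nonneg_pos) (use assms in auto)
next
  fix V :: "real \<Rightarrow> real set \<Rightarrow> real" and \<epsilon> h \<sigma> :: real
  assume V: "\<forall>h>0. finite_signed_borel_measure (V h) \<and> signed_supported_in (V h) {-R\<^sub>0..R\<^sub>0}"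
    and \<sigma>: "\<sigma> \<in> {1, -1}" and \<epsilon>: "0 < \<epsilon>" "\<epsilon> \<le> 1" and h: "0 < h"
    and h0: "h \<le> inverse 2 * inverse \<delta> * (1 + R\<^sub>0) powr (- \<delta>)"
  interpret compact_signed_measure "V h" R\<^sub>0
    by unfold_locales (use V h assms in auto)
  \<comment> \<open>This turns the bound on \<open>h\<close> into h \<delta> <= 1/2, the form in
    which the smallness of \<open>h\<close> enters the absorption argument.\<close>
  have "(1 + R\<^sub>0) powr (- \<delta>) \<le> 1"
    using powr_mono2'[of "- \<delta>" 1 "1 + R\<^sub>0"] assms by simp
  then have "inverse 2 * inverse \<delta> * (1 + R\<^sub>0) powr (- \<delta>) \<le> inverse 2 * inverse \<delta> * 1"
    using assms by (intro mult_left_mono) auto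
  then have h\<delta>: "h * \<delta> \<le> 1 / 2" using h0 assms by (simp add: field_simps)
  define z where "z = complex_of_real E - complex_of_real (\<sigma> * \<epsilon>) * \<i>"
  have "Im z \<noteq> 0" using \<sigma> \<epsilon> by (auto simp: z_def)
  then show "let z = complex_of_real E - complex_of_real (\<sigma> * \<epsilon>) * \<i>
        in P_shift_bijective (V h) h z \<and>
           L2_opnorm (mult_op (weight \<delta>) \<circ> mult_op (exterior_ind R\<^sub>0) \<circ> resolvent (V h) h z
                        \<circ> mult_op (exterior_ind R\<^sub>0) \<circ> mult_op (weight \<delta>))
             \<le> ennreal (res_const E \<delta> / h)"
    unfolding Let_def z_def[symmetric]
    using resolvent_bijective[OF _ h] resolvent_estimate[OF assms(2,1) h h\<delta> \<epsilon> z_def \<sigma>] by blast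
qed

end
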